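(* Let $q\in\mathbb{N}$, $\alpha\in(1,\infty)$, let $G$ be a locally compact abelian group with dual group $\Gamma$, let $\lambda$ be a Haar measure on the Borel $\sigma$-algebra $\mathcal{B}(\Gamma)$, let $S\subseteq G$ be nonempty, and let $M$ be a regular measure on $\mathcal{B}(\Gamma)$ with values in the positive semidefinite Hermitian complex $q\times q$ matrices, with singular part $M_s$ with respect to $\lambda$. If $G\setminus S$ is an AC-set, then $$L^\alpha(M_s)\subseteq\overline{\mathcal{T}(G\setminus S)},$$ where the closure is taken in $L^\alpha(M)$.
   Context: Regularity: a finite non-negative measure $\mu$ on $\mathcal{B}(\Gamma)$ is regular if for all $B\in\mathcal{B}(\Gamma)$ both $\mu(B)=\inf\{\mu(U): U \text{ open}, B\subseteq U\}$ and $\mu(B)=\sup\{\mu(K): K\text{ compact}, K\subseteq B\}$. A $\mathbb{C}$-valued measure is regular (absolutely continuous, singular) if its variation is regular (absolutely continuous, singular with respect to $\lambda$); vector- or matrix-valued measures are regular (absolutely continuous) if all their entries are. AC-set: for a regular $\mathbb{C}^q$-valued measure $\mu$ on $\mathcal{B}(\Gamma)$ let $\check\mu(x):=\int_\Gamma\langle\gamma,x\rangle\,\mu(d\gamma)$, $x\in G$, be its inverse Fourier-Stieltjes transform, where $\langle\gamma,x\rangle$ is the value of $\gamma\in\Gamma$ at $x$. A subset $E$ of $G$ is called an AC-set if for all regular $\mathbb{C}^q$-valued measures $\mu$ on $\mathcal{B}(\Gamma)$, the equality $\check\mu(x)=0$ for all $x\in E$ implies that $\mu$ is absolutely continuous.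 The space $L^\alpha(M)$: let $\tau$ be a $\sigma$-finite measure on $\mathcal{B}(\Gamma)$ such that $M$ is absolutely continuous with respect to $\tau$, and $P(\gamma)$ the orthoprojection in $\mathbb{C}^q$ onto the range of $(dM/d\tau)(\gamma)$. Measurable functions $f,g:\Gamma\to\mathbb{C}^q$ are $M$-equivalent if $Pf=Pg$ $\tau$-a.e. $L^\alpha(M)$ is the Banach space of ($M$-equivalence classes of) measurable $f$ with $\|f\|_\alpha:=\bigl[\int_\Gamma\|(dM/d\tau)^{1/\alpha}f\|^\alpha d\tau\bigr]^{1/\alpha}<\infty$, $\|\cdot\|$ being the Euclidean norm; it does not depend on $\tau$. Identification: with $M=M_a+M_s$ the Lebesgue decomposition with respect to $\lambda$, there is a Borel set $A$ with $M_a(A)=0$ and $M_s(\Gamma\setminus A)=0$; $L^\alpha(M_s)$ is identified with the subspace $\{1_Af: f\in L^\alpha(M)\}$ of $L^\alpha(M)$. Trigonometric polynomials: $\chi_x(\gamma):=\langle\gamma,x\rangle$. If $G\setminus S\neq\emptyset$, $\mathcal{T}(G\setminus S)$ is the linear space of all functions $\sum_{j=1}^n\chi_{x_j}u_j$ with $n\in\mathbb{N}$, $x_j\in G\setminus S$, $u_j\in\mathbb{C}^q$; if $G\setminus S=\emptyset$, it is $\{0\}$. *)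

theory Defs
  imports "HOL-Analysis.Analysis"
begin

section \<open>The dual group\<close>

typedef (overloaded) ('g::topological_ab_group_add) character =
  "{\<gamma> :: 'g \<Rightarrow> complex. continuous_on UNIV \<gamma> \<and> (\<forall>x. norm (\<gamma> x) = 1) \<and>
     (\<forall>x y. \<gamma> (x + y) = \<gamma> x * \<gamma> y)}"
  morphisms pairing Abs_character
  by (rule exI[of _ "\<lambda>_. 1"]) auto

setup_lifting type_definition_character

lemma norm_pairing [simp]: "norm (pairing \<gamma> x) = 1"
  and pairing_add: "pairing \<gamma> (x + y) = pairing \<gamma> x * pairing \<gamma> y"
  and continuous_on_pairing: "continuous_on A (pairing \<gamma>)"
  using pairing[of \<gamma>] by (auto intro: continuous_on_subset)

lemma pairing_neq_0 [simp]: "pairing \<gamma> x \<noteq> 0"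
  using norm_pairing[of \<gamma> x] by fastforce

text \<open>The group operation is pointwise multiplication, written additively.\<close>

instantiation character :: (topological_ab_group_add) ab_group_add
begin

lift_definition zero_character :: "'a character" is "\<lambda>_. 1" by auto

lift_definition plus_character :: "'a character \<Rightarrow> 'a character \<Rightarrow> 'a character"
  is "\<lambda>\<gamma> \<delta> x. \<gamma> x * \<delta> x"
  by (auto simp: norm_mult intro!: continuous_intros)

lift_definition uminus_character :: "'a character \<Rightarrow> 'a character"
  is "\<lambda>\<gamma> x. inverse (\<gamma> x)"
proof -
  fix \<gamma> :: "'a \<Rightarrow> complex"
  assume \<gamma>: "continuous_on UNIV \<gamma> \<and> (\<forall>x. norm (\<gamma> x) = 1) \<and> (\<forall>x y. \<gamma> (x + y) = \<gamma> x * \<gamma> y)"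
  then have "\<gamma> x \<noteq> 0" for x
    by (metis norm_zero zero_neq_one)
  with \<gamma> show "continuous_on UNIV (\<lambda>x. inverse (\<gamma> x)) \<and> (\<forall>x. norm (inverse (\<gamma> x)) = 1) \<and>
      (\<forall>x y. inverse (\<gamma> (x + y)) = inverse (\<gamma> x) * inverse (\<gamma> y))"
    by (simp add: norm_inverse continuous_on_inverse)
qed

definition minus_character :: "'a character \<Rightarrow> 'a character \<Rightarrow> 'a character"
  where "minus_character \<gamma> \<delta> = \<gamma> + - \<delta>"

instance
proof
  fix a b c :: "'a character"
  show "a + b + c = a + (b + c)" by transfer (simp add: mult.assoc)
  show "a + b = b + a" by transfer (simp add: mult.commute)
  show "0 + a = a" by transfer simp
  show "a - b = a + - b" by (rule minus_character_def)
  show "- a + a = 0"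
    by (rule pairing_inject[THEN iffD1])
      (simp add: plus_character.rep_eq uminus_character.rep_eq zero_character.rep_eq)
qed

end

text \<open>The topology is that of uniform convergence on compact subsets (equivalently, the
  compact-open topology).\<close>

instantiation character :: (topological_ab_group_add) topological_space
begin

definition open_character :: "'a character set \<Rightarrow> bool" where
  "open_character U \<longleftrightarrow> (\<forall>\<gamma>\<in>U. \<exists>K e. compact K \<and> 0 < e \<and>
     {\<delta>. \<forall>x\<in>K. norm (pairing \<delta> x - pairing \<gamma> x) < e} \<subseteq> U)"

instance
proof
  show "open (UNIV :: 'a character set)"
    unfolding open_character_def by (auto intro!: exI[of _ "{}"] exI[of _ 1])
next
  fix S T :: "'a character set"
  assume S: "open S" and T: "open T"
  show "open (S \<inter> T)"
    unfolding open_character_def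
  proof
    fix \<gamma> assume "\<gamma> \<in> S \<inter> T"
    with S T obtain K e L d where "compact K" "0 < e" "compact L" "0 < d"
      and "{\<delta>. \<forall>x\<in>K. norm (pairing \<delta> x - pairing \<gamma> x) < e} \<subseteq> S"
      and "{\<delta>. \<forall>x\<in>L. norm (pairing \<delta> x - pairing \<gamma> x) < d} \<subseteq> T"
      unfolding open_character_def by (meson IntD1 IntD2)
    then show "\<exists>K e. compact K \<and> 0 < e \<and>
        {\<delta>. \<forall>x\<in>K. norm (pairing \<delta> x - pairing \<gamma> x) < e} \<subseteq> S \<inter> T"
      by (intro exI[of _ "K \<union> L"] exI[of _ "min e d"]) auto
  qed
next
  fix \<K> :: "'a character set set"
  assume "\<forall>S\<in>\<K>. open S"
  then show "open (\<Union>\<K>)"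
    unfolding open_character_def by (meson UnionE Union_upper order_trans)
qed

end

lemma open_character_nbhd:
  fixes \<gamma> :: "'g::topological_ab_group_add character"
  assumes "compact K"
  shows "open {\<delta>. \<forall>x\<in>K. norm (pairing \<delta> x - pairing \<gamma> x) < e}"
  unfolding open_character_def
proof
  fix \<delta> assume \<delta>: "\<delta> \<in> {\<delta>. \<forall>x\<in>K. norm (pairing \<delta> x - pairing \<gamma> x) < e}"
  show "\<exists>L d. compact L \<and> 0 < d \<and> {\<eta>. \<forall>x\<in>L. norm (pairing \<eta> x - pairing \<delta> x) < d} \<subseteq>
      {\<delta>. \<forall>x\<in>K. norm (pairing \<delta> x - pairing \<gamma> x) < e}"
  proof (cases "K = {}")
    case True
    then show ?thesis by (auto intro!: exI[of _ "{}"] exI[of _ 1])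
  next
    case False
    have "continuous_on K (\<lambda>x. norm (pairing \<delta> x - pairing \<gamma> x))"
      by (intro continuous_intros continuous_on_pairing)
    with assms False obtain y where y: "y \<in> K"
      "\<And>x. x \<in> K \<Longrightarrow> norm (pairing \<delta> x - pairing \<gamma> x) \<le> norm (pairing \<delta> y - pairing \<gamma> y)"
      using continuous_attains_sup by meson
    define d where "d = e - norm (pairing \<delta> y - pairing \<gamma> y)"
    have "0 < d" using \<delta> y by (auto simp: d_def)
    moreover have "norm (pairing \<eta> x - pairing \<gamma> x) < e"
      if "\<forall>x\<in>K. norm (pairing \<eta> x - pairing \<delta> x) < d" "x \<in> K" for \<eta> x
    proof -
      have "norm (pairing \<eta> x - pairing \<gamma> x)
          \<le> norm (pairing \<eta> x - pairing \<delta> x) + norm (pairing \<delta> x - pairing \<gamma> x)"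
        using norm_triangle_ineq[of "pairing \<eta> x - pairing \<delta> x" "pairing \<delta> x - pairing \<gamma> x"]
        by simp
      also have "\<dots> < d + norm (pairing \<delta> y - pairing \<gamma> y)"
        using that y by (intro add_less_le_mono) auto
      finally show ?thesis by (simp add: d_def)
    qed
    ultimately show ?thesis using assms by blast
  qed
qed

lemma eventually_character_nbhd:
  fixes \<gamma> :: "'g::topological_ab_group_add character"
  assumes "compact K" "0 < e"
  shows "\<forall>\<^sub>F \<delta> in nhds \<gamma>. \<delta> \<in> {\<delta>. \<forall>x\<in>K. norm (pairing \<delta> x - pairing \<gamma> x) < e}"
  by (rule eventually_nhds_in_open[OF open_character_nbhd[OF assms(1)]]) (simp add: assms(2))

instance character :: (topological_ab_group_add) t2_space
proof
  fix \<gamma> \<delta> :: "'a character"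
  assume "\<gamma> \<noteq> \<delta>"
  then obtain x where x: "pairing \<gamma> x \<noteq> pairing \<delta> x"
    by (metis ext pairing_inject)
  define e where "e = norm (pairing \<gamma> x - pairing \<delta> x) / 2"
  have "0 < e" using x by (simp add: e_def)
  let ?N = "\<lambda>\<gamma>. {\<eta>. \<forall>y\<in>{x}. norm (pairing \<eta> y - pairing \<gamma> y) < e}"
  have "?N \<gamma> \<inter> ?N \<delta> = {}"
  proof (rule ccontr)
    assume "?N \<gamma> \<inter> ?N \<delta> \<noteq> {}"
    then obtain \<eta> where "norm (pairing \<eta> x - pairing \<gamma> x) < e" "norm (pairing \<eta> x - pairing \<delta> x) < e"
      by auto
    then show False
      using norm_triangle_ineq4[of "pairing \<eta> x - pairing \<delta> x" "pairing \<eta> x - pairing \<gamma> x"]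
      by (simp add: e_def)
  qed
  then show "\<exists>U V. open U \<and> open V \<and> \<gamma> \<in> U \<and> \<delta> \<in> V \<and> U \<inter> V = {}"
    using \<open>0 < e\<close> by (intro exI[of _ "?N \<gamma>"] exI[of _ "?N \<delta>"] conjI open_character_nbhd) auto
qed

instance character :: (topological_ab_group_add) topological_ab_group_add
proof
  fix \<gamma> \<delta> :: "'a character"
  show "LIM p (nhds \<gamma> \<times>\<^sub>F nhds \<delta>). fst p + snd p :> nhds (\<gamma> + \<delta>)"
  proof (rule topological_tendstoI)
    fix S :: "'a character set"
    assume "open S" "\<gamma> + \<delta> \<in> S"
    then obtain K e where K: "compact K" "0 < e"
      and sub: "{\<eta>. \<forall>x\<in>K. norm (pairing \<eta> x - pairing (\<gamma> + \<delta>) x) < e} \<subseteq> S"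
      unfolding open_character_def by meson
    let ?N = "\<lambda>\<gamma>. {\<eta>. \<forall>x\<in>K. norm (pairing \<eta> x - pairing \<gamma> x) < e / 2}"
    have "\<gamma>' + \<delta>' \<in> S" if "\<gamma>' \<in> ?N \<gamma>" "\<delta>' \<in> ?N \<delta>" for \<gamma>' \<delta>'
    proof -
      have "norm (pairing (\<gamma>' + \<delta>') x - pairing (\<gamma> + \<delta>) x) < e" if "x \<in> K" for x
      proof -
        have "pairing (\<gamma>' + \<delta>') x - pairing (\<gamma> + \<delta>) x =
            (pairing \<gamma>' x - pairing \<gamma> x) * pairing \<delta>' x + pairing \<gamma> x * (pairing \<delta>' x - pairing \<delta> x)"
          by (simp add: plus_character.rep_eq algebra_simps)
        then have "norm (pairing (\<gamma>' + \<delta>') x - pairing (\<gamma> + \<delta>) x) \<le>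
            norm (pairing \<gamma>' x - pairing \<gamma> x) + norm (pairing \<delta>' x - pairing \<delta> x)"
          using norm_triangle_ineq[of "(pairing \<gamma>' x - pairing \<gamma> x) * pairing \<delta>' x"
              "pairing \<gamma> x * (pairing \<delta>' x - pairing \<delta> x)"]
          by (simp add: norm_mult)
        also have "\<dots> < e / 2 + e / 2"
          using \<open>\<gamma>' \<in> ?N \<gamma>\<close> \<open>\<delta>' \<in> ?N \<delta>\<close> \<open>x \<in> K\<close> by (intro add_strict_mono) auto
        finally show ?thesis by simp
      qed
      then show ?thesis using sub by auto
    qed
    moreover have "eventually (\<lambda>\<eta>. \<eta> \<in> ?N \<gamma>) (nhds \<gamma>)" "eventually (\<lambda>\<eta>. \<eta> \<in> ?N \<delta>) (nhds \<delta>)"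
      using K by (intro eventually_character_nbhd; simp)+
    ultimately show "\<forall>\<^sub>F p in nhds \<gamma> \<times>\<^sub>F nhds \<delta>. fst p + snd p \<in> S"
      unfolding eventually_prod_filter
      by (intro exI[of _ "\<lambda>\<eta>. \<eta> \<in> ?N \<gamma>"] exI[of _ "\<lambda>\<eta>. \<eta> \<in> ?N \<delta>"]) simp
  qed
next
  fix \<gamma> :: "'a character"
  show "(uminus \<longlongrightarrow> - \<gamma>) (nhds \<gamma>)"
  proof (rule topological_tendstoI)
    fix S :: "'a character set"
    assume "open S" "- \<gamma> \<in> S"
    then obtain K e where K: "compact K" "0 < e"
      and sub: "{\<eta>. \<forall>x\<in>K. norm (pairing \<eta> x - pairing (- \<gamma>) x) < e} \<subseteq> S"
      unfolding open_character_def by meson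
    let ?N = "{\<eta>. \<forall>x\<in>K. norm (pairing \<eta> x - pairing \<gamma> x) < e}"
    have eq: "norm (pairing (- \<eta>) x - pairing (- \<gamma>) x) = norm (pairing \<eta> x - pairing \<gamma> x)" for \<eta> x
    proof -
      have "pairing (- \<eta>) x - pairing (- \<gamma>) x =
          (pairing \<gamma> x - pairing \<eta> x) / (pairing \<eta> x * pairing \<gamma> x)"
        by (simp add: uminus_character.rep_eq field_simps)
      then show ?thesis by (simp add: norm_divide norm_mult norm_minus_commute)
    qed
    have "eventually (\<lambda>\<eta>. \<eta> \<in> ?N) (nhds \<gamma>)"
      using K by (rule eventually_character_nbhd)
    then show "\<forall>\<^sub>F \<eta> in nhds \<gamma>. - \<eta> \<in> S"
      by (rule eventually_mono) (use sub eq in auto)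
  qed
qed

text \<open>Regularity is in the usual sense of Radon measures: outer on Borel sets, inner on open sets.
  No \<open>\<sigma>\<close>-finiteness is required.\<close>

definition haar_measure :: "'a::topological_ab_group_add measure \<Rightarrow> bool" where
  "haar_measure \<Lambda> \<longleftrightarrow>
     sets \<Lambda> = sets borel \<and> emeasure \<Lambda> UNIV \<noteq> 0 \<and>
     (\<forall>K. compact K \<longrightarrow> emeasure \<Lambda> K < \<infinity>) \<and>
     (\<forall>B\<in>sets borel. \<forall>c. emeasure \<Lambda> ((+) c ` B) = emeasure \<Lambda> B) \<and>
     (\<forall>B\<in>sets borel. emeasure \<Lambda> B = (INF U\<in>{U. open U \<and> B \<subseteq> U}. emeasure \<Lambda> U)) \<and>
     (\<forall>U. open U \<longrightarrow> emeasure \<Lambda> U = (SUP K\<in>{K. compact K \<and> K \<subseteq> U}. emeasure \<Lambda> K))"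

section \<open>Complex, vector and matrix measures\<close>

text \<open>These are represented by set functions; only the values on Borel sets matter. Entries are
  treated separately, a vector having entries \<open>\<mu> B $ i\<close> and a matrix \<open>M B $ i $ j\<close>.\<close>

definition vector_measure :: "('a::topological_space set \<Rightarrow> 'b::real_normed_vector) \<Rightarrow> bool" where
  "vector_measure \<mu> \<longleftrightarrow> (\<forall>A :: nat \<Rightarrow> 'a set. range A \<subseteq> sets borel \<longrightarrow> disjoint_family A \<longrightarrow>
     (\<lambda>n. \<mu> (A n)) sums \<mu> (\<Union>n. A n))"

definition variation :: "('a::topological_space set \<Rightarrow> complex) \<Rightarrow> 'a set \<Rightarrow> ennreal" where
  "variation \<mu> B =
     (SUP P\<in>{P. finite P \<and> partition_on B P \<and> P \<subseteq> sets borel}. \<Sum>C\<in>P. ennreal (norm (\<mu> C)))"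

definition regular_nonneg :: "('a::topological_space set \<Rightarrow> ennreal) \<Rightarrow> bool" where
  "regular_nonneg \<nu> \<longleftrightarrow> (\<forall>B\<in>sets borel.
     \<nu> B = (INF U\<in>{U. open U \<and> B \<subseteq> U}. \<nu> U) \<and>
     \<nu> B = (SUP K\<in>{K. compact K \<and> K \<subseteq> B}. \<nu> K))"

definition regular_cm :: "('a::topological_space set \<Rightarrow> complex) \<Rightarrow> bool" where
  "regular_cm \<mu> \<longleftrightarrow> vector_measure \<mu> \<and> regular_nonneg (variation \<mu>)"

definition abs_cont_cm :: "'a::topological_space measure \<Rightarrow> ('a set \<Rightarrow> complex) \<Rightarrow> bool" where
  "abs_cont_cm \<Lambda> \<mu> \<longleftrightarrow> (\<forall>B\<in>sets borel. emeasure \<Lambda> B = 0 \<longrightarrow> variation \<mu> B = 0)"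

definition singular_cm :: "'a::topological_space measure \<Rightarrow> ('a set \<Rightarrow> complex) \<Rightarrow> bool" where
  "singular_cm \<Lambda> \<mu> \<longleftrightarrow> (\<exists>N\<in>sets borel. emeasure \<Lambda> N = 0 \<and> variation \<mu> (- N) = 0)"

definition regular_vec :: "('a::topological_space set \<Rightarrow> complex^'q) \<Rightarrow> bool" where
  "regular_vec \<mu> \<longleftrightarrow> (\<forall>i. regular_cm (\<lambda>B. \<mu> B $ i))"

definition abs_cont_vec :: "'a::topological_space measure \<Rightarrow> ('a set \<Rightarrow> complex^'q) \<Rightarrow> bool" where
  "abs_cont_vec \<Lambda> \<mu> \<longleftrightarrow> (\<forall>i. abs_cont_cm \<Lambda> (\<lambda>B. \<mu> B $ i))"

definition regular_mat :: "('a::topological_space set \<Rightarrow> complex^'q^'q) \<Rightarrow> bool" where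
  "regular_mat M \<longleftrightarrow> (\<forall>i j. regular_cm (\<lambda>B. M B $ i $ j))"

definition abs_cont_mat :: "'a::topological_space measure \<Rightarrow> ('a set \<Rightarrow> complex^'q^'q) \<Rightarrow> bool" where
  "abs_cont_mat \<Lambda> M \<longleftrightarrow> (\<forall>i j. abs_cont_cm \<Lambda> (\<lambda>B. M B $ i $ j))"

definition singular_mat :: "'a::topological_space measure \<Rightarrow> ('a set \<Rightarrow> complex^'q^'q) \<Rightarrow> bool" where
  "singular_mat \<Lambda> M \<longleftrightarrow> (\<forall>i j. singular_cm \<Lambda> (\<lambda>B. M B $ i $ j))"

definition lebesgue_decomposition ::
  "'a::topological_space measure \<Rightarrow> ('a set \<Rightarrow> complex^'q^'q) \<Rightarrow>
   ('a set \<Rightarrow> complex^'q^'q) \<Rightarrow> ('a set \<Rightarrow> complex^'q^'q) \<Rightarrow> bool" where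
  "lebesgue_decomposition \<Lambda> M Ma Ms \<longleftrightarrow>
     vector_measure Ma \<and> vector_measure Ms \<and> (\<forall>B\<in>sets borel. M B = Ma B + Ms B) \<and>
     abs_cont_mat \<Lambda> Ma \<and> singular_mat \<Lambda> Ms"

text \<open>The positive part of the Jordan decomposition of a real measure; the negative part is the
  positive part of \<open>\<lambda>B. - \<nu> B\<close>. (\<open>ennreal\<close> truncates negative numbers to \<open>0\<close>, which does not affect
  the supremum because of \<open>C = {}\<close>.)\<close>

definition positive_part :: "('a::topological_space set \<Rightarrow> real) \<Rightarrow> 'a measure" where
  "positive_part \<nu> = measure_of UNIV (sets borel)
     (\<lambda>B. SUP C\<in>{C\<in>sets borel. C \<subseteq> B}. ennreal (\<nu> C))"

definition integral_cm ::
  "('a::topological_space set \<Rightarrow> complex) \<Rightarrow> ('a \<Rightarrow> complex) \<Rightarrow> complex" where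
  "integral_cm \<mu> f =
     (LINT \<gamma>|positive_part (\<lambda>B. Re (\<mu> B)). f \<gamma>) - (LINT \<gamma>|positive_part (\<lambda>B. - Re (\<mu> B)). f \<gamma>) +
     \<i> * ((LINT \<gamma>|positive_part (\<lambda>B. Im (\<mu> B)). f \<gamma>) - (LINT \<gamma>|positive_part (\<lambda>B. - Im (\<mu> B)). f \<gamma>))"

definition inverse_fourier_stieltjes ::
  "('g::topological_ab_group_add character set \<Rightarrow> complex^'q) \<Rightarrow> 'g \<Rightarrow> complex^'q" where
  "inverse_fourier_stieltjes \<mu> x = (\<chi> i. integral_cm (\<lambda>B. \<mu> B $ i) (\<lambda>\<gamma>. pairing \<gamma> x))"

text \<open>The type argument carries the dimension \<open>q\<close>.\<close>

definition AC_set ::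
  "'q::finite itself \<Rightarrow> 'g::topological_ab_group_add character measure \<Rightarrow> 'g set \<Rightarrow> bool" where
  "AC_set _ \<Lambda> E \<longleftrightarrow> (\<forall>\<mu> :: 'g character set \<Rightarrow> complex^'q.
     regular_vec \<mu> \<longrightarrow> (\<forall>x\<in>E. inverse_fourier_stieltjes \<mu> x = 0) \<longrightarrow> abs_cont_vec \<Lambda> \<mu>)"

section \<open>Positive semidefinite matrices\<close>

definition conj_transpose :: "complex^'n^'m \<Rightarrow> complex^'m^'n" where
  "conj_transpose A = (\<chi> i j. cnj (A $ j $ i))"

definition hermitian :: "complex^'q^'q \<Rightarrow> bool" where
  "hermitian A \<longleftrightarrow> conj_transpose A = A"

definition psd :: "complex^'q^'q \<Rightarrow> bool" where
  "psd A \<longleftrightarrow> hermitian A \<and> (\<forall>v. 0 \<le> Re (\<Sum>i\<in>UNIV. (A *v v) $ i * cnj (v $ i)))"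

definition unitary :: "complex^'q^'q \<Rightarrow> bool" where
  "unitary U \<longleftrightarrow> conj_transpose U ** U = mat 1 \<and> U ** conj_transpose U = mat 1"

definition diag_mat :: "('q \<Rightarrow> real) \<Rightarrow> complex^'q^'q" where
  "diag_mat d = (\<chi> i j. if i = j then complex_of_real (d i) else 0)"

text \<open>The power \<open>A\<^sup>r\<close> (\<open>r > 0\<close>) of a positive semidefinite matrix, through a spectral decomposition;
  note \<open>0 powr r = 0\<close>.\<close>

definition psd_powr :: "complex^'q^'q \<Rightarrow> real \<Rightarrow> complex^'q^'q" where
  "psd_powr A r = (THE B. \<exists>U d. unitary U \<and> (\<forall>i. 0 \<le> d i) \<and>
     A = U ** diag_mat d ** conj_transpose U \<and>
     B = U ** diag_mat (\<lambda>i. d i powr r) ** conj_transpose U)"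

definition range_projection :: "complex^'q^'q \<Rightarrow> complex^'q^'q" where
  "range_projection A =
     (THE P. hermitian P \<and> P ** P = P \<and> range (\<lambda>v. P *v v) = range (\<lambda>v. A *v v))"

section \<open>The space of functions that are \<open>\<alpha>\<close>-integrable with respect to a matrix measure\<close>

text \<open>A version of the Radon-Nikodym derivative \<open>dM/d\<tau>\<close>; it is determined up to a \<open>\<tau>\<close>-null set.\<close>

definition mat_deriv ::
  "'a::topological_space measure \<Rightarrow> ('a set \<Rightarrow> complex^'q^'q) \<Rightarrow> 'a \<Rightarrow> complex^'q^'q" where
  "mat_deriv \<tau> M = (SOME W. integrable \<tau> W \<and> (\<forall>B\<in>sets borel. (LINT \<gamma>:B|\<tau>. W \<gamma>) = M B))"

definition M_equiv ::
  "'a::topological_space measure \<Rightarrow> ('a set \<Rightarrow> complex^'q^'q) \<Rightarrow>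
   (('a \<Rightarrow> complex^'q) \<times> ('a \<Rightarrow> complex^'q)) set" where
  "M_equiv \<tau> M = {(f, g). f \<in> borel_measurable borel \<and> g \<in> borel_measurable borel \<and>
     (AE \<gamma> in \<tau>. range_projection (mat_deriv \<tau> M \<gamma>) *v f \<gamma> =
                 range_projection (mat_deriv \<tau> M \<gamma>) *v g \<gamma>)}"

definition L_integral ::
  "real \<Rightarrow> 'a::topological_space measure \<Rightarrow> ('a set \<Rightarrow> complex^'q^'q) \<Rightarrow> ('a \<Rightarrow> complex^'q) \<Rightarrow> ennreal"
  where "L_integral \<alpha> \<tau> M f =
     (\<integral>\<^sup>+\<gamma>. ennreal (norm (psd_powr (mat_deriv \<tau> M \<gamma>) (1 / \<alpha>) *v f \<gamma>) powr \<alpha>) \<partial>\<tau>)"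

definition L_norm ::
  "real \<Rightarrow> 'a::topological_space measure \<Rightarrow> ('a set \<Rightarrow> complex^'q^'q) \<Rightarrow> ('a \<Rightarrow> complex^'q) \<Rightarrow> real"
  where "L_norm \<alpha> \<tau> M f = enn2real (L_integral \<alpha> \<tau> M f) powr (1 / \<alpha>)"

definition L_functions ::
  "real \<Rightarrow> 'a::topological_space measure \<Rightarrow> ('a set \<Rightarrow> complex^'q^'q) \<Rightarrow> ('a \<Rightarrow> complex^'q) set"
  where "L_functions \<alpha> \<tau> M = {f \<in> borel_measurable borel. L_integral \<alpha> \<tau> M f < \<infinity>}"

definition L_space ::
  "real \<Rightarrow> 'a::topological_space measure \<Rightarrow> ('a set \<Rightarrow> complex^'q^'q) \<Rightarrow> ('a \<Rightarrow> complex^'q) set set"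
  where "L_space \<alpha> \<tau> M = L_functions \<alpha> \<tau> M // M_equiv \<tau> M"

definition L_dist ::
  "real \<Rightarrow> 'a::topological_space measure \<Rightarrow> ('a set \<Rightarrow> complex^'q^'q) \<Rightarrow>
   ('a \<Rightarrow> complex^'q) set \<Rightarrow> ('a \<Rightarrow> complex^'q) set \<Rightarrow> real" where
  "L_dist \<alpha> \<tau> M F H = L_norm \<alpha> \<tau> M (\<lambda>\<gamma>. (SOME f. f \<in> F) \<gamma> - (SOME h. h \<in> H) \<gamma>)"

text \<open>For \<open>1 \<le> \<alpha>\<close> and a positive semidefinite \<open>M\<close>, absolutely continuous with respect to the
  \<open>\<sigma>\<close>-finite \<open>\<tau>\<close>, \<open>L_dist\<close> is a metric on \<open>L_space\<close> and does not depend on the chosen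
  representatives.\<close>

definition L_topology ::
  "real \<Rightarrow> 'a::topological_space measure \<Rightarrow> ('a set \<Rightarrow> complex^'q^'q) \<Rightarrow> ('a \<Rightarrow> complex^'q) set topology"
  where "L_topology \<alpha> \<tau> M = Metric_space.mtopology (L_space \<alpha> \<tau> M) (L_dist \<alpha> \<tau> M)"

text \<open>The subspace \<open>{1\<^sub>A f}\<close>, which for \<open>A\<close> separating \<open>M\<^sub>a\<close> and \<open>M\<^sub>s\<close> is identified with the space
  belonging to \<open>M\<^sub>s\<close>.\<close>

definition L_restricted ::
  "real \<Rightarrow> 'a::topological_space measure \<Rightarrow> ('a set \<Rightarrow> complex^'q^'q) \<Rightarrow> 'a set \<Rightarrow>
   ('a \<Rightarrow> complex^'q) set set" where
  "L_restricted \<alpha> \<tau> M A =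
     {M_equiv \<tau> M `` {\<lambda>\<gamma>. indicator A \<gamma> *s f \<gamma>} | f. f \<in> L_functions \<alpha> \<tau> M}"

text \<open>The empty sum is allowed, so that \<open>E = {}\<close> yields \<open>{0}\<close>.\<close>

definition trig_polynomials ::
  "'g::topological_ab_group_add set \<Rightarrow> ('g character \<Rightarrow> complex^'q) set" where
  "trig_polynomials E = {\<lambda>\<gamma>. \<Sum>j<n. pairing \<gamma> (x j) *s u j |
     (n::nat) (x :: nat \<Rightarrow> 'g) (u :: nat \<Rightarrow> complex^'q). \<forall>j<n. x j \<in> E}"

definition trig_classes ::
  "'g::topological_ab_group_add character measure \<Rightarrow> ('g character set \<Rightarrow> complex^'q^'q) \<Rightarrow>
   'g set \<Rightarrow> ('g character \<Rightarrow> complex^'q) set set" where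
  "trig_classes \<tau> M E = (\<lambda>t. M_equiv \<tau> M `` {t}) ` trig_polynomials E"

end

theory Submission
  imports Defs
begin

text \<open>Let \<open>W = dM/d\<tau>\<close> and \<open>R = W\<^bsup>1/\<alpha>\<^esup>\<close>. The map \<open>f \<mapsto> R f\<close> embeds the normed space belonging to \<open>M\<close>
  isometrically into the space of \<open>\<alpha>\<close>-integrable functions from \<open>(\<Gamma>, \<tau>)\<close> to \<open>\<complex>\<^sup>q\<close>, so it has to be shown that
  \<open>F = R (1\<^sub>A f)\<close> lies in the closure of \<open>V = {R t}\<close>, where \<open>t\<close> runs through the trigonometric
  polynomials with frequencies outside \<open>S\<close>. By duality it suffices that every \<open>g\<close>, integrable to the
  conjugate exponent, that annihilates \<open>V\<close> also annihilates \<open>F\<close>.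

  Given such a \<open>g\<close>, let \<open>\<mu>\<close> be the vector measure whose entries have the \<open>\<tau>\<close>-densities \<open>cnj ((R g)\<^sub>i)\<close>.
  That \<open>g\<close> annihilates \<open>V\<close> says exactly that the inverse Fourier-Stieltjes transform of \<open>\<mu>\<close> vanishes
  outside \<open>S\<close> (\<open>fourier_coefficient_zero\<close>). The densities vanish wherever the trace of \<open>W\<close> does, so \<open>\<mu>\<close> is
  absolutely continuous with respect to the trace of \<open>M\<close> and inherits its regularity
  (\<open>regular_integral\<close>). The AC property therefore makes \<open>\<mu>\<close> absolutely continuous with respect to
  the Haar measure, that is, \<open>R g = 0\<close> almost everywhere on every Haar null set \<open>N\<close>
  (\<open>annihilator_vanishes_on_null_set\<close>). If \<open>N\<close> carries the singular part of \<open>M\<close>, then \<open>M (A - N) = 0\<close>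
  (\<open>singular_part_carrier\<close>), so that \<open>R = 0\<close> almost everywhere on \<open>A - N\<close>. In both cases
  \<open>g \<bullet> F = R g \<bullet> 1\<^sub>A f\<close> vanishes.

  The duality statement, \<open>Lp_approximable_if_annihilators_vanish\<close>, is proved without the Hahn-Banach
  theorem or a representation of the dual space. For exponents \<open>p > 1\<close> a sequence \<open>F - v\<^sub>n\<close> whose norms tend
  to the distance of \<open>F\<close> from \<open>V\<close> is Cauchy by uniform convexity; its limit \<open>h\<close> has minimal norm, and
  differentiating the norm at \<open>h\<close> shows that \<open>g = \<bar>h\<bar>\<^bsup>p-2\<^esup> h\<close> annihilates \<open>V\<close> and the limit
  \<open>F - h\<close> of the \<open>v\<^sub>n\<close>, so that
  the integral of \<open>g \<bullet> F\<close> is that of \<open>\<bar>h\<bar>\<^sup>p\<close>.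

  The objects in the statement are given by descriptions, and the properties that justify these are
  established first: a spectral theorem makes the fractional powers and range projections of
  positive semidefinite matrices explicit, the Weierstrass approximation theorem gives uniqueness and
  measurability of the powers, and the matrix density exists by the Radon-Nikodym theorem for the
  scalar measures \<open>v\<^sup>* M v\<close> together with polarisation.\<close>

section \<open>Convexity of powers of the norm\<close>

text \<open>Strict convexity of \<open>t \<mapsto> t\<^sup>p\<close> on the closed half line, in the form in which it extends to norms.\<close>

lemma powr_above_tangent:
  fixes p x y :: real
  assumes "1 < p" "0 \<le> x" "0 \<le> y" "x \<noteq> y"
  shows "y powr p + p * y powr (p - 1) * (x - y) < x powr p"
proof -
  consider "y = 0" | "x = 0" "0 < y" | "0 < x" "0 < y" using assms by linarith
  then show ?thesis
  proof cases
    case 1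
    then show ?thesis using assms by simp
  next
    case 2
    have "y powr p = y powr (p - 1) * y"
      using 2 powr_mult_base[of y "p - 1"] by (simp add: mult.commute)
    then show ?thesis using 2 assms by (simp add: algebra_simps)
  next
    case 3
    have der: "((\<lambda>t. t powr p) has_real_derivative p * t powr (p - 1)) (at t)" if "0 < t" for t
      using that by (auto intro!: derivative_eq_intros simp: powr_diff field_simps)
    consider "x < y" | "y < x" using assms by linarith
    then show ?thesis
    proof cases
      case 1
      obtain z where z: "x < z" "z < y" "y powr p - x powr p = (y - x) * (p * z powr (p - 1))"
        using MVT2[of x y "\<lambda>t. t powr p" "\<lambda>t. p * t powr (p - 1)"] 1 3 der by auto
      have "z powr (p - 1) < y powr (p - 1)" using z 3 assms by (intro powr_less_mono2) auto
      then have "(y - x) * (p * z powr (p - 1)) < (y - x) * (p * y powr (p - 1))"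
        using 1 assms by simp
      then show ?thesis using z by (simp add: algebra_simps)
    next
      case 2
      obtain z where z: "y < z" "z < x" "x powr p - y powr p = (x - y) * (p * z powr (p - 1))"
        using MVT2[of y x "\<lambda>t. t powr p" "\<lambda>t. p * t powr (p - 1)"] 2 3 der by auto
      have "y powr (p - 1) < z powr (p - 1)" using z 3 assms by (intro powr_less_mono2) auto
      then have "(x - y) * (p * y powr (p - 1)) < (x - y) * (p * z powr (p - 1))"
        using 2 assms by simp
      then show ?thesis using z by (simp add: algebra_simps)
    qed
  qed
qed

text \<open>Up to the factor \<open>p\<close> this is the gradient of \<open>v \<mapsto> \<bar>v\<bar>\<^sup>p\<close>. At \<open>0\<close> it is \<open>0\<close>, the correct value for \<open>p > 1\<close>.\<close>

definition norm_powr_grad :: "real \<Rightarrow> 'e::real_inner \<Rightarrow> 'e" where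
  "norm_powr_grad p b = norm b powr (p - 2) *\<^sub>R b"

lemma norm_norm_powr_grad: "norm (norm_powr_grad p b) = norm b powr (p - 1)"
  using powr_mult_base[of "norm b" "p - 2"]
  by (simp add: norm_powr_grad_def mult.commute)

lemma norm_powr_grad_inner_self: "norm_powr_grad p b \<bullet> b = norm b powr p"
proof -
  have "norm b powr (p - 2) * (norm b * norm b) = norm b powr p"
    using powr_mult_base[of "norm b" "p - 2"] powr_mult_base[of "norm b" "p - 1"]
    by (simp add: algebra_simps)
  then show ?thesis
    by (simp add: norm_powr_grad_def dot_square_norm power2_eq_square)
qed

text \<open>For vectors of different lengths this follows from the scalar case and the Cauchy-Schwarz
  inequality; for equal lengths the Cauchy-Schwarz inequality is itself strict.\<close>

lemma norm_powr_above_tangent: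
  fixes a b :: "'e::real_inner"
  assumes p: "1 < p" and ab: "a \<noteq> b"
  shows "norm b powr p + p * (norm_powr_grad p b \<bullet> (a - b)) < norm a powr p"
proof -
  have self: "norm b powr p = norm b powr (p - 1) * norm b"
    using powr_mult_base[of "norm b" "p - 1"] by (simp add: mult.commute)
  have g: "norm_powr_grad p b \<bullet> a \<le> norm b powr (p - 1) * norm a"
    using norm_cauchy_schwarz[of "norm_powr_grad p b" a] by (simp add: norm_norm_powr_grad)
  have gd: "norm_powr_grad p b \<bullet> (a - b) = norm_powr_grad p b \<bullet> a - norm b powr p"
    by (simp add: inner_diff_right norm_powr_grad_inner_self)
  show ?thesis
  proof (cases "norm a = norm b")
    case False
    have "norm b powr p + p * norm b powr (p - 1) * (norm a - norm b) < norm a powr p"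
      using powr_above_tangent[OF p, of "norm a" "norm b"] False by simp
    moreover have "p * (norm_powr_grad p b \<bullet> a) \<le> p * (norm b powr (p - 1) * norm a)"
      using g p by simp
    ultimately show ?thesis unfolding gd right_diff_distrib by (simp add: self algebra_simps)
  next
    case True
    then have b0: "norm b > 0" using ab by auto
    have "0 < (norm (a - b))\<^sup>2" using ab by simp
    also have "(norm (a - b))\<^sup>2 = 2 * (norm b)\<^sup>2 - 2 * (b \<bullet> a)"
      using True norm_eq[of a b] by (simp add: power2_norm_eq_inner algebra_simps inner_commute)
    finally have "b \<bullet> a < b \<bullet> b" by (simp add: power2_norm_eq_inner)
    then have "norm_powr_grad p b \<bullet> a < norm b powr p"
      using b0 norm_powr_grad_inner_self[of p b]
      by (metis inner_scaleR_left mult_less_cancel_left_pos norm_powr_grad_def powr_gt_zero zero_less_norm_iff norm_not_less_zero less_irrefl)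
    then show ?thesis using p True by (simp add: gd mult_pos_neg)
  qed
qed

lemma norm_powr_above_tangent_weak:
  fixes a b :: "'e::real_inner"
  assumes p: "1 < p"
  shows "norm b powr p + p * (norm_powr_grad p b \<bullet> (a - b)) \<le> norm a powr p"
  using norm_powr_above_tangent[OF p, of a b] by (cases "a = b") auto

lemma norm_powr_convex:
  fixes a b :: "'e::real_inner"
  assumes "1 < p" "0 \<le> s" "0 \<le> t" "s + t = 1"
  shows "norm (s *\<^sub>R a + t *\<^sub>R b) powr p \<le> s * norm a powr p + t * norm b powr p"
proof -
  define m where "m = s *\<^sub>R a + t *\<^sub>R b"
  let ?G = "norm_powr_grad p m"
  have "s * (norm m powr p + p * (?G \<bullet> (a - m))) + t * (norm m powr p + p * (?G \<bullet> (b - m)))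
      \<le> s * norm a powr p + t * norm b powr p"
    using assms by (intro add_mono mult_left_mono norm_powr_above_tangent_weak) auto
  moreover have "s * (norm m powr p + p * (?G \<bullet> (a - m))) + t * (norm m powr p + p * (?G \<bullet> (b - m)))
      = (s + t) * norm m powr p + p * (?G \<bullet> (m - (s + t) *\<^sub>R m))"
    by (simp add: m_def algebra_simps inner_diff_right inner_add_right)
  ultimately show ?thesis using assms by (simp add: m_def)
qed

lemma norm_powr_midpoint_less:
  fixes a b :: "'e::real_inner"
  assumes p: "1 < p" and ab: "a \<noteq> b"
  shows "norm ((1/2) *\<^sub>R (a + b)) powr p < (norm a powr p + norm b powr p) / 2"
proof -
  define m where "m = (1/2) *\<^sub>R (a + b)"
  have "a - m = (1/2) *\<^sub>R (a - b)" "b - m = - ((1/2) *\<^sub>R (a - b))"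
    by (simp_all add: m_def algebra_simps) (simp_all flip: scaleR_left_distrib)
  moreover have "a \<noteq> m" "b \<noteq> m" using calculation ab by auto
  ultimately show ?thesis
    using norm_powr_above_tangent[OF p, of a m] norm_powr_above_tangent[OF p, of b m]
    by (simp flip: m_def add: inner_minus_right)
qed

lemma tendsto_norm_powr_grad:
  fixes f :: "'b \<Rightarrow> 'e::real_inner"
  assumes p: "1 < p" and f: "(f \<longlongrightarrow> l) F"
  shows "((\<lambda>x. norm_powr_grad p (f x)) \<longlongrightarrow> norm_powr_grad p l) F"
proof (cases "l = 0")
  case True
  have "((\<lambda>x. norm (f x) powr (p - 1)) \<longlongrightarrow> 0 powr (p - 1)) F"
    using tendsto_norm[OF f] True p
    by (intro tendsto_powr'[of _ 0 F "\<lambda>_. p - 1" "p - 1"]) (auto)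
  then have "((\<lambda>x. norm (norm_powr_grad p (f x))) \<longlongrightarrow> 0) F"
    by (simp add: norm_norm_powr_grad)
  then show ?thesis using True by (simp add: tendsto_norm_zero_iff norm_powr_grad_def[of p 0])
next
  case False
  then show ?thesis
    unfolding norm_powr_grad_def
    by (intro tendsto_intros f) auto
qed

lemma borel_measurable_norm_powr_grad [measurable]:
  fixes f :: "'b \<Rightarrow> 'e::euclidean_space"
  assumes [measurable]: "f \<in> borel_measurable M"
  shows "(\<lambda>x. norm_powr_grad p (f x)) \<in> borel_measurable M"
  unfolding norm_powr_grad_def by measurable

text \<open>Uniform convexity with a constant not given explicitly: by homogeneity only pairs with
  \<open>max \<bar>a\<bar> \<bar>b\<bar> = 1\<close> matter, and on the compact set of those with \<open>\<bar>a - b\<bar> \<ge> e\<close> the convexity gap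
  attains a positive minimum. This treats all exponents \<open>p > 1\<close> alike, unlike Clarkson's inequalities.\<close>

lemma uniform_convexity_powr:
  fixes e p :: real
  assumes p: "1 < p" and e: "0 < e"
  obtains d where "0 < d"
    "\<And>a b :: 'e::euclidean_space. e * max (norm a) (norm b) \<le> norm (a - b) \<Longrightarrow>
       d * max (norm a) (norm b) powr p \<le>
       (norm a powr p + norm b powr p) / 2 - norm ((1/2) *\<^sub>R (a + b)) powr p"
proof -
  define gap where "gap = (\<lambda>(a::'e, b::'e). (norm a powr p + norm b powr p) / 2 - norm ((1/2) *\<^sub>R (a + b)) powr p)"
  define K where "K = {z::'e\<times>'e. max (norm (fst z)) (norm (snd z)) = 1 \<and> e \<le> norm (fst z - snd z)}"
  have "closed K" unfolding K_def
    by (intro closed_Collect_conj closed_Collect_eq closed_Collect_le continuous_intros)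
  moreover have "bounded K"
  proof (rule boundedI)
    fix z assume "z \<in> K"
    then show "norm z \<le> 2" using norm_Pair_le[of "fst z" "snd z"] by (auto simp: K_def)
  qed
  ultimately have "compact K" by (simp add: compact_eq_bounded_closed)
  moreover have "continuous_on K gap"
    unfolding gap_def case_prod_unfold using p
    by (intro continuous_intros continuous_on_powr') auto
  ultimately obtain d where d: "0 < d" "\<And>z. z \<in> K \<Longrightarrow> d \<le> gap z"
  proof (cases "K = {}")
    case True
    then show ?thesis using that[of 1] by simp
  next
    case False
    then obtain z0 where "z0 \<in> K" "\<And>z. z \<in> K \<Longrightarrow> gap z0 \<le> gap z"
      using continuous_attains_inf[OF \<open>compact K\<close> False \<open>continuous_on K gap\<close>] by auto
    moreover have "0 < gap z0"
    proof -
      have "fst z0 \<noteq> snd z0" using \<open>z0 \<in> K\<close> e by (auto simp: K_def)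
      then show ?thesis
        using norm_powr_midpoint_less[OF p] by (auto simp: gap_def case_prod_unfold)
    qed
    ultimately show ?thesis using that by blast
  qed
  show thesis
  proof (rule that[OF \<open>0 < d\<close>])
    fix a b :: 'e
    assume ab: "e * max (norm a) (norm b) \<le> norm (a - b)"
    define m where "m = max (norm a) (norm b)"
    show "d * max (norm a) (norm b) powr p \<le>
       (norm a powr p + norm b powr p) / 2 - norm ((1/2) *\<^sub>R (a + b)) powr p"
    proof (cases "m = 0")
      case True
      then have "norm a = 0" "norm b = 0" unfolding m_def
        by (metis max.cobounded1 max.cobounded2 norm_le_zero_iff norm_zero)+
      then show ?thesis using p by simp
    next
      case False
      then have m: "0 < m" by (metis m_def less_eq_real_def max.coboundedI1 norm_ge_zero)
      let ?z = "(a /\<^sub>R m, b /\<^sub>R m)"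
      have "norm (a /\<^sub>R m - b /\<^sub>R m) = norm (a - b) / m"
        using m by (simp flip: scaleR_diff_right) (simp add: field_simps)
      moreover have "max (norm a / m) (norm b / m) = 1"
        using m by (auto simp: m_def max_def divide_simps)
      moreover have "norm (a /\<^sub>R m) = norm a / m" "norm (b /\<^sub>R m) = norm b / m"
        using m by (simp_all add: field_simps)
      ultimately have "?z \<in> K"
        using ab m unfolding K_def
        by (simp del: norm_scaleR add: m_def[symmetric] pos_le_divide_eq)
      then have "d \<le> gap ?z" by (rule d)
      also have "gap ?z = gap (a, b) / m powr p"
      proof -
        have "(1/2) *\<^sub>R (a /\<^sub>R m + b /\<^sub>R m) = ((1/2) *\<^sub>R (a + b)) /\<^sub>R m"
          by (simp add: algebra_simps)
        then have "norm ((1/2) *\<^sub>R (a /\<^sub>R m + b /\<^sub>R m)) = norm ((1/2) *\<^sub>R (a + b)) / m"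
          using m by (simp only: norm_scaleR) (simp add: field_simps)
        moreover have "norm (a /\<^sub>R m) = norm a / m" "norm (b /\<^sub>R m) = norm b / m"
          using m by (simp_all add: field_simps)
        ultimately show ?thesis
          using m by (simp add: gap_def powr_divide diff_divide_distrib add_divide_distrib ac_simps)
      qed
      finally show ?thesis using m
        by (simp add: gap_def m_def[symmetric] field_simps)
    qed
  qed
qed

text \<open>The pointwise estimate that will be integrated: up to a small multiple of the norms, the distance
  is controlled by the convexity gap.\<close>

lemma norm_diff_powr_le:
  fixes e p :: real
  assumes p: "1 < p" and e: "0 < e"
  obtains C where "0 \<le> C"
    "\<And>a b :: 'e::euclidean_space. norm (a - b) powr p \<le> e * (norm a powr p + norm b powr p) +
       C * ((norm a powr p + norm b powr p) / 2 - norm ((1/2) *\<^sub>R (a + b)) powr p)"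
proof -
  define r where "r = e powr (1 / p)"
  have r: "0 < r" "r powr p = e" using e p by (simp_all add: r_def powr_powr)
  obtain d where d: "0 < d"
    "\<And>a b :: 'e. r * max (norm a) (norm b) \<le> norm (a - b) \<Longrightarrow>
       d * max (norm a) (norm b) powr p \<le>
       (norm a powr p + norm b powr p) / 2 - norm ((1/2) *\<^sub>R (a + b)) powr p"
    using uniform_convexity_powr[OF p r(1)] by metis
  show thesis
  proof (rule that[of "2 powr p / d"])
    show "0 \<le> 2 powr p / d" using d by simp
    fix a b :: 'e
    define m where "m = max (norm a) (norm b)"
    define gap where "gap = (norm a powr p + norm b powr p) / 2 - norm ((1/2) *\<^sub>R (a + b)) powr p"
    have gap: "0 \<le> gap"
      using norm_powr_midpoint_less[OF p, of a b] p unfolding gap_def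
      by (cases "a = b") (auto simp flip: scaleR_2)
    have m: "0 \<le> m" "m powr p \<le> norm a powr p + norm b powr p"
      by (auto simp: m_def max_def)
    have "norm (a - b) powr p \<le> e * (norm a powr p + norm b powr p) + 2 powr p / d * gap"
    proof (cases "r * m \<le> norm (a - b)")
      case True
      have "norm (a - b) \<le> 2 * m"
        using norm_triangle_ineq4[of a b] by (simp add: m_def)
      then have "norm (a - b) powr p \<le> (2 * m) powr p" using p by (intro powr_mono2) auto
      also have "\<dots> = 2 powr p * m powr p" using m by (simp add: powr_mult)
      also have "\<dots> \<le> 2 powr p * (gap / d)"
        using d True by (intro mult_left_mono) (auto simp: gap_def m_def pos_le_divide_eq mult.commute)
      finally show ?thesis using e by (simp add: add_increasing)
    next
      case False
      then have "norm (a - b) powr p \<le> (r * m) powr p" using p by (intro powr_mono2) auto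
      also have "\<dots> = e * m powr p" using m r by (simp add: powr_mult)
      also have "\<dots> \<le> e * (norm a powr p + norm b powr p)" using m e by simp
      finally show ?thesis using gap d by (simp add: add_increasing2)
    qed
    then show "norm (a - b) powr p \<le> e * (norm a powr p + norm b powr p) +
       2 powr p / d * ((norm a powr p + norm b powr p) / 2 - norm ((1/2) *\<^sub>R (a + b)) powr p)"
      by (simp add: gap_def)
  qed
qed

section \<open>Spaces of vector-valued p-integrable functions\<close>

text \<open>The elements are functions rather than equivalence classes, and \<open>Lp_norm\<close> is only a seminorm on them.\<close>

definition Lp_functions :: "real \<Rightarrow> 'a measure \<Rightarrow> ('a \<Rightarrow> 'e::euclidean_space) set" where
  "Lp_functions p M = {f \<in> borel_measurable M. integrable M (\<lambda>x. norm (f x) powr p)}"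

definition Lp_norm :: "real \<Rightarrow> 'a measure \<Rightarrow> ('a \<Rightarrow> 'e::euclidean_space) \<Rightarrow> real" where
  "Lp_norm p M f = (LINT x|M. norm (f x) powr p) powr (1 / p)"

lemma Lp_functionsD:
  assumes "f \<in> Lp_functions p M"
  shows "f \<in> borel_measurable M" "integrable M (\<lambda>x. norm (f x) powr p)"
  using assms by (auto simp: Lp_functions_def)

lemma Lp_norm_nonneg [simp]: "0 \<le> Lp_norm p M f"
  by (simp add: Lp_norm_def)

lemma Lp_norm_powr: "1 < p \<Longrightarrow> Lp_norm p M f powr p = (LINT x|M. norm (f x) powr p)"
  by (simp add: Lp_norm_def powr_powr)

lemma Lp_norm_le_iff:
  assumes "1 < p" "0 \<le> c"
  shows "Lp_norm p M f \<le> c \<longleftrightarrow> (LINT x|M. norm (f x) powr p) \<le> c powr p"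
proof -
  have "Lp_norm p M f \<le> c \<longleftrightarrow> Lp_norm p M f powr p \<le> c powr p"
    using assms powr_mono2[of p "Lp_norm p M f" c] powr_less_mono2[of p c "Lp_norm p M f"]
    by (auto simp: not_le[symmetric])
  then show ?thesis by (simp add: Lp_norm_powr assms)
qed

lemma Lp_norm_minus_commute: "Lp_norm p M (\<lambda>x. f x - g x) = Lp_norm p M (\<lambda>x. g x - f x)"
  by (simp add: Lp_norm_def norm_minus_commute)

lemma Lp_scaleR:
  assumes "f \<in> Lp_functions p M"
  shows "(\<lambda>x. c *\<^sub>R f x) \<in> Lp_functions p M"
  using assms by (auto simp: Lp_functions_def powr_mult)

lemma Lp_norm_scaleR:
  assumes "1 < p"
  shows "Lp_norm p M (\<lambda>x. c *\<^sub>R f x) = \<bar>c\<bar> * Lp_norm p M f"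
  using assms by (simp add: Lp_norm_def powr_mult powr_powr)

lemma Lp_add:
  assumes p: "1 < p" and f: "f \<in> Lp_functions p M" and g: "g \<in> Lp_functions p M"
  shows "(\<lambda>x. f x + g x) \<in> Lp_functions p M"
proof -
  note [measurable] = Lp_functionsD(1)[OF f] Lp_functionsD(1)[OF g]
  have "norm (f x + g x) powr p \<le> (1/2) * (2 powr p * norm (f x) powr p) + (1/2) * (2 powr p * norm (g x) powr p)" for x
    using norm_powr_convex[OF p, of "1/2" "1/2" "2 *\<^sub>R f x" "2 *\<^sub>R g x"] by (simp add: powr_mult)
  moreover have "integrable M (\<lambda>x. (1/2) * (2 powr p * norm (f x) powr p) + (1/2) * (2 powr p * norm (g x) powr p))"
    by (intro Bochner_Integration.integrable_add integrable_mult_right Lp_functionsD(2)[OF f] Lp_functionsD(2)[OF g])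
  ultimately have "integrable M (\<lambda>x. norm (f x + g x) powr p)"
    by (rule_tac Bochner_Integration.integrable_bound) auto
  then show ?thesis by (simp add: Lp_functions_def)
qed

lemma Lp_diff:
  assumes p: "1 < p" and f: "f \<in> Lp_functions p M" and g: "g \<in> Lp_functions p M"
  shows "(\<lambda>x. f x - g x) \<in> Lp_functions p M"
  using Lp_add[OF p f Lp_scaleR[OF g, of "-1"]] by simp

text \<open>Minkowski's inequality: \<open>f + g\<close> is \<open>A + B\<close> times a convex combination of \<open>f / A\<close> and \<open>g / B\<close>.\<close>

lemma Lp_norm_triangle:
  assumes p: "1 < p" and f: "f \<in> Lp_functions p M" and g: "g \<in> Lp_functions p M"
  shows "Lp_norm p M (\<lambda>x. f x + g x) \<le> Lp_norm p M f + Lp_norm p M g"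
proof (rule field_le_epsilon)
  fix e :: real assume e: "0 < e"
  \<comment> \<open>The slack keeps the denominators positive when a norm is zero.\<close>
  define A where "A = Lp_norm p M f + e / 2"
  define B where "B = Lp_norm p M g + e / 2"
  have AB: "0 < A" "0 < B" using e by (auto simp: A_def B_def add_nonneg_pos)
  define s where "s = A / (A + B)"
  define t where "t = B / (A + B)"
  have st: "0 \<le> s" "0 \<le> t" "s + t = 1" using AB by (auto simp: s_def t_def simp flip: add_divide_distrib)
  let ?I = "\<lambda>f. LINT x|M. norm (f x) powr p"
  have IA: "?I f \<le> A powr p" "?I g \<le> B powr p"
    using e AB by (auto simp flip: Lp_norm_le_iff[OF p] simp: A_def B_def)
  have "norm (f x + g x) powr p \<le>
      (A + B) powr p * (s * (norm (f x) powr p / A powr p) + t * (norm (g x) powr p / B powr p))" for x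
  proof -
    have "f x + g x = (A + B) *\<^sub>R (s *\<^sub>R (f x /\<^sub>R A) + t *\<^sub>R (g x /\<^sub>R B))"
      using AB by (simp add: s_def t_def scaleR_add_right)
    then have "norm (f x + g x) powr p = (A + B) powr p * norm (s *\<^sub>R (f x /\<^sub>R A) + t *\<^sub>R (g x /\<^sub>R B)) powr p"
      using AB by (simp add: powr_mult)
    also have "\<dots> \<le> (A + B) powr p * (s * norm (f x /\<^sub>R A) powr p + t * norm (g x /\<^sub>R B) powr p)"
      by (intro mult_left_mono norm_powr_convex p st) auto
    finally show ?thesis using AB by (simp add: powr_mult inverse_powr divide_inverse mult.commute powr_minus)
  qed
  then have "?I (\<lambda>x. f x + g x) \<le> (LINT x|M. (A + B) powr p * (s * (norm (f x) powr p / A powr p) + t * (norm (g x) powr p / B powr p)))"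
    by (intro integral_mono Lp_functionsD[OF Lp_add[OF p f g]] integrable_mult_right Bochner_Integration.integrable_add
        integrable_divide_zero Lp_functionsD[OF f] Lp_functionsD[OF g] impI)
  also have "\<dots> = (A + B) powr p * (s * (?I f / A powr p) + t * (?I g / B powr p))"
    using Lp_functionsD(2)[OF f] Lp_functionsD(2)[OF g] by simp
  also have "\<dots> \<le> (A + B) powr p * (s * 1 + t * 1)"
    using IA st AB by (intro mult_left_mono add_mono) auto
  finally have "?I (\<lambda>x. f x + g x) \<le> (A + B) powr p" using st by simp
  then have "Lp_norm p M (\<lambda>x. f x + g x) \<le> A + B"
    using AB by (simp add: Lp_norm_le_iff[OF p])
  then show "Lp_norm p M (\<lambda>x. f x + g x) \<le> Lp_norm p M f + Lp_norm p M g + e"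
    by (simp add: A_def B_def)
qed

lemma Lp_norm_triangle3:
  assumes p: "1 < p" and "f \<in> Lp_functions p M" "g \<in> Lp_functions p M" "h \<in> Lp_functions p M"
  shows "Lp_norm p M (\<lambda>x. f x - h x) \<le> Lp_norm p M (\<lambda>x. f x - g x) + Lp_norm p M (\<lambda>x. g x - h x)"
  using Lp_norm_triangle[OF p Lp_diff[OF p, of f M g] Lp_diff[OF p, of g M h]] assms by simp

lemma nn_integral_norm_powr_Lp:
  assumes "f \<in> Lp_functions p M"
  shows "(\<integral>\<^sup>+x. ennreal (norm (f x) powr p) \<partial>M) = ennreal (LINT x|M. norm (f x) powr p)"
  using Lp_functionsD[OF assms] by (intro nn_integral_eq_integral) auto

lemma Lp_functions_iff_nn_integral:
  "f \<in> Lp_functions p M \<longleftrightarrow> f \<in> borel_measurable M \<and> (\<integral>\<^sup>+x. ennreal (norm (f x) powr p) \<partial>M) < \<infinity>"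
  unfolding Lp_functions_def by (auto simp: integrable_iff_bounded)

lemma suminf_ennreal_finite_bound:
  fixes u :: "nat \<Rightarrow> ennreal"
  assumes "(\<Sum>k. u k) \<noteq> \<infinity>"
  obtains c where "0 \<le> c" "\<And>k. u k \<le> ennreal c"
proof -
  obtain c where "0 \<le> c" "(\<Sum>k. u k) = ennreal c"
    using assms by (cases "\<Sum>k. u k") auto
  moreover have "u k \<le> (\<Sum>k. u k)" for k
    using sum_le_suminf[of u "{k}"] by simp
  ultimately show thesis using that by metis
qed

text \<open>The Riesz-Fischer theorem: a rapidly Cauchy subsequence converges almost everywhere, and Fatou's
  lemma identifies the limit.\<close>

lemma Lp_complete:
  fixes f :: "nat \<Rightarrow> 'a \<Rightarrow> 'e::euclidean_space"
  assumes p: "1 < p" and f: "\<And>n. f n \<in> Lp_functions p M"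
    and cauchy: "\<And>e. 0 < e \<Longrightarrow> \<exists>N. \<forall>m\<ge>N. \<forall>n\<ge>N. Lp_norm p M (\<lambda>x. f m x - f n x) < e"
  obtains h where "h \<in> Lp_functions p M" "(\<lambda>n. Lp_norm p M (\<lambda>x. f n x - h x)) \<longlonglongrightarrow> 0"
proof -
  note [measurable] = Lp_functionsD(1)[OF f]
  have "\<forall>k. \<exists>N. \<forall>m\<ge>N. \<forall>n\<ge>N. Lp_norm p M (\<lambda>x. f m x - f n x) < (1/4)^k"
    using cauchy by simp
  then obtain N where N: "\<And>k m n. N k \<le> m \<Longrightarrow> N k \<le> n \<Longrightarrow> Lp_norm p M (\<lambda>x. f m x - f n x) < (1/4)^k"
    by metis
  define r where "r k = (\<Sum>i\<le>k. Suc (N i))" for k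
  have r_ge: "N k \<le> r k" for k
    using member_le_sum[of k "{..k}" "\<lambda>i. Suc (N i)"] by (simp add: r_def)
  have r_Suc: "r k < r (Suc k)" for k by (simp add: r_def)
  then have r_mono: "strict_mono r" by (simp add: strict_mono_Suc_iff)
  define D where "D k x = f (r (Suc k)) x - f (r k) x" for k x
  have D_in: "D k \<in> Lp_functions p M" for k
    unfolding D_def by (intro Lp_diff p f)
  have [measurable]: "D k \<in> borel_measurable M" for k by (rule Lp_functionsD[OF D_in])
  have D_int: "(LINT x|M. norm (D k x) powr p) \<le> ((1/4)^k) powr p" for k
    using N[of k "r (Suc k)" "r k"] r_ge[of k] r_Suc[of k]
    by (subst Lp_norm_le_iff[OF p, symmetric]) (auto simp: D_def[abs_def])
  \<comment> \<open>The increments are so small (\<open>4\<^bsup>-k\<^esup>\<close>) that even after multiplication by \<open>2\<^sup>k\<close> their norms are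
    summable; so \<open>2\<^sup>k D\<^sub>k\<close> is bounded almost everywhere and the increments are summable pointwise.\<close>
  have "(\<integral>\<^sup>+x. (\<Sum>k. ennreal (norm (2^k *\<^sub>R D k x) powr p)) \<partial>M) =
      (\<Sum>k. \<integral>\<^sup>+x. ennreal (norm (2^k *\<^sub>R D k x) powr p) \<partial>M)"
    by (intro nn_integral_suminf) auto
  also have "\<dots> \<le> (\<Sum>k. ennreal (((1/2) powr p)^k))"
  proof (intro suminf_le)
    fix k
    have "(\<integral>\<^sup>+x. ennreal (norm (2^k *\<^sub>R D k x) powr p) \<partial>M) = ennreal (LINT x|M. norm (2^k *\<^sub>R D k x) powr p)"
      by (intro nn_integral_norm_powr_Lp Lp_scaleR D_in)
    also have "(LINT x|M. norm (2^k *\<^sub>R D k x) powr p) = (2^k) powr p * (LINT x|M. norm (D k x) powr p)"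
      by (simp add: powr_mult)
    also have "\<dots> \<le> (2^k) powr p * ((1/4)^k) powr p"
      by (intro mult_left_mono D_int) auto
    also have "\<dots> = ((1/2)^k) powr p"
      by (simp flip: powr_mult power_mult_distrib)
    also have "\<dots> = ((1/2) powr p)^k"
      by (simp add: powr_realpow[symmetric] powr_powr mult.commute)
    finally show "(\<integral>\<^sup>+x. ennreal (norm (2^k *\<^sub>R D k x) powr p) \<partial>M) \<le> ennreal (((1/2) powr p)^k)"
      by (simp add: ennreal_leI)
  qed auto
  also have "\<dots> < \<infinity>"
  proof -
    have "(1/2 :: real) powr p < 1" using gr_one_powr[of 2 p] p by (simp add: powr_divide)
    then have "summable (\<lambda>k. ((1/2::real) powr p)^k)" by (intro summable_geometric) auto
    then show ?thesis by (simp add: suminf_ennreal2 less_top)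
  qed
  finally have "AE x in M. (\<Sum>k. ennreal (norm (2^k *\<^sub>R D k x) powr p)) \<noteq> \<infinity>"
    by (intro nn_integral_PInf_AE) auto
  then have conv: "AE x in M. convergent (\<lambda>k. f (r k) x)"
  proof eventually_elim
    fix x assume fin: "(\<Sum>k. ennreal (norm (2^k *\<^sub>R D k x) powr p)) \<noteq> \<infinity>"
    obtain c where c: "0 \<le> c" "\<And>k. ennreal (norm (2^k *\<^sub>R D k x) powr p) \<le> ennreal c"
      using suminf_ennreal_finite_bound[OF fin] by metis
    have "norm (D k x) \<le> c powr (1/p) * (1/2)^k" for k
    proof -
      have "norm (2^k *\<^sub>R D k x) powr p \<le> c" using c(2)[of k] c(1) by (simp only: ennreal_le_iff)
      then have "(norm (2^k *\<^sub>R D k x) powr p) powr (1/p) \<le> c powr (1/p)"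
        using p by (intro powr_mono2) auto
      then show ?thesis using p by (simp add: powr_powr field_simps)
    qed
    moreover have "summable (\<lambda>k. c powr (1/p) * (1/2)^k)" by (intro summable_mult summable_geometric) auto
    ultimately have "summable (\<lambda>k. D k x)" by (rule summable_comparison_test'[of _ 0, rotated])
    then have "convergent (\<lambda>n. \<Sum>k<n. D k x)" by (simp add: summable_iff_convergent)
    moreover have "(\<Sum>k<n. D k x) = f (r n) x - f (r 0) x" for n
      unfolding D_def by (rule sum_lessThan_telescope)
    ultimately have "convergent (\<lambda>n. f (r n) x - f (r 0) x)" by simp
    then show "convergent (\<lambda>k. f (r k) x)"
      using convergent_add[OF _ convergent_const[of "f (r 0) x"]] by fastforce
  qed
  define h where "h x = lim (\<lambda>k. f (r k) x)" for x
  have [measurable]: "h \<in> borel_measurable M" unfolding h_def by measurable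
  have lim: "AE x in M. (\<lambda>k. f (r k) x) \<longlonglongrightarrow> h x"
    using conv by eventually_elim (simp add: h_def convergent_LIMSEQ_iff)
  have bound: "(\<integral>\<^sup>+x. ennreal (norm (f n x - h x) powr p) \<partial>M) \<le> ennreal (e powr p)"
    if e: "0 < e" and n: "\<And>m. n \<le> m \<Longrightarrow> Lp_norm p M (\<lambda>x. f n x - f m x) < e" for e n
  proof -
    have "(\<integral>\<^sup>+x. ennreal (norm (f n x - h x) powr p) \<partial>M) =
        (\<integral>\<^sup>+x. liminf (\<lambda>k. ennreal (norm (f n x - f (r k) x) powr p)) \<partial>M)"
    proof (rule nn_integral_cong_AE)
      show "AE x in M. ennreal (norm (f n x - h x) powr p) = liminf (\<lambda>k. ennreal (norm (f n x - f (r k) x) powr p))"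
        using lim
      proof eventually_elim
        fix x assume "(\<lambda>k. f (r k) x) \<longlonglongrightarrow> h x"
        then have "(\<lambda>k. ennreal (norm (f n x - f (r k) x) powr p)) \<longlonglongrightarrow> ennreal (norm (f n x - h x) powr p)"
          using p by (intro tendsto_ennrealI tendsto_powr' tendsto_norm tendsto_diff) auto
        then show "ennreal (norm (f n x - h x) powr p) = liminf (\<lambda>k. ennreal (norm (f n x - f (r k) x) powr p))"
          by (intro lim_imp_Liminf[symmetric]) auto
      qed
    qed
    also have "\<dots> \<le> liminf (\<lambda>k. \<integral>\<^sup>+x. ennreal (norm (f n x - f (r k) x) powr p) \<partial>M)"
      by (intro nn_integral_liminf) measurable
    also have "\<dots> \<le> ennreal (e powr p)"
    proof (intro Liminf_le)
      show "eventually (\<lambda>k. (\<integral>\<^sup>+x. ennreal (norm (f n x - f (r k) x) powr p) \<partial>M) \<le> ennreal (e powr p)) sequentially"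
        using eventually_ge_at_top[of n]
      proof eventually_elim
        fix k assume "n \<le> k"
        then have "n \<le> r k" using r_mono by (meson order_trans strict_mono_imp_increasing)
        then have "Lp_norm p M (\<lambda>x. f n x - f (r k) x) \<le> e" using n by (simp add: less_imp_le)
        then show "(\<integral>\<^sup>+x. ennreal (norm (f n x - f (r k) x) powr p) \<partial>M) \<le> ennreal (e powr p)"
          using e by (subst nn_integral_norm_powr_Lp[OF Lp_diff[OF p f f]])
            (simp add: Lp_norm_le_iff[OF p] ennreal_leI)
      qed
    qed auto
    finally show ?thesis .
  qed
  have h_diff: "(\<lambda>x. f n x - h x) \<in> Lp_functions p M" if "0 < e" "\<And>m. n \<le> m \<Longrightarrow> Lp_norm p M (\<lambda>x. f n x - f m x) < e" for e n
    using bound[OF that] by (auto simp: Lp_functions_iff_nn_integral intro: le_less_trans)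
  obtain n0 where n0: "\<And>m. n0 \<le> m \<Longrightarrow> Lp_norm p M (\<lambda>x. f n0 x - f m x) < 1"
    using cauchy[of 1] by auto
  have "(\<lambda>x. f n0 x - (f n0 x - h x)) \<in> Lp_functions p M"
    by (intro Lp_diff p f h_diff[OF _ n0]) auto
  then have h: "h \<in> Lp_functions p M" by simp
  moreover have "(\<lambda>n. Lp_norm p M (\<lambda>x. f n x - h x)) \<longlonglongrightarrow> 0"
  proof (rule LIMSEQ_I)
    fix e :: real assume "0 < e"
    then have e: "0 < e / 2" by simp
    then obtain K where K: "\<And>m n. K \<le> m \<Longrightarrow> K \<le> n \<Longrightarrow> Lp_norm p M (\<lambda>x. f m x - f n x) < e / 2"
      using cauchy by meson
    have "Lp_norm p M (\<lambda>x. f n x - h x) \<le> e / 2" if "K \<le> n" for n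
    proof -
      have "ennreal (LINT x|M. norm (f n x - h x) powr p) \<le> ennreal ((e/2) powr p)"
        using bound[OF e, of n] K[OF that] that
        by (subst nn_integral_norm_powr_Lp[OF Lp_diff[OF p f h], symmetric]) auto
      then show ?thesis using e by (subst Lp_norm_le_iff[OF p]) auto
    qed
    then have "\<forall>n\<ge>K. norm (Lp_norm p M (\<lambda>x. f n x - h x) - 0) < e"
      using \<open>0 < e\<close> by fastforce
    then show "\<exists>no. \<forall>n\<ge>no. norm (Lp_norm p M (\<lambda>x. f n x - h x) - 0) < e" by blast
  qed
  ultimately show thesis by (rule that)
qed

lemma Lp_norm_tendsto:
  assumes p: "1 < p" and f: "\<And>n. f n \<in> Lp_functions p M" and h: "h \<in> Lp_functions p M"
    and lim: "(\<lambda>n. Lp_norm p M (\<lambda>x. f n x - h x)) \<longlonglongrightarrow> 0"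
  shows "(\<lambda>n. Lp_norm p M (f n)) \<longlonglongrightarrow> Lp_norm p M h"
proof (rule Lim_transform2[OF tendsto_const])
  have z: "(\<lambda>_. 0) \<in> Lp_functions p M" by (simp add: Lp_functions_def)
  have "\<bar>Lp_norm p M h - Lp_norm p M (f n)\<bar> \<le> Lp_norm p M (\<lambda>x. f n x - h x)" for n
    using Lp_norm_triangle3[OF p f[of n] h z] Lp_norm_triangle3[OF p h f[of n] z]
      Lp_norm_minus_commute[of p M h "f n"] by simp
  then show "(\<lambda>n. Lp_norm p M h - Lp_norm p M (f n)) \<longlonglongrightarrow> 0"
    by (intro Lim_null_comparison[OF _ lim]) auto
qed

section \<open>Best approximation and annihilators\<close>

text \<open>The second fact bounds the integrands \<open>norm_powr_grad p (h + s w) \<bullet> w\<close> uniformly in \<open>\<bar>s\<bar> \<le> 1\<close> by an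
  integrable function, as dominated convergence for \<open>s \<rightarrow> 0\<close> requires.\<close>

lemma integrable_norm_powr_grad_inner:
  assumes p: "1 < p" and h: "h \<in> Lp_functions p M" and w: "w \<in> Lp_functions p M"
  shows "integrable M (\<lambda>x. norm_powr_grad p (h x) \<bullet> w x)"
    and "\<And>x s. \<bar>s\<bar> \<le> 1 \<Longrightarrow> \<bar>norm_powr_grad p (h x + s *\<^sub>R w x) \<bullet> w x\<bar> \<le> (norm (h x) + norm (w x)) powr p"
    and "integrable M (\<lambda>x. (norm (h x) + norm (w x)) powr p)"
proof -
  note [measurable] = Lp_functionsD(1)[OF h] Lp_functionsD(1)[OF w]
  have "(\<lambda>x. norm (h x)) \<in> Lp_functions p M" "(\<lambda>x. norm (w x)) \<in> Lp_functions p M"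
    using h w by (auto simp: Lp_functions_def)
  from Lp_functionsD(2)[OF Lp_add[OF p this]]
  show int: "integrable M (\<lambda>x. (norm (h x) + norm (w x)) powr p)" by simp
  show bd: "\<bar>norm_powr_grad p (h x + s *\<^sub>R w x) \<bullet> w x\<bar> \<le> (norm (h x) + norm (w x)) powr p"
    if "\<bar>s\<bar> \<le> 1" for x s
  proof -
    let ?t = "norm (h x) + norm (w x)"
    have "norm (h x + s *\<^sub>R w x) \<le> norm (h x) + \<bar>s\<bar> * norm (w x)"
      using norm_triangle_ineq[of "h x" "s *\<^sub>R w x"] by simp
    also have "\<dots> \<le> ?t" using that by (simp add: mult_left_le_one_le)
    finally have "norm (h x + s *\<^sub>R w x) powr (p - 1) \<le> ?t powr (p - 1)"
      using p by (intro powr_mono2) auto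
    then have "norm (h x + s *\<^sub>R w x) powr (p - 1) * norm (w x) \<le> ?t powr (p - 1) * ?t"
      by (intro mult_mono) auto
    also have "\<dots> = ?t powr p" using powr_mult_base[of ?t "p - 1"] by (simp add: mult.commute)
    finally show ?thesis
      using Cauchy_Schwarz_ineq2[of "norm_powr_grad p (h x + s *\<^sub>R w x)" "w x"]
      by (simp add: norm_norm_powr_grad)
  qed
  show "integrable M (\<lambda>x. norm_powr_grad p (h x) \<bullet> w x)"
    using bd[of 0] by (intro Bochner_Integration.integrable_bound[OF int]) auto
qed

text \<open>Comparing \<open>h\<close> with the tangent at \<open>h + s w\<close>, minimality gives the inequality with
  \<open>norm_powr_grad p (h + s w)\<close> in place of \<open>norm_powr_grad p h\<close> for every \<open>s > 0\<close>; then \<open>s \<rightarrow> 0\<close>.\<close>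

lemma Lp_norm_minimal_imp_integral_nonneg:
  fixes h w :: "'a \<Rightarrow> 'e::euclidean_space"
  assumes p: "1 < p" and h: "h \<in> Lp_functions p M" and w: "w \<in> Lp_functions p M"
    and min: "\<And>s. Lp_norm p M h \<le> Lp_norm p M (\<lambda>x. h x + s *\<^sub>R w x)"
  shows "0 \<le> (LINT x|M. norm_powr_grad p (h x) \<bullet> w x)"
proof -
  note [measurable] = Lp_functionsD(1)[OF h] Lp_functionsD(1)[OF w]
  define s where "s n = inverse (real (Suc n))" for n
  have s: "0 < s n" "\<bar>s n\<bar> \<le> 1" for n by (auto simp: s_def field_simps)
  let ?g = "\<lambda>n x. norm_powr_grad p (h x + s n *\<^sub>R w x) \<bullet> w x"
  have hs: "(\<lambda>x. h x + s n *\<^sub>R w x) \<in> Lp_functions p M" for n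
    by (intro Lp_add p h Lp_scaleR w)
  have lim: "(\<lambda>n. LINT x|M. ?g n x) \<longlonglongrightarrow> (LINT x|M. norm_powr_grad p (h x) \<bullet> w x)"
  proof (rule integral_dominated_convergence[where w = "\<lambda>x. (norm (h x) + norm (w x)) powr p"])
    have "(\<lambda>n. ?g n x) \<longlonglongrightarrow> norm_powr_grad p (h x + 0 *\<^sub>R w x) \<bullet> w x" for x
      unfolding s_def by (intro tendsto_inner tendsto_norm_powr_grad p tendsto_intros LIMSEQ_inverse_real_of_nat)
    then show "AE x in M. (\<lambda>n. ?g n x) \<longlonglongrightarrow> norm_powr_grad p (h x) \<bullet> w x" by simp
    show "AE x in M. norm (?g n x) \<le> (norm (h x) + norm (w x)) powr p" for n
      using integrable_norm_powr_grad_inner(2)[OF p h w s(2)] by simp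
  qed (use integrable_norm_powr_grad_inner(3)[OF p h w] in auto)
  have "0 \<le> (LINT x|M. ?g n x)" for n
  proof -
    have int: "integrable M (?g n)"
      by (rule integrable_norm_powr_grad_inner(1)[OF p hs w])
    have "norm (h x + s n *\<^sub>R w x) powr p \<le> norm (h x) powr p + (p * s n) * ?g n x" for x
      using norm_powr_above_tangent_weak[OF p, of "h x + s n *\<^sub>R w x" "h x"] by simp
    then have "(LINT x|M. norm (h x + s n *\<^sub>R w x) powr p) \<le> (LINT x|M. norm (h x) powr p + (p * s n) * ?g n x)"
      by (intro integral_mono Lp_functionsD[OF hs] Bochner_Integration.integrable_add
          integrable_mult_right int Lp_functionsD[OF h])
    also have "\<dots> = (LINT x|M. norm (h x) powr p) + (p * s n) * (LINT x|M. ?g n x)"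
      using Lp_functionsD(2)[OF h] int by simp
    finally have "(LINT x|M. norm (h x + s n *\<^sub>R w x) powr p) \<le> \<dots>" .
    moreover have "(LINT x|M. norm (h x) powr p) \<le> (LINT x|M. norm (h x + s n *\<^sub>R w x) powr p)"
      using min[of "s n"] p by (simp flip: Lp_norm_powr[OF p] add: powr_mono2)
    ultimately have "0 \<le> (p * s n) * (LINT x|M. ?g n x)" by simp
    moreover have "0 < p * s n" using p s(1)[of n] by simp
    ultimately show ?thesis by (simp only: zero_le_mult_iff) linarith
  qed
  then show ?thesis by (intro LIMSEQ_le_const[OF lim]) auto
qed

lemma Lp_norm_minimal_imp_integral_zero:
  fixes h w :: "'a \<Rightarrow> 'e::euclidean_space"
  assumes p: "1 < p" and h: "h \<in> Lp_functions p M" and w: "w \<in> Lp_functions p M"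
    and min: "\<And>s. Lp_norm p M h \<le> Lp_norm p M (\<lambda>x. h x + s *\<^sub>R w x)"
  shows "(LINT x|M. norm_powr_grad p (h x) \<bullet> w x) = 0"
proof (rule antisym)
  have "(\<lambda>x. (-1) *\<^sub>R w x) \<in> Lp_functions p M" by (rule Lp_scaleR[OF w])
  then have "0 \<le> (LINT x|M. norm_powr_grad p (h x) \<bullet> ((-1) *\<^sub>R w x))"
    by (rule Lp_norm_minimal_imp_integral_nonneg[OF p h]) (use min[of "- _"] in simp)
  then show "(LINT x|M. norm_powr_grad p (h x) \<bullet> w x) \<le> 0" by simp
qed (rule Lp_norm_minimal_imp_integral_nonneg[OF assms])

text \<open>The consequence of the Hahn-Banach theorem and of the duality of the spaces of \<open>p\<close>-integrable
  functions that is needed here, in terms of the real inner product. The annihilator that decides is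
  \<open>norm_powr_grad p k\<close>, where \<open>k\<close> is the element of minimal norm in the closure of \<open>F - V\<close>.\<close>

theorem Lp_approximable_if_annihilators_vanish:
  fixes F :: "'a \<Rightarrow> 'e::euclidean_space"
  assumes p: "1 < p" and F: "F \<in> Lp_functions p M"
    and V: "V \<subseteq> Lp_functions p M" and V0: "V \<noteq> {}"
    and Vadd: "\<And>v w c. v \<in> V \<Longrightarrow> w \<in> V \<Longrightarrow> (\<lambda>x. v x + c *\<^sub>R w x) \<in> V"
    and ann: "\<And>g. g \<in> Lp_functions (p / (p - 1)) M \<Longrightarrow>
      (\<And>v. v \<in> V \<Longrightarrow> (LINT x|M. g x \<bullet> v x) = 0) \<Longrightarrow> (LINT x|M. g x \<bullet> F x) = 0"
    and e: "0 < e"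
  shows "\<exists>v\<in>V. Lp_norm p M (\<lambda>x. F x - v x) < e"
proof -
  let ?I = "\<lambda>f. LINT x|M. norm (f x) powr p"
  define d where "d = (INF v\<in>V. ?I (\<lambda>x. F x - v x))"
  have bdd: "bdd_below ((\<lambda>v. ?I (\<lambda>x. F x - v x)) ` V)"
    by (rule bdd_belowI[of _ 0]) auto
  have d_le: "d \<le> ?I (\<lambda>x. F x - v x)" if "v \<in> V" for v
    unfolding d_def using bdd that by (rule cINF_lower)
  have d0: "0 \<le> d" unfolding d_def using V0 by (intro cINF_greatest) auto
  have "\<exists>v\<in>V. ?I (\<lambda>x. F x - v x) < d + inverse (real (Suc n))" for n
    using cINF_less_iff[OF V0 bdd, of "d + inverse (real (Suc n))"] by (simp add: d_def)
  then obtain v where v: "\<And>n. v n \<in> V" and v_lt: "\<And>n. ?I (\<lambda>x. F x - v n x) < d + inverse (real (Suc n))"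
    by metis
  define h where "h n x = F x - v n x" for n x
  have h: "h n \<in> Lp_functions p M" for n
    unfolding h_def using v V by (intro Lp_diff p F) auto
  have h_lt: "?I (h n) < d + inverse (real (Suc n))" for n
    using v_lt by (simp add: h_def)
  have Vscale: "(\<lambda>x. c *\<^sub>R w x) \<in> V" if "w \<in> V" for w c
    using Vadd[OF that that, of "c - 1"] by (simp add: algebra_simps)
  have mid: "d \<le> ?I (\<lambda>x. (1/2) *\<^sub>R (h m x + h n x))" for m n
  proof -
    have "(\<lambda>x. (1/2) *\<^sub>R v m x + (1/2) *\<^sub>R v n x) \<in> V"
      by (intro Vadd[OF Vscale] v)
    then have "d \<le> ?I (\<lambda>x. F x - ((1/2) *\<^sub>R v m x + (1/2) *\<^sub>R v n x))" by (rule d_le)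
    also have "(\<lambda>x. F x - ((1/2) *\<^sub>R v m x + (1/2) *\<^sub>R v n x)) = (\<lambda>x. (1/2) *\<^sub>R (h m x + h n x))"
      by (rule ext) (simp add: h_def algebra_simps flip: scaleR_left_distrib)
    finally show ?thesis .
  qed
  have cauchy: "\<exists>N. \<forall>m\<ge>N. \<forall>n\<ge>N. Lp_norm p M (\<lambda>x. h m x - h n x) < e" if e: "0 < e" for e
  proof -
    \<comment> \<open>Both \<open>\<integral>\<bar>h\<^sub>m\<bar>\<^sup>p\<close> and \<open>\<integral>\<bar>h\<^sub>n\<bar>\<^sup>p\<close> are at most \<open>d + 1\<close>, so this \<open>\<epsilon>\<close> contributes a quarter of \<open>e\<^sup>p\<close>.\<close>
    define \<epsilon> where "\<epsilon> = e powr p / (8 * (d + 1))"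
    have \<epsilon>: "0 < \<epsilon>" using e d0 by (simp add: \<epsilon>_def)
    obtain C where C: "0 \<le> C" "\<And>a b :: 'e. norm (a - b) powr p \<le> \<epsilon> * (norm a powr p + norm b powr p) +
       C * ((norm a powr p + norm b powr p) / 2 - norm ((1/2) *\<^sub>R (a + b)) powr p)"
      using norm_diff_powr_le[OF p \<epsilon>] by metis
    have "0 < e powr p / (4 * (C + 1))" using e C by simp
    then obtain N where N: "inverse (real (Suc N)) < e powr p / (4 * (C + 1))"
      using reals_Archimedean by blast
    have "Lp_norm p M (\<lambda>x. h m x - h n x) < e" if mn: "N \<le> m" "N \<le> n" for m n
    proof -
      have hm: "?I (h k) \<le> d + inverse (real (Suc N))" if "N \<le> k" for k
        using h_lt[of k] that le_imp_inverse_le[of "real (Suc N)" "real (Suc k)"] by linarith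
      have hm1: "?I (h k) \<le> d + 1" for k
        using h_lt[of k] le_imp_inverse_le[of 1 "real (Suc k)"] by (simp del: of_nat_Suc)
      have hh: "(\<lambda>x. (1/2) *\<^sub>R (h m x + h n x)) \<in> Lp_functions p M"
        by (intro Lp_scaleR Lp_add p h)
      note ints = Lp_functionsD(2)[OF h] Lp_functionsD(2)[OF hh]
      have "?I (\<lambda>x. h m x - h n x) \<le> (LINT x|M. \<epsilon> * (norm (h m x) powr p + norm (h n x) powr p) +
          C * ((norm (h m x) powr p + norm (h n x) powr p) / 2 - norm ((1/2) *\<^sub>R (h m x + h n x)) powr p))"
        by (intro integral_mono C Bochner_Integration.integrable_add integrable_mult_right
            Bochner_Integration.integrable_diff integrable_divide_zero ints
            Lp_functionsD(2)[OF Lp_diff[OF p h h]] impI)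
      also have "\<dots> = \<epsilon> * (?I (h m) + ?I (h n)) +
          C * ((?I (h m) + ?I (h n)) / 2 - ?I (\<lambda>x. (1/2) *\<^sub>R (h m x + h n x)))"
        using ints by simp
      also have "\<dots> \<le> \<epsilon> * ((d + 1) + (d + 1)) +
          C * (((d + inverse (real (Suc N))) + (d + inverse (real (Suc N)))) / 2 - d)"
        using \<epsilon> C mid[of m n] hm[OF mn(1)] hm[OF mn(2)] hm1[of m] hm1[of n]
        by (intro add_mono mult_left_mono diff_mono divide_right_mono) auto
      also have "\<epsilon> * ((d + 1) + (d + 1)) = e powr p / 4"
        using d0 unfolding \<epsilon>_def by (simp add: divide_simps)
      also have "((d + inverse (real (Suc N))) + (d + inverse (real (Suc N)))) / 2 - d = inverse (real (Suc N))"
        by (simp add: add_divide_distrib del: of_nat_Suc)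
      also have "C * inverse (real (Suc N)) \<le> (C + 1) * (e powr p / (4 * (C + 1)))"
        using C N by (intro mult_mono) auto
      also have "(C + 1) * (e powr p / (4 * (C + 1))) = e powr p / 4"
        using C(1) by (simp add: field_simps)
      also have "e powr p / 4 + e powr p / 4 < e powr p" using e by simp
      finally have "Lp_norm p M (\<lambda>x. h m x - h n x) powr p < e powr p"
        by (simp add: Lp_norm_powr[OF p])
      moreover have "e powr p \<le> Lp_norm p M (\<lambda>x. h m x - h n x) powr p"
        if "e \<le> Lp_norm p M (\<lambda>x. h m x - h n x)"
        using that e p by (intro powr_mono2) auto
      ultimately show ?thesis by linarith
    qed
    then show ?thesis by blast
  qed
  obtain k where k: "k \<in> Lp_functions p M" and lim: "(\<lambda>n. Lp_norm p M (\<lambda>x. h n x - k x)) \<longlonglongrightarrow> 0"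
    using Lp_complete[OF p h cauchy] by metis
  have k_norm: "Lp_norm p M k \<le> d powr (1/p)"
  proof -
    have "(\<lambda>n. Lp_norm p M (h n)) \<longlonglongrightarrow> Lp_norm p M k"
      by (rule Lp_norm_tendsto[OF p h k lim])
    moreover have "(\<lambda>n. (d + inverse (real (Suc n))) powr (1/p)) \<longlonglongrightarrow> (d + 0) powr (1/p)"
      using p d0 by (intro tendsto_powr' tendsto_add tendsto_const LIMSEQ_inverse_real_of_nat) auto
    moreover have "Lp_norm p M (h n) \<le> (d + inverse (real (Suc n))) powr (1/p)" for n
      unfolding Lp_norm_def using h_lt[of n] p by (intro powr_mono2) auto
    ultimately show ?thesis by (intro LIMSEQ_le) auto
  qed
  have min: "d powr (1/p) \<le> Lp_norm p M w"
    if w: "w \<in> Lp_functions p M" and u: "\<And>n. u n \<in> V"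
      and ulim: "(\<lambda>n. Lp_norm p M (\<lambda>x. (F x - u n x) - w x)) \<longlonglongrightarrow> 0" for u w
  proof -
    have "(\<lambda>x. F x - u n x) \<in> Lp_functions p M" for n using u V by (intro Lp_diff p F) auto
    then have "(\<lambda>n. Lp_norm p M (\<lambda>x. F x - u n x)) \<longlonglongrightarrow> Lp_norm p M w"
      using Lp_norm_tendsto[OF p _ w ulim] by simp
    moreover have "d powr (1/p) \<le> Lp_norm p M (\<lambda>x. F x - u n x)" for n
      unfolding Lp_norm_def using d_le[OF u] d0 p by (intro powr_mono2) auto
    ultimately show ?thesis by (intro LIMSEQ_le_const) auto
  qed
  have norm_k: "Lp_norm p M k = d powr (1/p)"
    using k_norm min[OF k v] lim by (simp add: h_def)
  define g where "g x = norm_powr_grad p (k x)" for x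
  have g_V: "(LINT x|M. g x \<bullet> w x) = 0" if w: "w \<in> V" for w
    unfolding g_def
  proof (rule Lp_norm_minimal_imp_integral_zero[OF p k])
    show wLp: "w \<in> Lp_functions p M" using V w by auto
    fix s
    have "d powr (1/p) \<le> Lp_norm p M (\<lambda>x. k x + s *\<^sub>R w x)"
    proof (rule min)
      show "(\<lambda>x. v n x + (- s) *\<^sub>R w x) \<in> V" for n by (intro Vadd v w)
      have "F x - (v n x + (- s) *\<^sub>R w x) - (k x + s *\<^sub>R w x) = h n x - k x" for n x
        by (simp add: h_def algebra_simps)
      then show "(\<lambda>n. Lp_norm p M (\<lambda>x. F x - (v n x + (- s) *\<^sub>R w x) - (k x + s *\<^sub>R w x))) \<longlonglongrightarrow> 0"
        using lim by presburger
    qed (intro Lp_add Lp_scaleR wLp k p)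
    then show "Lp_norm p M k \<le> Lp_norm p M (\<lambda>x. k x + s *\<^sub>R w x)" by (simp add: norm_k)
  qed
  \<comment> \<open>The direction \<open>k - F\<close> is only a limit of elements of \<open>V\<close>, but minimality extends to it.\<close>
  have kF: "(\<lambda>x. k x - F x) \<in> Lp_functions p M" by (intro Lp_diff p k F)
  have g_kF: "(LINT x|M. g x \<bullet> (k x - F x)) = 0"
    unfolding g_def
  proof (rule Lp_norm_minimal_imp_integral_zero[OF p k kF])
    fix s
    have "d powr (1/p) \<le> Lp_norm p M (\<lambda>x. k x + s *\<^sub>R (k x - F x))"
    proof (rule min)
      show "(\<lambda>x. (1 + s) *\<^sub>R v n x) \<in> V" for n by (intro Vscale v)
      have "F x - (1 + s) *\<^sub>R v n x - (k x + s *\<^sub>R (k x - F x)) = (1 + s) *\<^sub>R (h n x - k x)" for n x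
        by (simp add: h_def algebra_simps)
      then have eq: "Lp_norm p M (\<lambda>x. F x - (1 + s) *\<^sub>R v n x - (k x + s *\<^sub>R (k x - F x)))
          = \<bar>1 + s\<bar> * Lp_norm p M (\<lambda>x. h n x - k x)" for n
        by (simp only: Lp_norm_scaleR[OF p])
      show "(\<lambda>n. Lp_norm p M (\<lambda>x. F x - (1 + s) *\<^sub>R v n x - (k x + s *\<^sub>R (k x - F x)))) \<longlonglongrightarrow> 0"
        unfolding eq using tendsto_mult_right_zero[OF lim] by simp
    qed (intro Lp_add Lp_scaleR kF k p)
    then show "Lp_norm p M k \<le> Lp_norm p M (\<lambda>x. k x + s *\<^sub>R (k x - F x))" by (simp add: norm_k)
  qed
  have "g \<in> Lp_functions (p / (p - 1)) M"
    using k p unfolding Lp_functions_def g_def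
    by (auto simp: norm_norm_powr_grad powr_powr)
  then have "(LINT x|M. g x \<bullet> F x) = 0" using g_V by (rule ann)
  moreover have "(LINT x|M. g x \<bullet> (k x - F x)) = (LINT x|M. g x \<bullet> k x) - (LINT x|M. g x \<bullet> F x)"
    using integrable_norm_powr_grad_inner(1)[OF p k k] integrable_norm_powr_grad_inner(1)[OF p k F]
    by (simp add: g_def inner_diff_right)
  ultimately have "?I k = 0" using g_kF by (simp add: g_def norm_powr_grad_inner_self)
  then have "Lp_norm p M k = 0" by (simp add: Lp_norm_def)
  then have "(\<lambda>n. Lp_norm p M (h n)) \<longlonglongrightarrow> 0" using Lp_norm_tendsto[OF p h k lim] by simp
  then have "eventually (\<lambda>n. Lp_norm p M (h n) < e) sequentially" using e by (rule order_tendstoD)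
  then obtain n where "Lp_norm p M (h n) < e" by (auto simp: eventually_sequentially)
  then show ?thesis using v by (auto simp: h_def[abs_def])
qed

section \<open>The spectral theorem for Hermitian matrices\<close>

lemma inner_complex_vec: "(x::complex^'n) \<bullet> y = Re (\<Sum>i\<in>UNIV. x $ i * cnj (y $ i))"
  by (simp add: inner_vec_def inner_complex_def)

lemma matrix_vector_nth: "(A *v x) $ i = (\<Sum>j\<in>UNIV. A $ i $ j * x $ j)"
  by (simp add: matrix_vector_mult_def)

lemma inner_conj_transpose: "(A *v x) \<bullet> y = x \<bullet> (conj_transpose A *v y)"
proof -
  have "(\<Sum>i\<in>UNIV. (A *v x) $ i * cnj (y $ i)) = (\<Sum>i\<in>UNIV. \<Sum>j\<in>UNIV. A $ i $ j * x $ j * cnj (y $ i))"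
    by (simp add: matrix_vector_nth sum_distrib_right)
  also have "\<dots> = (\<Sum>j\<in>UNIV. \<Sum>i\<in>UNIV. A $ i $ j * x $ j * cnj (y $ i))" by (rule sum.swap)
  also have "\<dots> = (\<Sum>j\<in>UNIV. x $ j * cnj ((conj_transpose A *v y) $ j))"
    by (simp add: matrix_vector_nth conj_transpose_def sum_distrib_left mult_ac)
  finally show ?thesis by (simp add: inner_complex_vec)
qed

lemma matrix_vector_mult_scaleR: "A *v (c *\<^sub>R x) = c *\<^sub>R (A *v (x::complex^'n))"
  by (simp add: vec_eq_iff matrix_vector_nth scaleR_sum_right)

lemma conj_transpose_conj_transpose [simp]: "conj_transpose (conj_transpose A) = A"
  by (simp add: conj_transpose_def vec_eq_iff)

lemma conj_transpose_mult: "conj_transpose (A ** B) = conj_transpose B ** conj_transpose A"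
  by (simp add: conj_transpose_def vec_eq_iff matrix_matrix_mult_def mult.commute)

lemma conj_transpose_diag [simp]: "conj_transpose (diag_mat d) = diag_mat d"
  by (auto simp: conj_transpose_def diag_mat_def vec_eq_iff)

lemma diag_mat_mult: "diag_mat a ** diag_mat b = diag_mat (\<lambda>i. a i * b i)"
proof -
  have "(diag_mat a ** diag_mat b) $ i $ j = diag_mat (\<lambda>i. a i * b i) $ i $ j" for i j
    unfolding diag_mat_def matrix_matrix_mult_def
    by (simp add: if_distrib[of "\<lambda>x. x * _"] cong: if_cong)
  then show ?thesis by (simp add: vec_eq_iff)
qed

lemma diag_mat_vector: "(diag_mat d *v v) $ i = complex_of_real (d i) * v $ i"
  unfolding diag_mat_def matrix_vector_nth
  by (simp add: if_distrib[of "\<lambda>x. x * _"] cong: if_cong)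

lemma psd_inner_nonneg: "psd A \<Longrightarrow> 0 \<le> (A *v v) \<bullet> v"
  by (simp add: psd_def inner_complex_vec)

text \<open>The Hermitian inner product. The inner product of \<open>complex^'n\<close> as a Euclidean space is its real part.\<close>

definition hdot :: "complex^'n \<Rightarrow> complex^'n \<Rightarrow> complex" where
  "hdot x y = (\<Sum>i\<in>UNIV. x $ i * cnj (y $ i))"

lemma hdot_eq_0_iff: "hdot x y = 0 \<longleftrightarrow> x \<bullet> y = 0 \<and> x \<bullet> (\<i> *s y) = 0"
proof -
  have "x \<bullet> y = Re (hdot x y)" by (simp add: hdot_def inner_complex_vec)
  moreover have "x \<bullet> (\<i> *s y) = Im (hdot x y)"
    by (simp add: hdot_def inner_complex_vec algebra_simps)
  ultimately show ?thesis by (simp add: complex_eq_iff)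
qed

lemma hdot_self: "hdot x x = complex_of_real ((norm x)\<^sup>2)"
  by (simp add: hdot_def complex_eq_iff power2_norm_eq_inner inner_complex_vec mult.commute)

text \<open>A vector maximising the Rayleigh quotient on the orthogonal complement \<open>V\<close> of the given
  eigenvectors is an eigenvector, because \<open>V\<close> is invariant and the first variation of the
  quotient vanishes in all directions of \<open>V\<close>.\<close>

lemma hermitian_eigenvector_orthogonal:
  fixes A :: "complex^'q^'q"
  assumes A: "hermitian A" and K: "finite K" "card K < CARD('q)"
    and eig: "\<And>k. k \<in> K \<Longrightarrow> A *v e k = complex_of_real (d k) *s e k"
  obtains v l where "norm v = 1" "\<And>k. k \<in> K \<Longrightarrow> hdot v (e k) = 0" "A *v v = complex_of_real l *s v"
proof -
  define V where "V = {v::complex^'q. \<forall>k\<in>K. hdot v (e k) = 0}"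
  have V_alt: "V = (\<Inter>k\<in>K. {v. v \<bullet> e k = 0} \<inter> {v. v \<bullet> (\<i> *s e k) = 0})"
    by (auto simp: V_def hdot_eq_0_iff)
  have V_add: "v + c *\<^sub>R w \<in> V" if "v \<in> V" "w \<in> V" for v w c
    using that by (auto simp: V_def hdot_eq_0_iff inner_add_left)
  have adj: "(A *v x) \<bullet> y = x \<bullet> (A *v y)" for x y
    using inner_conj_transpose[of A x y] A by (simp add: hermitian_def)
  have AV: "A *v v \<in> V" if v: "v \<in> V" for v
  proof -
    have "(A *v v) \<bullet> e k = 0 \<and> (A *v v) \<bullet> (\<i> *s e k) = 0" if k: "k \<in> K" for k
    proof -
      have "v \<bullet> e k = 0" "v \<bullet> (\<i> *s e k) = 0" using v k by (auto simp: V_def hdot_eq_0_iff)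
      moreover have "complex_of_real c *s x = c *\<^sub>R x" for c and x :: "complex^'q"
        by (simp add: vec_eq_iff complex_eq_iff)
      moreover have "A *v (\<i> *s e k) = d k *\<^sub>R (\<i> *s e k)"
        using eig[OF k] by (simp add: matrix_vector_mult_scaleR vec.scale vec_eq_iff complex_eq_iff)
      ultimately show ?thesis using eig[OF k] by (simp add: adj)
    qed
    then show ?thesis by (auto simp: V_def hdot_eq_0_iff)
  qed
  have "\<exists>v\<in>V. norm v = 1"
  proof -
    \<comment> \<open>A square matrix whose rows are the conjugated eigenvectors and zero rows has a nontrivial kernel.\<close>
    obtain f :: "'a \<Rightarrow> 'q" where f: "inj_on f K"
      using card_le_inj[of K "UNIV::'q set"] K by auto
    define B :: "complex^'q^'q" where "B = (\<chi> i j. if i \<in> f ` K then cnj (e (the_inv_into K f i) $ j) else 0)"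
    have "card (f ` K) < CARD('q)" using K by (simp add: card_image f)
    then obtain i where i: "i \<notin> f ` K" by (metis UNIV_eq_I less_irrefl)
    have "(B ** C) $ i $ j = 0" for C :: "complex^'q^'q" and j
      using i by (simp add: B_def matrix_matrix_mult_def)
    then have "(B ** C) $ i $ i \<noteq> (mat 1 :: complex^'q^'q) $ i $ i" for C :: "complex^'q^'q"
      by (simp add: mat_def)
    then have "B ** C \<noteq> mat 1" for C :: "complex^'q^'q" by metis
    then have "\<not> (\<exists>C. C ** B = mat 1)" using matrix_left_right_inverse by blast
    then obtain x where x: "B *v x = 0" "x \<noteq> 0" by (auto simp: matrix_left_invertible_ker)
    have "hdot x (e k) = 0" if k: "k \<in> K" for k
    proof -
      have "(B *v x) $ (f k) = 0" using x by simp
      then show ?thesis using k f by (simp add: B_def matrix_vector_nth hdot_def the_inv_into_f_f mult.commute)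
    qed
    then have "(1 / norm x) *\<^sub>R x \<in> V" by (auto simp: V_def hdot_eq_0_iff)
    then show ?thesis using x by (intro bexI[of _ "(1 / norm x) *\<^sub>R x"]) auto
  qed
  moreover have "compact (V \<inter> sphere 0 1)"
    unfolding V_alt by (intro closed_Int_compact closed_INT ballI closed_Int closed_Collect_eq continuous_intros) auto
  moreover have lin: "linear (\<lambda>v::complex^'q. A *v v)"
    by (rule linearI) (simp_all add: matrix_vector_right_distrib matrix_vector_mult_scaleR)
  have "continuous_on (V \<inter> sphere 0 1) (\<lambda>v. (A *v v) \<bullet> v)"
    by (intro continuous_intros linear_continuous_on linear_conv_bounded_linear[THEN iffD1, OF lin])
  ultimately have "\<exists>v\<in>V \<inter> sphere 0 1. \<forall>w\<in>V \<inter> sphere 0 1. (A *v w) \<bullet> w \<le> (A *v v) \<bullet> v"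
    by (intro continuous_attains_sup) auto
  then obtain v where v: "v \<in> V" "norm v = 1"
    and max: "\<And>w. w \<in> V \<Longrightarrow> norm w = 1 \<Longrightarrow> (A *v w) \<bullet> w \<le> (A *v v) \<bullet> v"
    by (metis IntE IntI mem_sphere_0)
  define l where "l = (A *v v) \<bullet> v"
  have le: "(A *v w) \<bullet> w \<le> l * (w \<bullet> w)" if w: "w \<in> V" for w
  proof (cases "w = 0")
    case False
    have "(1 / norm w) *\<^sub>R w \<in> V" using w by (auto simp: V_def hdot_eq_0_iff)
    then have "(A *v ((1 / norm w) *\<^sub>R w)) \<bullet> ((1 / norm w) *\<^sub>R w) \<le> l"
      unfolding l_def using False by (intro max) auto
    then have "(A *v w) \<bullet> w / (norm w)\<^sup>2 \<le> l"
      by (simp add: matrix_vector_mult_scaleR power2_eq_square)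
    then show ?thesis using False by (simp add: power2_norm_eq_inner pos_divide_le_eq)
  qed simp
  have crit: "(A *v v - l *\<^sub>R v) \<bullet> w = 0" if w: "w \<in> V" for w
  proof -
    define b where "b = (A *v v - l *\<^sub>R v) \<bullet> w"
    define c where "c = l * (w \<bullet> w) - (A *v w) \<bullet> w"
    have quad: "0 \<le> s * s * c - 2 * s * b" for s
    proof -
      have "(A *v (v + s *\<^sub>R w)) \<bullet> (v + s *\<^sub>R w) \<le> l * ((v + s *\<^sub>R w) \<bullet> (v + s *\<^sub>R w))"
        by (intro le V_add v w)
      moreover have "v \<bullet> v = 1" using v by (simp add: dot_square_norm)
      moreover have "(A *v w) \<bullet> v = (A *v v) \<bullet> w" by (metis adj inner_commute)
      ultimately show ?thesis
        by (simp add: b_def c_def l_def matrix_vector_right_distrib matrix_vector_mult_scaleR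
            inner_add_left inner_add_right inner_diff_left algebra_simps inner_commute[of w v])
    qed
    have c0: "0 \<le> c" using le[OF w] by (simp add: c_def)
    \<comment> \<open>The quadratic polynomial is nonnegative for all \<open>s\<close>; the value at \<open>s = b / (c + 1)\<close> forces \<open>b = 0\<close>.\<close>
    have "0 \<le> (b / (c + 1)) * (b / (c + 1)) * c - 2 * (b / (c + 1)) * b" by (rule quad)
    also have "\<dots> = - (b * b) * ((c + 2) / ((c + 1) * (c + 1)))"
      using c0 by (simp add: divide_simps) (simp add: algebra_simps)
    finally have "b * b * ((c + 2) / ((c + 1) * (c + 1))) \<le> 0" by simp
    moreover have "0 < (c + 2) / ((c + 1) * (c + 1))" using c0 by simp
    ultimately have "\<not> 0 < b * b" by (meson mult_pos_pos not_less)
    then have "b = 0" by (metis not_real_square_gt_zero)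
    then show ?thesis by (simp add: b_def)
  qed
  have "A *v v + (- l) *\<^sub>R v \<in> V" by (intro V_add AV v)
  then have "A *v v - l *\<^sub>R v = 0" using crit[of "A *v v - l *\<^sub>R v"] by simp
  then have "A *v v = complex_of_real l *s v" by (simp add: vec_eq_iff complex_eq_iff)
  then show thesis using that v by (auto simp: V_def)
qed

lemma hermitian_orthonormal_eigenvectors:
  fixes A :: "complex^'q^'q"
  assumes A: "hermitian A" and K: "finite K" "card K \<le> CARD('q)"
  shows "\<exists>e d. (\<forall>k\<in>K. A *v e k = complex_of_real (d k) *s e k) \<and>
    (\<forall>j\<in>K. \<forall>k\<in>K. hdot (e j) (e k) = (if j = k then 1 else 0))"
  using K
proof (induction K rule: finite_induct)
  case (insert x K)
  then have "\<exists>e d. (\<forall>k\<in>K. A *v e k = complex_of_real (d k) *s e k) \<and>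
    (\<forall>j\<in>K. \<forall>k\<in>K. hdot (e j) (e k) = (if j = k then 1 else 0))" by simp
  then obtain e d where e: "\<forall>k\<in>K. A *v e k = complex_of_real (d k) *s e k"
    "\<forall>j\<in>K. \<forall>k\<in>K. hdot (e j) (e k) = (if j = k then 1 else 0)"
    by metis
  obtain v l where v: "norm v = 1" "\<And>k. k \<in> K \<Longrightarrow> hdot v (e k) = 0" "A *v v = complex_of_real l *s v"
    using hermitian_eigenvector_orthogonal[OF A, of K e d] insert.hyps insert.prems e by auto
  have "hdot (e k) v = 0" if "k \<in> K" for k
  proof -
    have "hdot (e k) v = cnj (hdot v (e k))" by (simp add: hdot_def mult.commute)
    then show ?thesis using v that by simp
  qed
  moreover have "hdot v v = 1" using v by (simp add: hdot_self)
  ultimately show ?case using e v insert.hyps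
    by (intro exI[of _ "e(x := v)"] exI[of _ "d(x := l)"]) auto
qed auto

theorem hermitian_spectral_decomposition:
  fixes A :: "complex^'q^'q"
  assumes A: "hermitian A"
  obtains U d where "unitary U" "A = U ** diag_mat d ** conj_transpose U"
proof -
  obtain e d where e: "\<And>k. A *v e k = complex_of_real (d k) *s e k"
    "\<And>j k :: 'q. hdot (e j) (e k) = (if j = k then 1 else 0)"
    using hermitian_orthonormal_eigenvectors[OF A, of "UNIV :: 'q set"] by (simp, metis)
  define U :: "complex^'q^'q" where "U = (\<chi> i k. e k $ i)"
  have "(conj_transpose U ** U) $ j $ k = (mat 1 :: complex^'q^'q) $ j $ k" for j k
    using e(2)[of k j] by (simp add: U_def conj_transpose_def matrix_matrix_mult_def mat_def hdot_def mult.commute)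
  then have UU: "conj_transpose U ** U = mat 1" by (simp add: vec_eq_iff)
  then have UU': "U ** conj_transpose U = mat 1" using matrix_left_right_inverse by blast
  have "(A ** U) $ i $ k = (U ** diag_mat d) $ i $ k" for i k
  proof -
    have "(A ** U) $ i $ k = (A *v e k) $ i"
      by (simp add: matrix_matrix_mult_def matrix_vector_nth U_def)
    also have "\<dots> = (U ** diag_mat d) $ i $ k"
      by (simp add: e(1) matrix_matrix_mult_def U_def diag_mat_def if_distrib[of "\<lambda>x. _ * x"] mult.commute cong: if_cong)
    finally show ?thesis .
  qed
  then have "A ** U = U ** diag_mat d" by (simp add: vec_eq_iff)
  then have "A ** U ** conj_transpose U = U ** diag_mat d ** conj_transpose U" by simp
  then have "A = U ** diag_mat d ** conj_transpose U"
    by (simp add: matrix_mul_assoc[symmetric] UU')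
  then show thesis using that UU UU' by (auto simp: unitary_def)
qed

lemma psd_spectral_decomposition:
  fixes A :: "complex^'q^'q"
  assumes A: "psd A"
  obtains U d where "unitary U" "\<And>i. 0 \<le> d i" "A = U ** diag_mat d ** conj_transpose U"
proof -
  obtain U d where U: "unitary U" "A = U ** diag_mat d ** conj_transpose U"
    using hermitian_spectral_decomposition A by (auto simp: psd_def)
  have "0 \<le> d i" for i
  proof -
    define v where "v = U *v axis i 1"
    have "conj_transpose U *v v = axis i 1"
      using U by (simp add: v_def matrix_vector_mul_assoc unitary_def)
    then have "(A *v v) \<bullet> v = (diag_mat d *v axis i 1) \<bullet> axis i 1"
      using U by (simp add: matrix_vector_mul_assoc[symmetric] inner_conj_transpose)
    also have "\<dots> = d i" by (simp add: inner_axis diag_mat_vector inner_complex_def)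
    finally show ?thesis using psd_inner_nonneg[OF A, of v] by simp
  qed
  then show thesis using that U by auto
qed

section \<open>Powers and range projections of positive semidefinite matrices\<close>

lemma spectral_nth:
  "(U ** diag_mat d ** conj_transpose U) $ i $ j = (\<Sum>k\<in>UNIV. U $ i $ k * complex_of_real (d k) * cnj (U $ j $ k))"
  by (simp add: matrix_matrix_mult_def diag_mat_def conj_transpose_def if_distrib[of "\<lambda>x. _ * x"] cong: if_cong)

lemma spectral_mult:
  assumes "unitary U"
  shows "(U ** diag_mat a ** conj_transpose U) ** (U ** diag_mat b ** conj_transpose U) =
    U ** diag_mat (\<lambda>i. a i * b i) ** conj_transpose U"
proof -
  have "(U ** diag_mat a ** conj_transpose U) ** (U ** diag_mat b ** conj_transpose U) =
    U ** diag_mat a ** (conj_transpose U ** U) ** diag_mat b ** conj_transpose U"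
    by (simp add: matrix_mul_assoc)
  also have "\<dots> = U ** (diag_mat a ** diag_mat b) ** conj_transpose U"
    using assms by (simp add: unitary_def matrix_mul_assoc)
  finally show ?thesis by (simp add: diag_mat_mult)
qed

lemma hermitian_spectral: "hermitian (U ** diag_mat d ** conj_transpose U)"
  by (simp add: hermitian_def conj_transpose_mult matrix_mul_assoc)

lemma norm_unitary_vector:
  assumes "unitary U"
  shows "norm (U *v x) = norm x" "norm (conj_transpose U *v x) = norm x"
proof -
  have "(U *v x) \<bullet> (U *v x) = x \<bullet> x"
    using assms by (simp add: inner_conj_transpose matrix_vector_mul_assoc unitary_def)
  then show "norm (U *v x) = norm x" by (simp add: norm_eq)
  have "(conj_transpose U *v x) \<bullet> (conj_transpose U *v x) = x \<bullet> x"
    using assms by (simp add: inner_conj_transpose matrix_vector_mul_assoc unitary_def)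
  then show "norm (conj_transpose U *v x) = norm x" by (simp add: norm_eq)
qed

definition mat_power :: "complex^'q^'q \<Rightarrow> nat \<Rightarrow> complex^'q^'q" where
  "mat_power A n = ((\<lambda>X. A ** X) ^^ n) (mat 1)"

lemma mat_power_spectral:
  assumes "unitary U"
  shows "mat_power (U ** diag_mat d ** conj_transpose U) n = U ** diag_mat (\<lambda>i. d i ^ n) ** conj_transpose U"
proof (induction n)
  case 0
  have "diag_mat (\<lambda>_. 1) = (mat 1 :: complex^'a^'a)"
    by (auto simp: diag_mat_def mat_def vec_eq_iff)
  then show ?case using assms by (simp add: mat_power_def unitary_def)
next
  case (Suc n)
  then show ?case using spectral_mult[OF assms] by (simp add: mat_power_def)
qed

lemma continuous_mat_power: "continuous_on UNIV (\<lambda>A. mat_power A n)"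
proof (induction n)
  case (Suc n)
  have "continuous_on UNIV (\<lambda>A :: complex^'a^'a. A ** mat_power A n)"
    unfolding matrix_matrix_mult_def
    by (intro continuous_on_vec_lambda continuous_intros Suc)
  then show ?case by (simp add: mat_power_def)
qed (simp add: mat_power_def)

text \<open>One sequence of matrix polynomials converges to the \<open>r\<close>-th power on all positive semidefinite
  matrices, whatever spectral decomposition is used. The power is therefore independent of the
  decomposition, and it is measurable as a pointwise limit of continuous functions.\<close>

lemma psd_powr_approximation:
  fixes r :: real
  assumes r: "0 < r"
  obtains P :: "nat \<Rightarrow> complex^'q^'q \<Rightarrow> complex^'q^'q" where
    "\<And>n. continuous_on UNIV (P n)"
    "\<And>U d. unitary U \<Longrightarrow> (\<And>i. 0 \<le> d i) \<Longrightarrow>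
      (\<lambda>n. P n (U ** diag_mat d ** conj_transpose U)) \<longlonglongrightarrow> U ** diag_mat (\<lambda>i. d i powr r) ** conj_transpose U"
proof -
  \<comment> \<open>The intervals grow with \<open>n\<close>, so that they eventually contain the spectrum of any given matrix.\<close>
  have "\<exists>a N. \<forall>x\<in>{0..real n}. \<bar>x powr r - (\<Sum>i\<le>N. a i * x^i)\<bar> < inverse (real (Suc n))" for n
  proof -
    have "continuous_on {0..real n} (\<lambda>x. x powr r)"
      using r by (intro continuous_on_powr' continuous_intros) auto
    then obtain g where g: "real_polynomial_function g"
      "\<And>x. x \<in> {0..real n} \<Longrightarrow> \<bar>x powr r - g x\<bar> < inverse (real (Suc n))"
      using Stone_Weierstrass_real_polynomial_function[of "{0..real n}" "\<lambda>x. x powr r" "inverse (real (Suc n))"]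
      by auto
    moreover obtain a N where "g = (\<lambda>x. \<Sum>i\<le>N. a i * x^i)"
      using g(1) unfolding real_polynomial_function_iff_sum by blast
    ultimately show ?thesis by blast
  qed
  then obtain a N where aN: "\<And>n x. x \<in> {0..real n} \<Longrightarrow>
      \<bar>x powr r - (\<Sum>i\<le>N n. a n i * x^i)\<bar> < inverse (real (Suc n))"
    by metis
  define P :: "nat \<Rightarrow> complex^'q^'q \<Rightarrow> complex^'q^'q" where
    "P n A = (\<Sum>i\<le>N n. a n i *\<^sub>R mat_power A i)" for n A
  show thesis
  proof (rule that)
    show "continuous_on UNIV (P n)" for n
      unfolding P_def by (intro continuous_intros continuous_mat_power)
    fix U :: "complex^'q^'q" and d :: "'q \<Rightarrow> real"
    assume U: "unitary U" and d: "\<And>i. 0 \<le> d i"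
    let ?g = "\<lambda>n x. \<Sum>i\<le>N n. a n i * x^i"
    have lim: "(\<lambda>n. ?g n x) \<longlonglongrightarrow> x powr r" if x: "0 \<le> x" for x
    proof -
      have "eventually (\<lambda>n. norm (x powr r - ?g n x) \<le> inverse (real (Suc n))) sequentially"
      proof (rule eventually_mono[OF eventually_ge_at_top[of "nat \<lceil>x\<rceil>"]])
        fix n assume "nat \<lceil>x\<rceil> \<le> n"
        then have "x \<le> real n" by linarith
        then show "norm (x powr r - ?g n x) \<le> inverse (real (Suc n))" using aN[of x n] x by simp
      qed
      then have "(\<lambda>n. x powr r - ?g n x) \<longlonglongrightarrow> 0"
        by (rule Lim_null_comparison[OF _ LIMSEQ_inverse_real_of_nat])
      then show ?thesis by (rule Lim_transform2[OF tendsto_const])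
    qed
    have eq: "P n (U ** diag_mat d ** conj_transpose U) = U ** diag_mat (\<lambda>i. ?g n (d i)) ** conj_transpose U" for n
    proof -
      have "P n (U ** diag_mat d ** conj_transpose U) $ i $ j =
          (\<Sum>l\<le>N n. \<Sum>k\<in>UNIV. U $ i $ k * complex_of_real (a n l * d k ^ l) * cnj (U $ j $ k))" for i j
        by (simp add: P_def mat_power_spectral[OF U] spectral_nth scaleR_sum_right)
          (simp add: scaleR_conv_of_real mult_ac)
      also have "(\<Sum>l\<le>N n. \<Sum>k\<in>UNIV. U $ i $ k * complex_of_real (a n l * d k ^ l) * cnj (U $ j $ k)) =
          (\<Sum>k\<in>UNIV. U $ i $ k * complex_of_real (?g n (d k)) * cnj (U $ j $ k))" for i j
        by (subst sum.swap) (simp only: of_real_sum sum_distrib_left sum_distrib_right)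
      finally show ?thesis by (simp add: vec_eq_iff spectral_nth)
    qed
    show "(\<lambda>n. P n (U ** diag_mat d ** conj_transpose U)) \<longlonglongrightarrow> U ** diag_mat (\<lambda>i. d i powr r) ** conj_transpose U"
      unfolding eq by (intro vec_tendstoI, unfold spectral_nth) (intro tendsto_intros lim d)
  qed
qed

lemma psd_powr_eq:
  assumes r: "0 < r" and U: "unitary U" and d: "\<And>i. 0 \<le> d i"
  shows "psd_powr (U ** diag_mat d ** conj_transpose U) r = U ** diag_mat (\<lambda>i. d i powr r) ** conj_transpose U"
  unfolding psd_powr_def
proof (rule the_equality)
  obtain P where P: "\<And>U d. unitary U \<Longrightarrow> (\<And>i. 0 \<le> d i) \<Longrightarrow>
      (\<lambda>n. P n (U ** diag_mat d ** conj_transpose U)) \<longlonglongrightarrow> (U ** diag_mat (\<lambda>i. d i powr r) ** conj_transpose U :: complex^'a^'a)"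
    using psd_powr_approximation[OF r] by metis
  fix B
  assume "\<exists>V c. unitary V \<and> (\<forall>i. 0 \<le> c i) \<and> U ** diag_mat d ** conj_transpose U = V ** diag_mat c ** conj_transpose V \<and>
     B = V ** diag_mat (\<lambda>i. c i powr r) ** conj_transpose V"
  then obtain V c where V: "unitary V" "\<And>i. 0 \<le> c i"
    "U ** diag_mat d ** conj_transpose U = V ** diag_mat c ** conj_transpose V"
    "B = V ** diag_mat (\<lambda>i. c i powr r) ** conj_transpose V" by blast
  show "B = U ** diag_mat (\<lambda>i. d i powr r) ** conj_transpose U"
    using LIMSEQ_unique[OF P[of U d, OF U d] P[of V c, OF V(1,2), folded V(3)]] V(4) by simp
qed (use U d in blast)

lemma borel_measurable_psd_powr:
  assumes r: "0 < r" and W [measurable]: "W \<in> borel_measurable M" and psd: "\<And>x. psd (W x)"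
  shows "(\<lambda>x. psd_powr (W x) r :: complex^'q^'q) \<in> borel_measurable M"
proof -
  obtain P where P: "\<And>n. continuous_on UNIV (P n :: complex^'q^'q \<Rightarrow> complex^'q^'q)" "\<And>U d. unitary U \<Longrightarrow> (\<And>i. 0 \<le> d i) \<Longrightarrow>
      (\<lambda>n. P n (U ** diag_mat d ** conj_transpose U)) \<longlonglongrightarrow> (U ** diag_mat (\<lambda>i. d i powr r) ** conj_transpose U :: complex^'q^'q)"
    using psd_powr_approximation[OF r] by metis
  show ?thesis
  proof (rule borel_measurable_LIMSEQ_metric)
    show "(\<lambda>x. P n (W x)) \<in> borel_measurable M" for n
      by (rule borel_measurable_continuous_on[OF P(1) W])
    show "(\<lambda>n. P n (W x)) \<longlonglongrightarrow> psd_powr (W x) r" for x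
    proof -
      obtain U d where U: "unitary U" "\<And>i. 0 \<le> d i" "W x = U ** diag_mat d ** conj_transpose U"
        using psd_spectral_decomposition[OF psd] by metis
      show ?thesis unfolding U(3) psd_powr_eq[OF r U(1,2)] by (rule P(2)[OF U(1,2)])
    qed
  qed
qed

lemma hermitian_psd_powr: "0 < r \<Longrightarrow> psd A \<Longrightarrow> hermitian (psd_powr A r)"
  by (metis psd_spectral_decomposition psd_powr_eq hermitian_spectral)

definition re_trace :: "complex^'q^'q \<Rightarrow> real" where
  "re_trace A = (\<Sum>i\<in>UNIV. Re (A $ i $ i))"

lemma psd_diag_nonneg: assumes "psd A" shows "0 \<le> Re (A $ i $ i)"
proof -
  have "(A *v axis i 1) $ i = A $ i $ i"
    by (simp add: matrix_vector_nth axis_def if_distrib[of "\<lambda>x. _ * x"] cong: if_cong)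
  then have "(A *v axis i 1) \<bullet> axis i 1 = Re (A $ i $ i)"
    by (simp add: inner_axis inner_complex_def)
  then show ?thesis using psd_inner_nonneg[OF assms, of "axis i 1"] by simp
qed

lemma re_trace_nonneg: "psd A \<Longrightarrow> 0 \<le> re_trace A"
  by (simp add: re_trace_def sum_nonneg psd_diag_nonneg)

text \<open>The trace is the sum of the eigenvalues and hence dominates each of them. The bound serves both for
  integrability and to see that the power vanishes with the trace.\<close>

lemma norm_psd_powr_le:
  assumes r: "0 < r" and A: "psd A"
  shows "norm (psd_powr A r *v v) \<le> re_trace A powr r * norm v"
proof -
  obtain U d where U: "unitary U" "\<And>i. 0 \<le> d i" "A = U ** diag_mat d ** conj_transpose U"
    using psd_spectral_decomposition[OF A] by metis
  have "re_trace A = (\<Sum>i\<in>UNIV. \<Sum>k\<in>UNIV. d k * (norm (U $ i $ k))\<^sup>2)"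
    unfolding re_trace_def U(3) spectral_nth
    unfolding cmod_power2 by (intro sum.cong refl) (simp add: power2_eq_square algebra_simps)
  also have "\<dots> = (\<Sum>k\<in>UNIV. d k * (\<Sum>i\<in>UNIV. (norm (U $ i $ k))\<^sup>2))"
    by (subst sum.swap) (simp add: sum_distrib_left)
  also have "\<dots> = (\<Sum>k\<in>UNIV. d k)"
  proof (intro sum.cong refl)
    fix k
    have "complex_of_real (\<Sum>i\<in>UNIV. (norm (U $ i $ k))\<^sup>2) = (conj_transpose U ** U) $ k $ k"
      unfolding of_real_sum complex_norm_square
      by (simp add: matrix_matrix_mult_def conj_transpose_def mult.commute)
    also have "\<dots> = 1" using U(1) by (simp add: unitary_def mat_def)
    finally have "(\<Sum>i\<in>UNIV. (norm (U $ i $ k))\<^sup>2) = 1"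
      by (simp only: of_real_eq_1_iff)
    then show "d k * (\<Sum>i\<in>UNIV. (norm (U $ i $ k))\<^sup>2) = d k" by simp
  qed
  finally have tr: "d k \<le> re_trace A" for k
    using U(2) member_le_sum[of k UNIV d] by simp
  have "psd_powr A r *v v = U *v (diag_mat (\<lambda>i. d i powr r) *v (conj_transpose U *v v))"
    unfolding U(3) psd_powr_eq[OF r U(1,2)] by (simp add: matrix_vector_mul_assoc matrix_mul_assoc)
  then have "norm (psd_powr A r *v v) = norm (diag_mat (\<lambda>i. d i powr r) *v (conj_transpose U *v v))"
    by (simp add: norm_unitary_vector[OF U(1)])
  also have "\<dots> \<le> norm (re_trace A powr r *\<^sub>R (conj_transpose U *v v))"
    using r tr U(2) by (intro norm_le_componentwise_cart) (auto simp: diag_mat_vector norm_mult intro!: mult_right_mono powr_mono2)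
  also have "\<dots> = re_trace A powr r * norm v" by (simp add: norm_unitary_vector[OF U(1)])
  finally show ?thesis .
qed

lemma spectral_kernel:
  assumes "unitary U"
  shows "(U ** diag_mat d ** conj_transpose U) *v v = 0 \<longleftrightarrow> (\<forall>i. d i = 0 \<or> (conj_transpose U *v v) $ i = 0)"
proof -
  have "(U ** diag_mat d ** conj_transpose U) *v v = U *v (diag_mat d *v (conj_transpose U *v v))"
    by (simp add: matrix_vector_mul_assoc matrix_mul_assoc)
  then have "(U ** diag_mat d ** conj_transpose U) *v v = 0 \<longleftrightarrow> norm (diag_mat d *v (conj_transpose U *v v)) = 0"
    using norm_unitary_vector(1)[OF assms] by (metis norm_eq_zero)
  also have "\<dots> \<longleftrightarrow> (\<forall>i. d i = 0 \<or> (conj_transpose U *v v) $ i = 0)"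
    by (simp add: vec_eq_iff diag_mat_vector)
  finally show ?thesis .
qed

text \<open>Two Hermitian idempotents with the same range absorb each other, and taking adjoints gives
  equality; so the description of the projection determines it.\<close>

lemma range_projection_eq:
  fixes U :: "complex^'q^'q"
  assumes U: "unitary U"
  shows "range_projection (U ** diag_mat d ** conj_transpose U) =
    U ** diag_mat (\<lambda>i. if d i = 0 then 0 else 1) ** conj_transpose U"
proof -
  define A where "A = U ** diag_mat d ** conj_transpose U"
  define P where "P = U ** diag_mat (\<lambda>i. if d i = 0 then 0 else 1) ** conj_transpose U"
  define B where "B = U ** diag_mat (\<lambda>i. inverse (d i)) ** conj_transpose U"
  have herm: "hermitian P" unfolding P_def by (rule hermitian_spectral)
  have idem: "P ** P = P" unfolding P_def spectral_mult[OF U] by (intro arg_cong2[of _ _ _ _ "(**)"] arg_cong[of _ _ diag_mat]) auto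
  have PA: "P ** A = A" unfolding P_def A_def spectral_mult[OF U] by (intro arg_cong2[of _ _ _ _ "(**)"] arg_cong[of _ _ diag_mat]) auto
  have AB: "A ** B = P" unfolding P_def A_def B_def spectral_mult[OF U] by (intro arg_cong2[of _ _ _ _ "(**)"] arg_cong[of _ _ diag_mat]) auto
  have range: "range (\<lambda>v. P *v v) = range (\<lambda>v. A *v v)"
  proof (intro equalityI subsetI; elim rangeE)
    show "x \<in> range (\<lambda>v. A *v v)" if "x = P *v v" for x v
      using that by (simp flip: AB matrix_vector_mul_assoc)
    show "x \<in> range (\<lambda>v. P *v v)" if "x = A *v v" for x v
      using that PA by (metis matrix_vector_mul_assoc rangeI)
  qed
  have absorb: "X ** Y = Y" if X: "X ** X = X" and r: "range (\<lambda>v. X *v v) = range (\<lambda>v. Y *v v)" for X Y :: "complex^'q^'q"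
  proof -
    have "X *v (Y *v v) = Y *v v" for v
    proof -
      have "Y *v v \<in> range (\<lambda>v. X *v v)" by (simp only: r) (rule rangeI)
      then obtain w where "Y *v v = X *v w" by blast
      then show ?thesis using X by (simp add: matrix_vector_mul_assoc)
    qed
    then show ?thesis by (simp add: matrix_eq matrix_vector_mul_assoc[symmetric])
  qed
  have "range_projection A = P"
    unfolding range_projection_def
  proof (rule the_equality)
    show "hermitian P \<and> P ** P = P \<and> range (\<lambda>v. P *v v) = range (\<lambda>v. A *v v)"
      using herm idem range by simp
    fix Q assume Q: "hermitian Q \<and> Q ** Q = Q \<and> range (\<lambda>v. Q *v v) = range (\<lambda>v. A *v v)"
    have "Q = conj_transpose Q" using Q by (simp add: hermitian_def)
    also have "\<dots> = conj_transpose (P ** Q)" using absorb[OF idem, of Q] range Q by simp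
    also have "\<dots> = Q ** P" using Q herm by (simp add: conj_transpose_mult hermitian_def)
    also have "\<dots> = P" using absorb[of Q P] range Q by simp
    finally show "Q = P" .
  qed
  then show ?thesis by (simp add: A_def P_def)
qed

text \<open>A positive power has the same kernel as the range projection: the eigenvalues \<open>d\<^sup>r\<close> and \<open>1\<close> are nonzero
  for the same indices.\<close>

lemma range_projection_eq_iff_psd_powr_eq:
  assumes r: "0 < r" and A: "psd A"
  shows "range_projection A *v v = range_projection A *v w \<longleftrightarrow> psd_powr A r *v v = psd_powr A r *v w"
proof -
  obtain U d where U: "unitary U" "\<And>i. 0 \<le> d i" "A = U ** diag_mat d ** conj_transpose U"
    using psd_spectral_decomposition[OF A] by metis
  have "range_projection A *v (v - w) = 0 \<longleftrightarrow> psd_powr A r *v (v - w) = 0"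
    unfolding U(3) psd_powr_eq[OF r U(1,2)] range_projection_eq[OF U(1)] spectral_kernel[OF U(1)] by auto
  then show ?thesis by (simp add: matrix_vector_mult_diff_distrib)
qed

lemma closed_psd: "closed {A :: complex^'q^'q. psd A}"
proof -
  have "{A :: complex^'q^'q. psd A} = {A. \<forall>i j. cnj (A $ j $ i) = A $ i $ j} \<inter>
      {A. \<forall>v. 0 \<le> Re (\<Sum>i\<in>UNIV. (\<Sum>j\<in>UNIV. A $ i $ j * v $ j) * cnj (v $ i))}"
    by (auto simp: psd_def hermitian_def conj_transpose_def vec_eq_iff matrix_vector_nth)
  also have "closed \<dots>"
    by (intro closed_Int closed_Collect_all closed_Collect_eq closed_Collect_le continuous_intros)
  finally show ?thesis .
qed

section \<open>Variation of complex measures\<close>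

lemma sums_finite_pair:
  fixes f :: "nat \<Rightarrow> 'b::real_normed_vector"
  assumes "f sums s" "\<And>n. n \<ge> 2 \<Longrightarrow> f n = 0"
  shows "s = f 0 + f 1"
proof -
  have "f sums (\<Sum>n\<in>{0, 1}. f n)"
    using assms(2) by (intro sums_finite) auto
  then show ?thesis using sums_unique2[OF assms(1)] by simp
qed

lemma vector_measure_empty:
  assumes "vector_measure \<mu>"
  shows "\<mu> {} = 0"
proof -
  have "(\<lambda>n::nat. \<mu> {}) sums \<mu> (\<Union>n::nat. {})"
    using assms unfolding vector_measure_def by (elim allE[of _ "\<lambda>_. {}"]) (auto simp: disjoint_family_on_def)
  then have "summable (\<lambda>n::nat. \<mu> {})" by (rule sums_summable)
  then show ?thesis by (simp add: summable_const_iff)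
qed

lemma vector_measure_Un:
  assumes \<mu>: "vector_measure \<mu>" and AB: "A \<in> sets borel" "B \<in> sets borel" "A \<inter> B = {}"
  shows "\<mu> (A \<union> B) = \<mu> A + \<mu> B"
proof -
  define C where "C n = (if n = 0 then A else if n = 1 then B else {})" for n :: nat
  have "range C \<subseteq> sets borel" "disjoint_family C"
    using AB by (auto simp: C_def disjoint_family_on_def)
  then have "(\<lambda>n. \<mu> (C n)) sums \<mu> (\<Union>n. C n)"
    using \<mu> by (simp add: vector_measure_def)
  moreover have "(\<Union>n. C n) = A \<union> B"
    by (auto simp: C_def split: if_splits)
  ultimately show ?thesis
    using sums_finite_pair[of "\<lambda>n. \<mu> (C n)" "\<mu> (A \<union> B)"] vector_measure_empty[OF \<mu>]
    by (simp add: C_def)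
qed

lemma vector_measure_Diff:
  assumes \<mu>: "vector_measure \<mu>" and AB: "A \<in> sets borel" "B \<in> sets borel" "A \<subseteq> B"
  shows "\<mu> B = \<mu> A + \<mu> (B - A)"
proof -
  have "A \<union> (B - A) = B" using AB by auto
  then show ?thesis using vector_measure_Un[OF \<mu> AB(1), of "B - A"] AB by auto
qed

lemma vector_measure_mono_real:
  fixes m :: "'a::topological_space set \<Rightarrow> real"
  assumes "vector_measure m" "\<And>B. B \<in> sets borel \<Longrightarrow> 0 \<le> m B" "A \<in> sets borel" "B \<in> sets borel" "A \<subseteq> B"
  shows "m A \<le> m B"
  using vector_measure_Diff[OF assms(1,3-5)] assms(2)[of "B - A"] assms(3,4) by auto

lemma norm_le_variation:
  assumes C: "C \<in> sets borel" and "\<mu> {} = 0"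
  shows "ennreal (norm (\<mu> C)) \<le> variation \<mu> C"
proof (cases "C = {}")
  case False
  have "partition_on C {C}" using False by (simp add: partition_on_def)
  then have "(\<Sum>D\<in>{C}. ennreal (norm (\<mu> D))) \<le> variation \<mu> C"
    unfolding variation_def using C by (intro SUP_upper) auto
  then show ?thesis by simp
qed (use assms in simp)

lemma variation_mono:
  assumes B: "B \<in> sets borel" and C: "C \<in> sets borel" and sub: "C \<subseteq> B"
  shows "variation \<mu> C \<le> variation \<mu> B"
  unfolding variation_def[of \<mu> C]
proof (rule SUP_least)
  fix P assume "P \<in> {P. finite P \<and> partition_on C P \<and> P \<subseteq> sets borel}"
  then have P: "finite P" "\<Union>P = C" "disjoint P" "{} \<notin> P" "P \<subseteq> sets borel"
    by (auto simp: partition_on_def)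
  define Q where "Q = P \<union> ({B - C} - {{}})"
  have "partition_on B Q"
  proof (rule partition_onI)
    show "\<Union>Q = B" using P sub by (auto simp: Q_def)
    show "disjnt p q" if "p \<in> Q" "q \<in> Q" "p \<noteq> q" for p q
      using that P unfolding Q_def by (auto simp: disjnt_def pairwise_def)
    show "{} \<notin> Q" using P by (auto simp: Q_def)
  qed
  moreover have "finite Q" "Q \<subseteq> sets borel" using P B C by (auto simp: Q_def)
  ultimately have "(\<Sum>D\<in>Q. ennreal (norm (\<mu> D))) \<le> variation \<mu> B"
    unfolding variation_def by (intro SUP_upper) auto
  moreover have "(\<Sum>D\<in>P. ennreal (norm (\<mu> D))) \<le> (\<Sum>D\<in>Q. ennreal (norm (\<mu> D)))"
    using \<open>finite Q\<close> by (intro sum_mono2) (auto simp: Q_def)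
  ultimately show "(\<Sum>D\<in>P. ennreal (norm (\<mu> D))) \<le> variation \<mu> B" by simp
qed

lemma sum_norm_trace_le_variation:
  assumes P: "finite P" "disjoint P" "P \<subseteq> sets borel" and B: "B \<in> sets borel" "B \<subseteq> \<Union>P" and e: "\<mu> {} = 0"
  shows "(\<Sum>D\<in>P. ennreal (norm (\<mu> (D \<inter> B)))) \<le> variation \<mu> B"
proof -
  define Q where "Q = {D \<in> P. D \<inter> B \<noteq> {}}"
  have inj: "inj_on (\<lambda>D. D \<inter> B) Q"
  proof (rule inj_onI)
    fix D E assume "D \<in> Q" "E \<in> Q" "D \<inter> B = E \<inter> B"
    then have "D \<inter> E \<noteq> {}" "D \<in> P" "E \<in> P" by (auto simp: Q_def)
    then show "D = E" using P(2) by (meson disjointD)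
  qed
  have "(\<Sum>D\<in>P. ennreal (norm (\<mu> (D \<inter> B)))) = (\<Sum>D\<in>Q. ennreal (norm (\<mu> (D \<inter> B))))"
    using P e by (intro sum.mono_neutral_right) (auto simp: Q_def)
  also have "\<dots> = (\<Sum>D\<in>(\<lambda>D. D \<inter> B) ` Q. ennreal (norm (\<mu> D)))"
    by (simp add: sum.reindex[OF inj])
  also have "\<dots> \<le> variation \<mu> B"
  proof -
    have "partition_on B ((\<lambda>D. D \<inter> B) ` Q)"
    proof (rule partition_onI)
      show "\<Union>((\<lambda>D. D \<inter> B) ` Q) = B" using B by (auto simp: Q_def)
      show "disjnt p q" if "p \<in> (\<lambda>D. D \<inter> B) ` Q" "q \<in> (\<lambda>D. D \<inter> B) ` Q" "p \<noteq> q" for p q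
        using that P(2) unfolding Q_def pairwise_def disjnt_def by blast
      show "{} \<notin> (\<lambda>D. D \<inter> B) ` Q" by (auto simp: Q_def)
    qed
    moreover have "finite ((\<lambda>D. D \<inter> B) ` Q)" "(\<lambda>D. D \<inter> B) ` Q \<subseteq> sets borel"
      using P B by (auto simp: Q_def)
    ultimately show ?thesis unfolding variation_def by (intro SUP_upper) auto
  qed
  finally show ?thesis .
qed

text \<open>Every partition of \<open>B\<close> is refined by its traces on \<open>C\<close> and on \<open>B - C\<close>.\<close>

lemma variation_subadditive:
  assumes \<mu>: "vector_measure \<mu>" and C: "C \<in> sets borel" and B: "B \<in> sets borel" and sub: "C \<subseteq> B"
  shows "variation \<mu> B \<le> variation \<mu> C + variation \<mu> (B - C)"
  unfolding variation_def[of \<mu> B]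
proof (rule SUP_least)
  fix P assume "P \<in> {P. finite P \<and> partition_on B P \<and> P \<subseteq> sets borel}"
  then have P: "finite P" "\<Union>P = B" "disjoint P" "P \<subseteq> sets borel"
    by (auto simp: partition_on_def)
  have "(\<Sum>D\<in>P. ennreal (norm (\<mu> D))) \<le> (\<Sum>D\<in>P. ennreal (norm (\<mu> (D \<inter> C))) + ennreal (norm (\<mu> (D \<inter> (B - C)))))"
  proof (rule sum_mono)
    fix D assume D: "D \<in> P"
    have "D = (D \<inter> C) \<union> (D \<inter> (B - C))" using D P by auto
    moreover have "\<mu> ((D \<inter> C) \<union> (D \<inter> (B - C))) = \<mu> (D \<inter> C) + \<mu> (D \<inter> (B - C))"
      using D P B C by (intro vector_measure_Un[OF \<mu>]) auto
    ultimately have "norm (\<mu> D) \<le> norm (\<mu> (D \<inter> C)) + norm (\<mu> (D \<inter> (B - C)))"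
      using norm_triangle_ineq[of "\<mu> (D \<inter> C)" "\<mu> (D \<inter> (B - C))"] by simp
    then show "ennreal (norm (\<mu> D)) \<le> ennreal (norm (\<mu> (D \<inter> C))) + ennreal (norm (\<mu> (D \<inter> (B - C))))"
      by (simp add: ennreal_leI flip: ennreal_plus)
  qed
  also have "\<dots> = (\<Sum>D\<in>P. ennreal (norm (\<mu> (D \<inter> C)))) + (\<Sum>D\<in>P. ennreal (norm (\<mu> (D \<inter> (B - C)))))"
    by (rule sum.distrib)
  also have "\<dots> \<le> variation \<mu> C + variation \<mu> (B - C)"
    using P B C sub vector_measure_empty[OF \<mu>] by (intro add_mono sum_norm_trace_le_variation) auto
  finally show "(\<Sum>D\<in>P. ennreal (norm (\<mu> D))) \<le> variation \<mu> C + variation \<mu> (B - C)" .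
qed

lemma variation_nonneg_real:
  assumes \<mu>: "vector_measure \<mu>" and nn: "\<And>B. B \<in> sets borel \<Longrightarrow> \<mu> B = complex_of_real (Re (\<mu> B)) \<and> 0 \<le> Re (\<mu> B)"
    and B: "B \<in> sets borel"
  shows "variation \<mu> B = ennreal (Re (\<mu> B))"
proof (rule antisym)
  have nrm: "norm (\<mu> C) = Re (\<mu> C)" if "C \<in> sets borel" for C
    using nn[OF that] by (metis abs_of_nonneg norm_of_real)
  have add: "finite P \<Longrightarrow> disjoint P \<Longrightarrow> P \<subseteq> sets borel \<Longrightarrow> \<Union>P \<in> sets borel \<and> (\<Sum>D\<in>P. Re (\<mu> D)) = Re (\<mu> (\<Union>P))" for P
  proof (induction P rule: finite_induct)
    case empty
    then show ?case by (simp add: vector_measure_empty[OF \<mu>])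
  next
    case (insert D P)
    have "disjoint P" using insert.prems by (simp add: pairwise_insert)
    then have IH: "\<Union>P \<in> sets borel" "(\<Sum>D\<in>P. Re (\<mu> D)) = Re (\<mu> (\<Union>P))" using insert by auto
    have "D \<inter> \<Union>P = {}" using insert.prems insert.hyps by (auto simp: pairwise_insert disjnt_def)
    then have "\<mu> (D \<union> \<Union>P) = \<mu> D + \<mu> (\<Union>P)"
      using IH insert.prems by (intro vector_measure_Un[OF \<mu>]) auto
    moreover have "D \<union> \<Union>P \<in> sets borel" using IH insert.prems by (intro sets.Un) auto
    ultimately show ?case using IH insert by simp
  qed
  show "variation \<mu> B \<le> ennreal (Re (\<mu> B))"
    unfolding variation_def
  proof (rule SUP_least)
    fix P assume "P \<in> {P. finite P \<and> partition_on B P \<and> P \<subseteq> sets borel}"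
    then have P: "finite P" "\<Union>P = B" "disjoint P" "P \<subseteq> sets borel"
      by (auto simp: partition_on_def)
    have "(\<Sum>D\<in>P. ennreal (norm (\<mu> D))) = (\<Sum>D\<in>P. ennreal (Re (\<mu> D)))"
      using P nrm by (intro sum.cong) auto
    also have "\<dots> = ennreal (Re (\<mu> B))"
      using add[of P] P nn by (subst sum_ennreal) auto
    finally show "(\<Sum>D\<in>P. ennreal (norm (\<mu> D))) \<le> ennreal (Re (\<mu> B))" by simp
  qed
  show "ennreal (Re (\<mu> B)) \<le> variation \<mu> B"
    using norm_le_variation[OF B, of \<mu>] vector_measure_empty[OF \<mu>] nrm[OF B] by simp
qed

section \<open>Measures given by densities\<close>

text \<open>The Radon-Nikodym theorem for a finite nonnegative measure given as a real set function.\<close>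

lemma nonneg_vector_measure_density:
  fixes m :: "'a::topological_space set \<Rightarrow> real"
  assumes \<tau>: "sigma_finite_measure \<tau>" "sets \<tau> = sets borel"
    and m: "vector_measure m" and nn: "\<And>B. B \<in> sets borel \<Longrightarrow> 0 \<le> m B"
    and ac: "\<And>B. B \<in> sets borel \<Longrightarrow> emeasure \<tau> B = 0 \<Longrightarrow> m B = 0"
  obtains f where "integrable \<tau> f" "\<And>B. B \<in> sets borel \<Longrightarrow> (LINT x:B|\<tau>. f x) = m B"
proof -
  interpret sigma_finite_measure \<tau> by fact
  define N where "N = measure_of UNIV (sets borel) (\<lambda>B. ennreal (m B))"
  have sets_N: "sets N = sets borel"
    unfolding N_def by (metis sets.sets_measure_of_eq sets.top sets_measure_of_conv space_borel sets_measure_of sets.space_closed)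
  have em: "emeasure N B = ennreal (m B)" if "B \<in> sets borel" for B
    unfolding N_def
  proof (rule emeasure_measure_of_sigma[OF _ _ _ that])
    show "sigma_algebra UNIV (sets borel)" using sets.sigma_algebra_axioms[of borel] by simp
    show "positive (sets borel) (\<lambda>B. ennreal (m B))"
      by (simp add: positive_def vector_measure_empty[OF m])
    show "countably_additive (sets borel) (\<lambda>B. ennreal (m B))"
    proof (rule countably_additiveI)
      fix A :: "nat \<Rightarrow> 'a set" assume A: "range A \<subseteq> sets borel" "disjoint_family A"
      then have "(\<lambda>n. m (A n)) sums m (\<Union>n. A n)" using m by (simp add: vector_measure_def)
      then show "(\<Sum>n. ennreal (m (A n))) = ennreal (m (\<Union>n. A n))"
        using A nn by (intro sums_unique[symmetric] sums_ennreal[THEN iffD2]) (auto simp: range_subsetD)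
    qed
  qed
  interpret N: finite_measure N
    by (rule finite_measureI) (simp add: em sets_eq_imp_space_eq[OF sets_N])
  have abs: "absolutely_continuous \<tau> N"
    using ac \<tau> em by (auto simp: absolutely_continuous_def null_sets_def sets_N)
  obtain D where D: "D \<in> borel_measurable \<tau>" "AE x in \<tau>. RN_deriv \<tau> N x = ennreal (D x)" "\<And>x. 0 \<le> D x"
    using real_RN_deriv[OF N.finite_measure_axioms abs] sets_N \<tau>(2) by metis
  have hb: "has_bochner_integral \<tau> (\<lambda>x. indicator B x *\<^sub>R D x) (m B)" if B: "B \<in> sets borel" for B
  proof (rule has_bochner_integral_nn_integral)
    have "(\<integral>\<^sup>+x. ennreal (indicator B x *\<^sub>R D x) \<partial>\<tau>) = (\<integral>\<^sup>+x. RN_deriv \<tau> N x * indicator B x \<partial>\<tau>)"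
      using D(2) by (intro nn_integral_cong_AE) (auto split: split_indicator)
    also have "\<dots> = emeasure (density \<tau> (RN_deriv \<tau> N)) B"
      using B \<tau>(2) by (simp add: emeasure_density)
    also have "\<dots> = ennreal (m B)"
      using density_RN_deriv[OF abs] sets_N \<tau>(2) em[OF B] by simp
    finally show "(\<integral>\<^sup>+x. ennreal (indicator B x *\<^sub>R D x) \<partial>\<tau>) = ennreal (m B)" .
  qed (use D B nn \<tau>(2) in \<open>auto\<close>)
  show thesis
  proof (rule that[of D])
    show "integrable \<tau> D" using hb[of UNIV] by (auto simp: has_bochner_integral_iff)
    show "(LINT x:B|\<tau>. D x) = m B" if "B \<in> sets borel" for B
      using hb[OF that] by (simp add: set_lebesgue_integral_def has_bochner_integral_iff)
  qed
qed

lemma vector_measure_integral: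
  fixes w :: "'a::topological_space \<Rightarrow> 'b::{banach, second_countable_topology}"
  assumes w: "integrable \<tau> w" and \<tau>: "sets \<tau> = sets borel"
  shows "vector_measure (\<lambda>B. LINT x:B|\<tau>. w x)"
  unfolding vector_measure_def
proof (intro allI impI)
  fix A :: "nat \<Rightarrow> 'a set" assume A: "range A \<subseteq> sets borel" "disjoint_family A"
  note [measurable] = borel_measurable_integrable[OF w]
  have [measurable]: "A n \<in> sets \<tau>" "A n \<in> sets borel" for n using A \<tau> by auto
  have int: "integrable \<tau> (\<lambda>x. indicator (A n) x *\<^sub>R w x)" for n
    by (intro integrable_mult_indicator w) auto
  have part: "(\<Sum>k<n. indicator (A k) x) = (indicator (\<Union>k<n. A k) x :: real)" for n x
    using A(2) by (subst indicator_UN_disjoint) (auto intro: disjoint_family_on_mono)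
  have eq: "(\<Sum>k<n. indicator (A k) x *\<^sub>R w x) = indicator (\<Union>k<n. A k) x *\<^sub>R w x" for n x
    by (simp only: scaleR_sum_left[symmetric] part)
  have "(\<lambda>n. LINT x|\<tau>. (\<Sum>k<n. indicator (A k) x *\<^sub>R w x)) \<longlonglongrightarrow> (LINT x|\<tau>. indicator (\<Union>n. A n) x *\<^sub>R w x)"
  proof (rule integral_dominated_convergence[where w = "\<lambda>x. norm (w x)"])
    have "(\<lambda>n. indicator (\<Union>k<n. A k) x :: real) \<longlonglongrightarrow> indicator (\<Union>n. A n) x" for x
      by (rule LIMSEQ_indicator_UN)
    then show "AE x in \<tau>. (\<lambda>n. \<Sum>k<n. indicator (A k) x *\<^sub>R w x) \<longlonglongrightarrow> indicator (\<Union>n. A n) x *\<^sub>R w x"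
      unfolding eq by (intro AE_I2 tendsto_scaleR tendsto_const)
    show "AE x in \<tau>. norm (\<Sum>k<n. indicator (A k) x *\<^sub>R w x) \<le> norm (w x)" for n
      unfolding eq by (intro AE_I2) (simp add: indicator_def)
    show "(\<lambda>x. \<Sum>k<n. indicator (A k) x *\<^sub>R w x) \<in> borel_measurable \<tau>" for n
      by (intro borel_measurable_sum borel_measurable_integrable int)
    show "integrable \<tau> (\<lambda>x. norm (w x))" using w by simp
  qed measurable
  moreover have "(LINT x|\<tau>. (\<Sum>k<n. indicator (A k) x *\<^sub>R w x)) = (\<Sum>k<n. LINT x|\<tau>. indicator (A k) x *\<^sub>R w x)" for n
    by (intro Bochner_Integration.integral_sum int)
  ultimately show "(\<lambda>n. LINT x:A n|\<tau>. w x) sums (LINT x:(\<Union>n. A n)|\<tau>. w x)"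
    unfolding sums_def set_lebesgue_integral_def by simp
qed

lemma variation_integral_le:
  fixes w :: "'a::topological_space \<Rightarrow> complex"
  assumes w: "integrable \<tau> w" and \<tau>: "sets \<tau> = sets borel" and B: "B \<in> sets borel"
  shows "variation (\<lambda>B. LINT x:B|\<tau>. w x) B \<le> emeasure (density \<tau> (\<lambda>x. ennreal (norm (w x)))) B"
  unfolding variation_def
proof (rule SUP_least)
  note [measurable] = borel_measurable_integrable[OF w]
  let ?\<nu> = "density \<tau> (\<lambda>x. ennreal (norm (w x)))"
  fix P assume "P \<in> {P. finite P \<and> partition_on B P \<and> P \<subseteq> sets borel}"
  then have P: "finite P" "\<Union>P = B" "disjoint P" "P \<subseteq> sets borel"
    by (auto simp: partition_on_def)
  have "(\<Sum>C\<in>P. ennreal (norm (LINT x:C|\<tau>. w x))) \<le> (\<Sum>C\<in>P. emeasure ?\<nu> C)"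
  proof (rule sum_mono)
    fix C assume "C \<in> P"
    then have C: "C \<in> sets \<tau>" using P \<tau> by auto
    have "ennreal (norm (LINT x:C|\<tau>. w x)) \<le> (\<integral>\<^sup>+x. ennreal (norm (indicator C x *\<^sub>R w x)) \<partial>\<tau>)"
      unfolding set_lebesgue_integral_def using C w
      by (intro integral_norm_bound_ennreal integrable_mult_indicator)
    also have "\<dots> = emeasure ?\<nu> C"
      using C by (auto simp: emeasure_density intro!: nn_integral_cong split: split_indicator)
    finally show "ennreal (norm (LINT x:C|\<tau>. w x)) \<le> emeasure ?\<nu> C" .
  qed
  also have "\<dots> = emeasure ?\<nu> B"
    using sum_emeasure[of "\<lambda>x. x" P ?\<nu>] P \<tau> by (auto simp: disjoint_family_on_def pairwise_def disjnt_def)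
  finally show "(\<Sum>C\<in>P. ennreal (norm (LINT x:C|\<tau>. w x))) \<le> emeasure ?\<nu> B" .
qed

text \<open>The supremum over subsets of \<open>B\<close> is attained at the part of \<open>B\<close> where the density is positive.\<close>

lemma positive_part_integral:
  fixes u :: "'a::topological_space \<Rightarrow> real"
  assumes u: "integrable \<tau> u" and \<tau>: "sets \<tau> = sets borel"
  shows "positive_part (\<lambda>B. LINT x:B|\<tau>. u x) = density \<tau> (\<lambda>x. ennreal (max 0 (u x)))"
proof -
  note [measurable] = borel_measurable_integrable[OF u]
  let ?D = "density \<tau> (\<lambda>x. ennreal (max 0 (u x)))"
  have space: "space ?D = UNIV" using sets_eq_imp_space_eq[OF \<tau>] by simp
  have mp: "integrable \<tau> (\<lambda>x. max 0 (u x))" using u by (intro integrable_max) auto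
  have pos: "emeasure ?D B = ennreal (LINT x:B|\<tau>. max 0 (u x))" if B: "B \<in> sets \<tau>" for B
  proof -
    have "emeasure ?D B = (\<integral>\<^sup>+x. ennreal (indicator B x *\<^sub>R max 0 (u x)) \<partial>\<tau>)"
      using B by (auto simp: emeasure_density intro!: nn_integral_cong split: split_indicator)
    also have "\<dots> = ennreal (LINT x:B|\<tau>. max 0 (u x))"
      unfolding set_lebesgue_integral_def
      using B mp by (intro nn_integral_eq_integral integrable_mult_indicator) auto
    finally show ?thesis .
  qed
  have "(SUP C\<in>{C \<in> sets borel. C \<subseteq> B}. ennreal (LINT x:C|\<tau>. u x)) = emeasure ?D B" if B: "B \<in> sets borel" for B
  proof (rule antisym)
    have Bt: "B \<in> sets \<tau>" using B \<tau> by simp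
    show "(SUP C\<in>{C \<in> sets borel. C \<subseteq> B}. ennreal (LINT x:C|\<tau>. u x)) \<le> emeasure ?D B"
    proof (rule SUP_least)
      fix C assume C: "C \<in> {C \<in> sets borel. C \<subseteq> B}"
      have "(LINT x:C|\<tau>. u x) \<le> (LINT x:B|\<tau>. max 0 (u x))"
        unfolding set_lebesgue_integral_def using C Bt \<tau>
        by (intro integral_mono integrable_mult_indicator u mp) (auto split: split_indicator)
      then show "ennreal (LINT x:C|\<tau>. u x) \<le> emeasure ?D B" by (simp add: pos[OF Bt] ennreal_leI)
    qed
    define C where "C = B \<inter> {x \<in> space \<tau>. 0 < u x}"
    have "C \<in> sets \<tau>" unfolding C_def using Bt by measurable
    then have "C \<in> {C \<in> sets borel. C \<subseteq> B}" using \<tau> by (auto simp: C_def)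
    moreover have "(LINT x:C|\<tau>. u x) = (LINT x:B|\<tau>. max 0 (u x))"
      unfolding set_lebesgue_integral_def
      by (intro Bochner_Integration.integral_cong) (auto simp: C_def split: split_indicator)
    ultimately show "emeasure ?D B \<le> (SUP C\<in>{C \<in> sets borel. C \<subseteq> B}. ennreal (LINT x:C|\<tau>. u x))"
      by (intro SUP_upper2[of C]) (auto simp: pos[OF Bt])
  qed
  then have "positive_part (\<lambda>B. LINT x:B|\<tau>. u x) = measure_of UNIV (sets borel) (emeasure ?D)"
    unfolding positive_part_def
    using sets.sigma_sets_eq[of "borel :: 'a measure"] by (intro measure_of_eq) auto
  also have "\<dots> = ?D"
    using measure_of_of_measure[of ?D] space \<tau> by simp
  finally show ?thesis .
qed

lemma integrable_mult_bounded:
  fixes v f :: "'a \<Rightarrow> complex"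
  assumes v: "integrable \<tau> v" and f [measurable]: "f \<in> borel_measurable \<tau>" and c: "\<And>x. norm (f x) \<le> c"
  shows "integrable \<tau> (\<lambda>x. v x * f x)"
proof (rule Bochner_Integration.integrable_bound)
  note [measurable] = borel_measurable_integrable[OF v]
  have c0: "0 \<le> c" using c norm_ge_zero order_trans by blast
  show "AE x in \<tau>. norm (v x * f x) \<le> norm (c * norm (v x))"
    using c c0 by (intro AE_I2) (simp add: norm_mult mult.commute mult_right_mono)
  show "integrable \<tau> (\<lambda>x. c * norm (v x))" using v by simp
  show "(\<lambda>x. v x * f x) \<in> borel_measurable \<tau>" by measurable
qed

lemma integral_positive_parts:
  fixes u :: "'a::topological_space \<Rightarrow> real" and f :: "'a \<Rightarrow> complex"
  assumes u: "integrable \<tau> u" and \<tau>: "sets \<tau> = sets borel"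
    and f: "f \<in> borel_measurable borel" "\<And>x. norm (f x) \<le> c"
  shows "(LINT x|positive_part (\<lambda>B. LINT x:B|\<tau>. u x). f x) - (LINT x|positive_part (\<lambda>B. - (LINT x:B|\<tau>. u x)). f x) =
    (LINT x|\<tau>. complex_of_real (u x) * f x)"
proof -
  note [measurable] = borel_measurable_integrable[OF u]
  have [measurable]: "f \<in> borel_measurable \<tau>" using f(1) by (simp add: measurable_cong_sets[OF \<tau> refl])
  have int: "integrable \<tau> (\<lambda>x. max 0 (v x) *\<^sub>R f x)" if v: "integrable \<tau> v" for v :: "'a \<Rightarrow> real"
  proof -
    have "integrable \<tau> (\<lambda>x. complex_of_real (max 0 (v x)))" using v by simp
    then have "integrable \<tau> (\<lambda>x. complex_of_real (max 0 (v x)) * f x)"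
      by (rule integrable_mult_bounded) (use f in \<open>simp_all add: measurable_cong_sets[OF \<tau> refl]\<close>)
    then show ?thesis by (simp only: scaleR_conv_of_real)
  qed
  have mu: "integrable \<tau> (\<lambda>x. - u x)" using u by simp
  have dens: "(LINT x|density \<tau> (\<lambda>x. ennreal (max 0 (v x))). f x) = (LINT x|\<tau>. max 0 (v x) *\<^sub>R f x)"
    if v: "integrable \<tau> v" for v :: "'a \<Rightarrow> real"
  proof (rule integral_density)
    note [measurable] = borel_measurable_integrable[OF v]
    show "(\<lambda>x. max 0 (v x)) \<in> borel_measurable \<tau>" by measurable
  qed simp_all
  have neg: "(\<lambda>B. - (LINT x:B|\<tau>. u x)) = (\<lambda>B. LINT x:B|\<tau>. - u x)"
    by (simp add: set_lebesgue_integral_def)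
  have "(LINT x|positive_part (\<lambda>B. LINT x:B|\<tau>. u x). f x) - (LINT x|positive_part (\<lambda>B. - (LINT x:B|\<tau>. u x)). f x)
      = (LINT x|\<tau>. max 0 (u x) *\<^sub>R f x) - (LINT x|\<tau>. max 0 (- u x) *\<^sub>R f x)"
    unfolding neg positive_part_integral[OF u \<tau>] positive_part_integral[OF mu \<tau>]
    by (simp only: dens[OF u] dens[OF mu])
  also have "\<dots> = (LINT x|\<tau>. max 0 (u x) *\<^sub>R f x - max 0 (- u x) *\<^sub>R f x)"
    by (intro Bochner_Integration.integral_diff[symmetric] int u mu)
  also have "\<dots> = (LINT x|\<tau>. complex_of_real (u x) * f x)"
    by (intro Bochner_Integration.integral_cong) (auto simp: max_def scaleR_conv_of_real)
  finally show ?thesis .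
qed

lemma integral_cm_density:
  fixes w f :: "'a::topological_space \<Rightarrow> complex"
  assumes w: "integrable \<tau> w" and \<tau>: "sets \<tau> = sets borel"
    and f: "f \<in> borel_measurable borel" "\<And>x. norm (f x) \<le> c"
  shows "integral_cm (\<lambda>B. LINT x:B|\<tau>. w x) f = (LINT x|\<tau>. w x * f x)"
proof -
  note [measurable] = borel_measurable_integrable[OF w]
  have [measurable]: "f \<in> borel_measurable \<tau>" using f(1) by (simp add: measurable_cong_sets[OF \<tau> refl])
  have ind: "integrable \<tau> (\<lambda>x. indicator B x *\<^sub>R w x)" if "B \<in> sets borel" for B
    using that w \<tau> by (intro integrable_mult_indicator) auto
  have bd: "integrable \<tau> (\<lambda>x. v x * f x)" if "integrable \<tau> v" for v :: "'a \<Rightarrow> complex"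
    using that by (rule integrable_mult_bounded) (use f in \<open>simp_all add: measurable_cong_sets[OF \<tau> refl]\<close>)
  have ReIm: "integrable \<tau> (\<lambda>x. Re (w x))" "integrable \<tau> (\<lambda>x. Im (w x))" using w by auto
  have pp: "positive_part (\<lambda>B. g (LINT x:B|\<tau>. w x)) = positive_part (\<lambda>B. h B)"
    if "\<And>B. B \<in> sets borel \<Longrightarrow> g (LINT x:B|\<tau>. w x) = h B" for g h
    unfolding positive_part_def using sets.sigma_sets_eq[of "borel :: 'a measure"] that
    by (intro measure_of_eq) (auto intro!: SUP_cong)
  have Re: "Re (LINT x:B|\<tau>. w x) = (LINT x:B|\<tau>. Re (w x))" and Im: "Im (LINT x:B|\<tau>. w x) = (LINT x:B|\<tau>. Im (w x))"
    if "B \<in> sets borel" for B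
    using integral_Re[OF ind[OF that]] integral_Im[OF ind[OF that]]
    by (simp_all add: set_lebesgue_integral_def)
  have "integral_cm (\<lambda>B. LINT x:B|\<tau>. w x) f =
      (LINT x|\<tau>. complex_of_real (Re (w x)) * f x) + \<i> * (LINT x|\<tau>. complex_of_real (Im (w x)) * f x)"
    unfolding integral_cm_def
    using pp[of Re, OF Re] pp[of "\<lambda>z. - Re z" "\<lambda>B. - (LINT x:B|\<tau>. Re (w x))"]
      pp[of Im, OF Im] pp[of "\<lambda>z. - Im z" "\<lambda>B. - (LINT x:B|\<tau>. Im (w x))"]
    by (simp add: Re Im integral_positive_parts[OF ReIm(1) \<tau> f] integral_positive_parts[OF ReIm(2) \<tau> f])
  also have "\<dots> = (LINT x|\<tau>. complex_of_real (Re (w x)) * f x + \<i> * (complex_of_real (Im (w x)) * f x))"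
    using bd[of "\<lambda>x. complex_of_real (Re (w x))"] bd[of "\<lambda>x. complex_of_real (Im (w x))"] ReIm by simp
  also have "\<dots> = (LINT x|\<tau>. w x * f x)"
    by (intro Bochner_Integration.integral_cong refl) (subst (3) complex_eq, simp add: algebra_simps)
  finally show ?thesis .
qed

lemma AE_zero_if_variation_zero:
  fixes w :: "'a::topological_space \<Rightarrow> complex"
  assumes \<tau>: "sigma_finite_measure \<tau>" "sets \<tau> = sets borel" and w: "integrable \<tau> w"
    and N: "N \<in> sets borel" "variation (\<lambda>B. LINT x:B|\<tau>. w x) N = 0"
  shows "AE x in \<tau>. x \<in> N \<longrightarrow> w x = 0"
proof -
  interpret sigma_finite_measure \<tau> by fact
  have Nt: "N \<in> sets \<tau>" using N \<tau> by simp
  have "AE x in \<tau>. indicator N x *\<^sub>R w x = 0"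
  proof (rule density_zero)
    show "integrable \<tau> (\<lambda>x. indicator N x *\<^sub>R w x)" using w Nt by (rule integrable_mult_indicator[rotated])
    fix B assume "B \<in> sets \<tau>"
    then have B: "N \<inter> B \<in> sets borel" using N \<tau> by auto
    have "ennreal (norm (LINT x:(N \<inter> B)|\<tau>. w x)) \<le> variation (\<lambda>B. LINT x:B|\<tau>. w x) (N \<inter> B)"
      by (rule norm_le_variation[OF B]) (simp add: set_lebesgue_integral_def)
    also have "\<dots> \<le> variation (\<lambda>B. LINT x:B|\<tau>. w x) N" by (rule variation_mono) (use N B in auto)
    finally have "(LINT x:(N \<inter> B)|\<tau>. w x) = 0" using N by simp
    then show "(LINT x:B|\<tau>. indicator N x *\<^sub>R w x) = 0"
      by (simp add: set_lebesgue_integral_def indicator_inter_arith mult.commute)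
  qed
  then show ?thesis by eventually_elim (auto simp: indicator_def)
qed

section \<open>Positive semidefinite matrix-valued measures\<close>

lemma vector_measure_bounded_linear:
  assumes "vector_measure \<mu>" "bounded_linear T"
  shows "vector_measure (\<lambda>B. T (\<mu> B))"
  using assms bounded_linear.sums unfolding vector_measure_def by blast

lemma vector_measure_matrix:
  assumes "\<And>i j. vector_measure (\<lambda>B. M B $ i $ j)"
  shows "vector_measure (M :: 'a::topological_space set \<Rightarrow> complex^'q^'q)"
  unfolding vector_measure_def
proof (intro allI impI)
  fix A :: "nat \<Rightarrow> 'a set" assume A: "range A \<subseteq> sets borel" "disjoint_family A"
  have "(\<lambda>n. M (A n) $ i $ j) sums (M (\<Union>n. A n) $ i $ j)" for i j
    using assms[of i j] A unfolding vector_measure_def by blast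
  then show "(\<lambda>n. M (A n)) sums M (\<Union>n. A n)"
    unfolding sums_def by (intro vec_tendstoI) simp
qed

definition quad_form :: "complex^'q \<Rightarrow> complex^'q^'q \<Rightarrow> real" where
  "quad_form v A = (A *v v) \<bullet> v"

lemma matrix_vector_mult_scaleR_left: "(c *\<^sub>R A) *v x = c *\<^sub>R (A *v (x::complex^'n))"
  by (simp add: vec_eq_iff matrix_vector_nth scaleR_sum_right)

lemma bounded_linear_quad_form: "bounded_linear (quad_form v)"
  unfolding linear_conv_bounded_linear[symmetric] quad_form_def
  by (rule linearI) (simp_all add: matrix_vector_mult_add_rdistrib inner_add_left matrix_vector_mult_scaleR_left)

lemma bounded_linear_re_trace: "bounded_linear re_trace"
  unfolding linear_conv_bounded_linear[symmetric] re_trace_def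
  by (rule linearI) (simp_all add: sum.distrib sum_distrib_left)

lemma quad_form_add:
  assumes "hermitian A"
  shows "quad_form (x + y) A = quad_form x A + quad_form y A + 2 * ((A *v x) \<bullet> y)"
proof -
  have "(A *v y) \<bullet> x = (A *v x) \<bullet> y"
    using inner_conj_transpose[of A y x] assms by (simp add: hermitian_def inner_commute)
  then show ?thesis
    by (simp add: quad_form_def matrix_vector_right_distrib inner_add_left inner_add_right)
qed

lemma inner_matrix_axis: "(A *v axis j 1) \<bullet> axis i c = Re (A $ i $ j * cnj c)"
proof -
  have "(A *v axis j 1) $ i = A $ i $ j"
    by (simp add: matrix_vector_nth axis_def if_distrib[of "\<lambda>x. _ * x"] cong: if_cong)
  then show ?thesis by (simp add: inner_axis inner_complex_def)
qed

text \<open>Polarisation: the entries of a Hermitian matrix are real linear combinations of values of its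
  quadratic form.\<close>

lemma hermitian_entry:
  assumes "hermitian A"
  shows "Re (A $ i $ j) = (quad_form (axis j 1 + axis i 1) A - quad_form (axis j 1) A - quad_form (axis i 1) A) / 2"
    and "Im (A $ i $ j) = (quad_form (axis j 1 + axis i \<i>) A - quad_form (axis j 1) A - quad_form (axis i \<i>) A) / 2"
  by (simp_all add: quad_form_add[OF assms] inner_matrix_axis)

lemma matrix_sum_axis:
  fixes A :: "complex^'q^'q"
  shows "(\<Sum>i\<in>UNIV. \<Sum>j\<in>UNIV. Re (A $ i $ j) *\<^sub>R axis i (axis j 1) + Im (A $ i $ j) *\<^sub>R axis i (axis j \<i>)) = A"
proof -
  have "(\<Sum>i\<in>UNIV. \<Sum>j\<in>UNIV. Re (A $ i $ j) *\<^sub>R axis i (axis j 1) + Im (A $ i $ j) *\<^sub>R axis i (axis j \<i>)) $ k $ l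
      = (\<Sum>i\<in>UNIV. \<Sum>j\<in>UNIV. if i = k then (if j = l then A $ i $ j else 0) else 0)" for k l
    by (simp only: sum_component vector_add_component vector_scaleR_component)
      (intro sum.cong refl, auto simp: axis_def complex_eq_iff)
  also have "(\<Sum>i\<in>UNIV. \<Sum>j\<in>UNIV. if i = k then (if j = l then A $ i $ j else 0) else 0) = A $ k $ l" for k l
    by (subst sum.swap) simp
  finally show ?thesis by (simp add: vec_eq_iff)
qed

text \<open>Countably many test vectors suffice, which is what makes the property accessible almost everywhere.\<close>

lemma psdI_dense:
  assumes D: "\<And>U::(complex^'q) set. open U \<Longrightarrow> U \<noteq> {} \<Longrightarrow> \<exists>d\<in>D. d \<in> U"
    and h: "hermitian A" and nn: "\<And>d. d \<in> D \<Longrightarrow> 0 \<le> quad_form d A"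
  shows "psd (A :: complex^'q^'q)"
proof -
  have cont: "continuous_on UNIV (\<lambda>v::complex^'q. quad_form v A)"
  proof -
    have "linear (\<lambda>v::complex^'q. A *v v)"
      by (rule linearI) (simp_all add: matrix_vector_right_distrib matrix_vector_mult_scaleR)
    then show ?thesis unfolding quad_form_def
      by (intro continuous_intros linear_continuous_on linear_conv_bounded_linear[THEN iffD1])
  qed
  have "0 \<le> quad_form v A" for v
  proof (rule ccontr)
    assume "\<not> 0 \<le> quad_form v A"
    then have "v \<in> {v. quad_form v A < 0}" by simp
    then have "{v. quad_form v A < 0} \<noteq> {}" by blast
    moreover have "open {v. quad_form v A < 0}"
      using cont by (intro open_Collect_less continuous_intros)
    ultimately obtain d where "d \<in> D" "quad_form d A < 0" using D by blast
    then show False using nn by force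
  qed
  then show ?thesis using h by (simp add: psd_def quad_form_def inner_complex_vec)
qed

lemma psd_zero: "psd 0"
  by (simp add: psd_def hermitian_def conj_transpose_def vec_eq_iff)

text \<open>The standing assumptions on a regular positive semidefinite matrix measure and a \<open>\<sigma>\<close>-finite measure
  dominating it.\<close>

locale psd_matrix_measure = sigma_finite_measure \<tau>
  for \<tau> :: "'a::t2_space measure" +
  fixes M :: "'a set \<Rightarrow> complex^'q^'q"
  assumes sets_eq: "sets \<tau> = sets borel"
    and regular: "regular_mat M"
    and psd_M: "\<And>B. B \<in> sets borel \<Longrightarrow> psd (M B)"
    and abs_cont: "abs_cont_mat \<tau> M"
begin

lemma space_eq: "space \<tau> = UNIV"
  using sets_eq_imp_space_eq[OF sets_eq] by simp

lemma vector_measure_M: "vector_measure M"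
  using regular by (intro vector_measure_matrix) (auto simp: regular_mat_def regular_cm_def)

lemma null_M:
  assumes "B \<in> sets borel" "emeasure \<tau> B = 0"
  shows "M B = 0"
proof -
  have "M B $ i $ j = 0" for i j
  proof -
    have "variation (\<lambda>B. M B $ i $ j) B = 0"
      using abs_cont assms by (auto simp: abs_cont_mat_def abs_cont_cm_def)
    moreover have "ennreal (norm (M B $ i $ j)) \<le> variation (\<lambda>B. M B $ i $ j) B"
      using assms by (intro norm_le_variation) (simp_all add: vector_measure_empty[OF vector_measure_M])
    ultimately show ?thesis by simp
  qed
  then show ?thesis by (simp add: vec_eq_iff)
qed

lemma hermitian_M: "B \<in> sets borel \<Longrightarrow> hermitian (M B)"
  using psd_M by (auto simp: psd_def)

text \<open>Each \<open>v\<^sup>* M v\<close> is a finite nonnegative measure and has a scalar density; polarisation assembles these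
  densities to a matrix.\<close>

lemma density_exists:
  "\<exists>W. integrable \<tau> W \<and> (\<forall>B\<in>sets borel. (LINT x:B|\<tau>. W x) = M B)"
proof -
  have "\<exists>f. integrable \<tau> f \<and> (\<forall>B\<in>sets borel. (LINT x:B|\<tau>. f x) = quad_form v (M B))" for v
  proof -
    have "quad_form v (M B) = 0" if "B \<in> sets borel" "emeasure \<tau> B = 0" for B
      using null_M[OF that] by (simp add: quad_form_def)
    moreover have "0 \<le> quad_form v (M B)" if "B \<in> sets borel" for B
      using psd_inner_nonneg[OF psd_M[OF that]] by (simp add: quad_form_def)
    ultimately show ?thesis
      using nonneg_vector_measure_density[OF sigma_finite_measure_axioms sets_eq
          vector_measure_bounded_linear[OF vector_measure_M bounded_linear_quad_form[of v]]] by metis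
  qed
  then obtain f where f: "\<And>v. integrable \<tau> (f v)" "\<And>v B. B \<in> sets borel \<Longrightarrow> (LINT x:B|\<tau>. f v x) = quad_form v (M B)"
    by metis
  define r where "r i j x = (f (axis j 1 + axis i 1) x - f (axis j 1) x - f (axis i 1) x) / 2" for i j x
  define s where "s i j x = (f (axis j 1 + axis i \<i>) x - f (axis j 1) x - f (axis i \<i>) x) / 2" for i j x
  define W :: "'a \<Rightarrow> complex^'q^'q" where
    "W x = (\<Sum>i\<in>UNIV. \<Sum>j\<in>UNIV. r i j x *\<^sub>R axis i (axis j 1) + s i j x *\<^sub>R axis i (axis j \<i>))" for x
  have hb: "has_bochner_integral \<tau> (\<lambda>x. indicator B x *\<^sub>R W x) (M B)" if B: "B \<in> sets borel" for B
  proof -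
    have f': "has_bochner_integral \<tau> (\<lambda>x. indicator B x * f v x) (quad_form v (M B))" for v
      using f(2)[OF B, of v] integrable_mult_indicator[OF _ f(1), of B v] B sets_eq
      by (simp add: has_bochner_integral_iff set_lebesgue_integral_def)
    have r: "has_bochner_integral \<tau> (\<lambda>x. indicator B x * r i j x) (Re (M B $ i $ j))" for i j
    proof -
      have "has_bochner_integral \<tau> (\<lambda>x. (indicator B x * f (axis j 1 + axis i 1) x - indicator B x * f (axis j 1) x
          - indicator B x * f (axis i 1) x) / 2) (Re (M B $ i $ j))"
        unfolding hermitian_entry[OF hermitian_M[OF B]]
        by (intro has_bochner_integral_divide_zero has_bochner_integral_diff f')
      then show ?thesis by (simp add: r_def algebra_simps)
    qed
    have s: "has_bochner_integral \<tau> (\<lambda>x. indicator B x * s i j x) (Im (M B $ i $ j))" for i j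
    proof -
      have "has_bochner_integral \<tau> (\<lambda>x. (indicator B x * f (axis j 1 + axis i \<i>) x - indicator B x * f (axis j 1) x
          - indicator B x * f (axis i \<i>) x) / 2) (Im (M B $ i $ j))"
        unfolding hermitian_entry[OF hermitian_M[OF B]]
        by (intro has_bochner_integral_divide_zero has_bochner_integral_diff f')
      then show ?thesis by (simp add: s_def algebra_simps)
    qed
    have "has_bochner_integral \<tau> (\<lambda>x. \<Sum>i\<in>UNIV. \<Sum>j\<in>UNIV. (indicator B x * r i j x) *\<^sub>R axis i (axis j 1) + (indicator B x * s i j x) *\<^sub>R axis i (axis j \<i>))
       (\<Sum>i\<in>UNIV. \<Sum>j\<in>UNIV. Re (M B $ i $ j) *\<^sub>R axis i (axis j 1) + Im (M B $ i $ j) *\<^sub>R axis i (axis j \<i>))"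
      by (intro has_bochner_integral_sum has_bochner_integral_add has_bochner_integral_scaleR_left r s)
    then show ?thesis
      unfolding matrix_sum_axis by (simp add: W_def scaleR_sum_right scaleR_add_right)
  qed
  have "integrable \<tau> W" using hb[of UNIV] by (simp add: has_bochner_integral_iff)
  moreover have "(LINT x:B|\<tau>. W x) = M B" if "B \<in> sets borel" for B
    using hb[OF that] by (simp add: has_bochner_integral_iff set_lebesgue_integral_def)
  ultimately show ?thesis by blast
qed

abbreviation "W \<equiv> mat_deriv \<tau> M"

lemma W_integrable: "integrable \<tau> W"
  and W_integral: "B \<in> sets borel \<Longrightarrow> (LINT x:B|\<tau>. W x) = M B"
  using someI_ex[OF density_exists] by (auto simp: mat_deriv_def)

lemma integral_linear_W:
  assumes T: "bounded_linear T" and B: "B \<in> sets borel"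
  shows "integrable \<tau> (\<lambda>x. T (W x))" "(LINT x:B|\<tau>. T (W x)) = T (M B)"
proof -
  interpret T: bounded_linear T by fact
  show "integrable \<tau> (\<lambda>x. T (W x))" by (rule integrable_bounded_linear[OF T W_integrable])
  have "integrable \<tau> (\<lambda>x. indicator B x *\<^sub>R W x)"
    using B sets_eq by (intro integrable_mult_indicator W_integrable) simp
  then have "(LINT x|\<tau>. T (indicator B x *\<^sub>R W x)) = T (LINT x|\<tau>. indicator B x *\<^sub>R W x)"
    by (rule integral_bounded_linear[OF T])
  then show "(LINT x:B|\<tau>. T (W x)) = T (M B)"
    using W_integral[OF B] by (simp add: set_lebesgue_integral_def T.scaleR)
qed

text \<open>Hermitian symmetry and nonnegativity of each quadratic form hold for the integrals over all Borel
  sets, hence almost everywhere for the density.\<close>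

lemma AE_psd_W: "AE x in \<tau>. psd (W x)"
proof -
  have entry: "bounded_linear (\<lambda>A::complex^'q^'q. A $ i $ j)" for i j
    using bounded_linear_compose[OF bounded_linear_vec_nth bounded_linear_vec_nth] .
  have "AE x in \<tau>. cnj (W x $ j $ i) = W x $ i $ j" for i j
  proof (rule density_unique_banach)
    fix B assume "B \<in> sets \<tau>"
    then have B: "B \<in> sets borel" using sets_eq by simp
    show "(LINT x:B|\<tau>. cnj (W x $ j $ i)) = (LINT x:B|\<tau>. W x $ i $ j)"
      using hermitian_M[OF B] integral_linear_W(2)[OF entry B, of i j]
        integral_linear_W(2)[OF bounded_linear_compose[OF bounded_linear_cnj entry] B, of j i]
      by (simp add: hermitian_def conj_transpose_def vec_eq_iff)
  qed (use integral_linear_W(1)[OF entry, of UNIV] integral_linear_W(1)[OF bounded_linear_compose[OF bounded_linear_cnj entry], of UNIV] in auto)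
  then have "AE x in \<tau>. \<forall>i j. cnj (W x $ j $ i) = W x $ i $ j"
    unfolding AE_all_countable by blast
  then have herm: "AE x in \<tau>. hermitian (W x)"
    by (rule AE_mp) (auto simp: hermitian_def conj_transpose_def vec_eq_iff intro!: AE_I2)
  obtain D :: "(complex^'q) set" where D': "countable D \<and> (\<forall>U. open U \<longrightarrow> U \<noteq> {} \<longrightarrow> (\<exists>d\<in>D. d \<in> U))"
    using countable_dense_exists by (rule exE)
  then have D: "countable D" "\<And>U. open U \<Longrightarrow> U \<noteq> {} \<Longrightarrow> \<exists>d\<in>D. d \<in> U"
    by simp_all
  have "AE x in \<tau>. 0 \<le> quad_form d (W x)" for d
  proof (rule density_nonneg)
    show "integrable \<tau> (\<lambda>x. quad_form d (W x))"
      using integral_linear_W(1)[OF bounded_linear_quad_form, of UNIV] by simp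
    fix B assume "B \<in> sets \<tau>"
    then have B: "B \<in> sets borel" using sets_eq by simp
    show "0 \<le> (LINT x:B|\<tau>. quad_form d (W x))"
      using psd_inner_nonneg[OF psd_M[OF B]] integral_linear_W(2)[OF bounded_linear_quad_form B]
      by (simp add: quad_form_def)
  qed
  then have "AE x in \<tau>. \<forall>d\<in>D. 0 \<le> quad_form d (W x)"
    by (simp add: AE_ball_countable[OF D(1)])
  with herm show ?thesis
    by eventually_elim (rule psdI_dense[OF D(2)], auto)
qed

text \<open>The trace of the density is nonnegative almost everywhere, so it vanishes where its integral does.\<close>

lemma trace_zero_AE:
  assumes B: "B \<in> sets borel" and z: "re_trace (M B) = 0"
  shows "AE x in \<tau>. x \<in> B \<longrightarrow> re_trace (W x) = 0"
proof -
  have "integrable \<tau> (\<lambda>x. indicator B x *\<^sub>R re_trace (W x))"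
    using B sets_eq integral_linear_W(1)[OF bounded_linear_re_trace B] by (intro integrable_mult_indicator) auto
  moreover have "AE x in \<tau>. 0 \<le> indicator B x *\<^sub>R re_trace (W x)"
    using AE_psd_W by eventually_elim (simp add: re_trace_nonneg)
  moreover have "(LINT x|\<tau>. indicator B x *\<^sub>R re_trace (W x)) = 0"
    using integral_linear_W(2)[OF bounded_linear_re_trace B] z by (simp add: set_lebesgue_integral_def)
  ultimately have "AE x in \<tau>. indicator B x *\<^sub>R re_trace (W x) = 0"
    using integral_nonneg_eq_0_iff_AE by blast
  then show ?thesis by eventually_elim (auto simp: indicator_def)
qed

lemma trace_measure:
  "vector_measure (\<lambda>B. re_trace (M B))" "B \<in> sets borel \<Longrightarrow> 0 \<le> re_trace (M B)"
  using vector_measure_bounded_linear[OF vector_measure_M bounded_linear_re_trace] re_trace_nonneg psd_M by auto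

lemma diag_measure:
  "vector_measure (\<lambda>B. M B $ i $ i)"
  "B \<in> sets borel \<Longrightarrow> M B $ i $ i = complex_of_real (Re (M B $ i $ i)) \<and> 0 \<le> Re (M B $ i $ i)"
proof -
  show "vector_measure (\<lambda>B. M B $ i $ i)"
    using regular by (auto simp: regular_mat_def regular_cm_def)
  assume B: "B \<in> sets borel"
  have "cnj (M B $ i $ i) = M B $ i $ i"
    using hermitian_M[OF B] by (simp add: hermitian_def conj_transpose_def vec_eq_iff)
  then show "M B $ i $ i = complex_of_real (Re (M B $ i $ i)) \<and> 0 \<le> Re (M B $ i $ i)"
    using psd_diag_nonneg[OF psd_M[OF B]] by (simp add: complex_eq_iff)
qed

text \<open>Regularity is given for the variations of the entries; for the diagonal ones, which are nonnegative,
  it is a statement about the values.\<close>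

lemma variation_diag: "B \<in> sets borel \<Longrightarrow> variation (\<lambda>B. M B $ i $ i) B = ennreal (Re (M B $ i $ i))"
  by (rule variation_nonneg_real[OF diag_measure])

lemma diag_Diff:
  "A \<in> sets borel \<Longrightarrow> B \<in> sets borel \<Longrightarrow> A \<subseteq> B \<Longrightarrow> Re (M (B - A) $ i $ i) = Re (M B $ i $ i) - Re (M A $ i $ i)"
  using vector_measure_Diff[OF diag_measure(1), of A B i] by simp

lemma diag_outer_regular:
  assumes B: "B \<in> sets borel" and e: "0 < e"
  shows "\<exists>U. open U \<and> B \<subseteq> U \<and> Re (M (U - B) $ i $ i) < e"
proof -
  let ?v = "variation (\<lambda>B. M B $ i $ i)"
  have "regular_nonneg ?v" using regular by (auto simp: regular_mat_def regular_cm_def)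
  then have "?v B = (INF U\<in>{U. open U \<and> B \<subseteq> U}. ?v U)" using B unfolding regular_nonneg_def by blast
  moreover have "?v B < ennreal (Re (M B $ i $ i) + e)"
    using diag_measure(2)[OF B] e by (simp add: variation_diag[OF B] ennreal_lessI)
  ultimately obtain U where U: "open U" "B \<subseteq> U" "?v U < ennreal (Re (M B $ i $ i) + e)"
    by (auto simp: INF_less_iff)
  then have "Re (M U $ i $ i) < Re (M B $ i $ i) + e"
    using diag_measure(2)[of U i] by (simp add: variation_diag ennreal_less_iff)
  then show ?thesis using U diag_Diff[OF B, of U i] by (intro exI[of _ U]) auto
qed

lemma diag_inner_regular:
  assumes B: "B \<in> sets borel" and e: "0 < e"
  shows "\<exists>K. compact K \<and> K \<subseteq> B \<and> Re (M (B - K) $ i $ i) < e"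
proof (cases "Re (M B $ i $ i) < e")
  case True
  then show ?thesis by (intro exI[of _ "{}"]) auto
next
  case False
  let ?v = "variation (\<lambda>B. M B $ i $ i)"
  have "regular_nonneg ?v" using regular by (auto simp: regular_mat_def regular_cm_def)
  then have "?v B = (SUP K\<in>{K. compact K \<and> K \<subseteq> B}. ?v K)" using B unfolding regular_nonneg_def by blast
  moreover have "ennreal (Re (M B $ i $ i) - e) < ?v B"
    using False e by (simp add: variation_diag[OF B] ennreal_less_iff)
  ultimately obtain K where K: "compact K" "K \<subseteq> B" "ennreal (Re (M B $ i $ i) - e) < ?v K"
    by (auto simp: less_SUP_iff)
  have Kb: "K \<in> sets borel" using K(1) by (simp add: borel_closed compact_imp_closed)
  then have "Re (M B $ i $ i) - e < Re (M K $ i $ i)"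
    using K False by (simp add: variation_diag ennreal_less_iff)
  then show ?thesis using K diag_Diff[OF Kb B, of i] by (intro exI[of _ K]) auto
qed

lemma trace_less:
  assumes "\<And>i. C i \<in> sets borel" "D \<in> sets borel" "\<And>i. D \<subseteq> C i" "\<And>i. Re (M (C i) $ i $ i) < e / CARD('q)"
  shows "re_trace (M D) < e"
proof -
  have "Re (M D $ i $ i) < e / CARD('q)" for i
    using diag_Diff[of D "C i" i] diag_measure(2)[of "C i - D" i] assms(1)[of i] assms(2) assms(3)[of i] assms(4)[of i] by auto
  then have "re_trace (M D) < (\<Sum>i\<in>(UNIV::'q set). e / CARD('q))"
    unfolding re_trace_def by (intro sum_strict_mono) auto
  then show ?thesis by simp
qed

lemma trace_outer_regular:
  assumes B: "B \<in> sets borel" and e: "0 < e"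
  shows "\<exists>U. open U \<and> B \<subseteq> U \<and> re_trace (M (U - B)) < e"
proof -
  have "0 < e / CARD('q)" using e by simp
  then obtain U where U: "\<And>i. open (U i)" "\<And>i. B \<subseteq> U i" "\<And>i. Re (M (U i - B) $ i $ i) < e / CARD('q)"
    using diag_outer_regular[OF B] by metis
  show ?thesis
    using U B by (intro exI[of _ "\<Inter>i. U i"] conjI open_INT ballI trace_less[of "\<lambda>i. U i - B"]) auto
qed

lemma trace_inner_regular:
  assumes B: "B \<in> sets borel" and e: "0 < e"
  shows "\<exists>K. compact K \<and> K \<subseteq> B \<and> re_trace (M (B - K)) < e"
proof -
  have "0 < e / CARD('q)" using e by simp
  then obtain K where K: "\<And>i. compact (K i)" "\<And>i. K i \<subseteq> B" "\<And>i. Re (M (B - K i) $ i $ i) < e / CARD('q)"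
    using diag_inner_regular[OF B] by metis
  have [measurable]: "K i \<in> sets borel" for i using K(1) by (simp add: borel_closed compact_imp_closed)
  show ?thesis
    using K B by (intro exI[of _ "\<Union>i. K i"] conjI compact_UN trace_less[of "\<lambda>i. B - K i"]) auto
qed

context
  fixes w :: "'a \<Rightarrow> complex"
  assumes w: "integrable \<tau> w" and w0: "AE x in \<tau>. re_trace (W x) = 0 \<longrightarrow> w x = 0"
begin

text \<open>Absolute continuity in \<open>\<epsilon>\<close>-form, for sequences of sets of small trace measure: the finite
  intersections of the sets decrease to a set of trace measure zero, on which \<open>w\<close> vanishes almost everywhere.\<close>

lemma small_variation:
  assumes C: "\<And>n. C n \<in> sets borel" "\<And>n. re_trace (M (C n)) < inverse (real (Suc n))" and e: "0 < e"
  shows "\<exists>n. \<forall>D\<in>sets borel. D \<subseteq> (\<Inter>k\<le>n. C k) \<longrightarrow> variation (\<lambda>B. LINT x:B|\<tau>. w x) D \<le> ennreal e"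
proof -
  note [measurable] = borel_measurable_integrable[OF w]
  define \<nu> where "\<nu> = density \<tau> (\<lambda>x. ennreal (norm (w x)))"
  have sets_\<nu>: "sets \<nu> = sets borel" by (simp add: \<nu>_def sets_eq)
  have fin: "emeasure \<nu> B \<noteq> \<infinity>" for B
  proof -
    have "emeasure \<nu> B \<le> emeasure \<nu> UNIV" by (rule emeasure_mono) (auto simp: sets_\<nu>)
    also have "\<dots> = (\<integral>\<^sup>+x. ennreal (norm (w x)) \<partial>\<tau>)"
      using space_eq by (simp add: \<nu>_def emeasure_density sets_eq)
    also have "\<dots> < \<infinity>" using w by (simp add: integrable_iff_bounded)
    finally show ?thesis by simp
  qed
  define D where "D n = (\<Inter>k\<le>n. C k)" for n
  have D: "D n \<in> sets borel" for n unfolding D_def using C(1) by auto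
  have "re_trace (M (\<Inter>n. D n)) = 0"
  proof -
    have I: "(\<Inter>n. D n) \<in> sets borel" using D by auto
    have "re_trace (M (\<Inter>n. D n)) \<le> inverse (real (Suc n))" for n
      using vector_measure_mono_real[OF trace_measure I C(1), of n] C(2)[of n] by (fastforce simp: D_def)
    then have "re_trace (M (\<Inter>n. D n)) \<le> 0"
      by (intro LIMSEQ_le_const[OF LIMSEQ_inverse_real_of_nat]) auto
    then show ?thesis using trace_measure(2)[OF I] by simp
  qed
  then have "AE x in \<tau>. x \<in> (\<Inter>n. D n) \<longrightarrow> re_trace (W x) = 0"
    using D by (intro trace_zero_AE) auto
  with w0 have "AE x in \<tau>. ennreal (norm (w x)) * indicator (\<Inter>n. D n) x = 0"
    by eventually_elim (auto simp: indicator_def)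
  then have "emeasure \<nu> (\<Inter>n. D n) = 0"
    using D sets_eq by (subst \<nu>_def, subst emeasure_density) (auto simp: nn_integral_0_iff_AE)
  moreover have "(\<lambda>n. emeasure \<nu> (D n)) \<longlonglongrightarrow> emeasure \<nu> (\<Inter>n. D n)"
    using D fin by (intro Lim_emeasure_decseq) (auto simp: sets_\<nu> decseq_def D_def)
  ultimately have "eventually (\<lambda>n. emeasure \<nu> (D n) < ennreal e) sequentially"
    using e by (intro order_tendstoD) auto
  then obtain n where n: "emeasure \<nu> (D n) < ennreal e" by (auto simp: eventually_sequentially)
  have "variation (\<lambda>B. LINT x:B|\<tau>. w x) E \<le> ennreal e" if E: "E \<in> sets borel" "E \<subseteq> D n" for E
  proof -
    have "variation (\<lambda>B. LINT x:B|\<tau>. w x) E \<le> emeasure \<nu> E"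
      unfolding \<nu>_def by (rule variation_integral_le[OF w sets_eq E(1)])
    also have "\<dots> \<le> emeasure \<nu> (D n)" using E D by (intro emeasure_mono) (auto simp: sets_\<nu>)
    finally show ?thesis using n by simp
  qed
  then show ?thesis by (auto simp: D_def)
qed

text \<open>A measure absolutely continuous with respect to the trace of \<open>M\<close> inherits regularity: open supersets
  and compact subsets that are good for the trace are good for the variation by
  \<open>small_variation\<close>, since finite intersections of open and finite unions of compact sets remain such.\<close>

lemma regular_integral: "regular_cm (\<lambda>B. LINT x:B|\<tau>. w x)"
proof -
  let ?\<mu> = "\<lambda>B. LINT x:B|\<tau>. w x"
  have vm: "vector_measure ?\<mu>" by (rule vector_measure_integral[OF w sets_eq])
  have outer: "variation ?\<mu> B = (INF U\<in>{U. open U \<and> B \<subseteq> U}. variation ?\<mu> U)" if B: "B \<in> sets borel" for B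
  proof (rule antisym)
    show "variation ?\<mu> B \<le> (INF U\<in>{U. open U \<and> B \<subseteq> U}. variation ?\<mu> U)"
      using B by (intro INF_greatest variation_mono) auto
    show "(INF U\<in>{U. open U \<and> B \<subseteq> U}. variation ?\<mu> U) \<le> variation ?\<mu> B"
    proof (rule ennreal_le_epsilon)
      fix e :: real assume e: "0 < e"
      have "\<exists>U. open U \<and> B \<subseteq> U \<and> re_trace (M (U - B)) < inverse (real (Suc n))" for n
        by (rule trace_outer_regular[OF B]) simp
      then obtain U where U: "\<And>n. open (U n)" "\<And>n. B \<subseteq> U n" "\<And>n. re_trace (M (U n - B)) < inverse (real (Suc n))"
        by metis
      have "U n - B \<in> sets borel" for n using borel_open[OF U(1)] B by (rule sets.Diff)
      from small_variation[of "\<lambda>n. U n - B", OF this U(3) e]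
      obtain n where n: "\<forall>D\<in>sets borel. D \<subseteq> (\<Inter>k\<le>n. U k - B) \<longrightarrow> variation ?\<mu> D \<le> ennreal e"
        by (rule exE)
      define V where "V = (\<Inter>k\<le>n. U k)"
      have V: "open V" "B \<subseteq> V"
        unfolding V_def by (simp_all add: open_INT U(1) INT_greatest U(2))
      have "variation ?\<mu> V \<le> variation ?\<mu> B + variation ?\<mu> (V - B)"
        by (rule variation_subadditive[OF vm B borel_open[OF V(1)] V(2)])
      also have "variation ?\<mu> (V - B) \<le> ennreal e"
        by (rule n[rule_format]) (use borel_open[OF V(1)] B in \<open>auto simp: V_def\<close>)
      finally show "(INF U\<in>{U. open U \<and> B \<subseteq> U}. variation ?\<mu> U) \<le> variation ?\<mu> B + ennreal e"
        using V by (intro INF_lower2[of V]) (simp_all add: add_left_mono)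
    qed
  qed
  have inner: "variation ?\<mu> B = (SUP K\<in>{K. compact K \<and> K \<subseteq> B}. variation ?\<mu> K)" if B: "B \<in> sets borel" for B
  proof (rule antisym)
    show "(SUP K\<in>{K. compact K \<and> K \<subseteq> B}. variation ?\<mu> K) \<le> variation ?\<mu> B"
      using B by (intro SUP_least variation_mono) (auto simp: borel_closed compact_imp_closed)
    show "variation ?\<mu> B \<le> (SUP K\<in>{K. compact K \<and> K \<subseteq> B}. variation ?\<mu> K)"
    proof (rule ennreal_le_epsilon)
      fix e :: real assume e: "0 < e"
      have "\<exists>K. compact K \<and> K \<subseteq> B \<and> re_trace (M (B - K)) < inverse (real (Suc n))" for n
        by (rule trace_inner_regular[OF B]) simp
      then obtain K where K: "\<And>n. compact (K n)" "\<And>n. K n \<subseteq> B" "\<And>n. re_trace (M (B - K n)) < inverse (real (Suc n))"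
        by metis
      have Kb: "K n \<in> sets borel" for n using K(1) by (simp add: borel_closed compact_imp_closed)
      have "B - K n \<in> sets borel" for n using B Kb by (rule sets.Diff)
      from small_variation[of "\<lambda>n. B - K n", OF this K(3) e]
      obtain n where n: "\<forall>D\<in>sets borel. D \<subseteq> (\<Inter>k\<le>n. B - K k) \<longrightarrow> variation ?\<mu> D \<le> ennreal e"
        by (rule exE)
      define V where "V = (\<Union>k\<le>n. K k)"
      have V: "compact V" "V \<subseteq> B"
        unfolding V_def by (simp_all add: compact_UN K(1) UN_least K(2))
      have Vb: "V \<in> sets borel" using V(1) by (simp add: borel_closed compact_imp_closed)
      have "variation ?\<mu> B \<le> variation ?\<mu> V + variation ?\<mu> (B - V)"
        by (rule variation_subadditive[OF vm Vb B V(2)])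
      also have "\<dots> \<le> (SUP K\<in>{K. compact K \<and> K \<subseteq> B}. variation ?\<mu> K) + ennreal e"
      proof (intro add_mono SUP_upper n[rule_format])
        show "B - V \<in> sets borel" using B Vb by (rule sets.Diff)
      qed (use V in \<open>auto simp: V_def\<close>)
      finally show "variation ?\<mu> B \<le> (SUP K\<in>{K. compact K \<and> K \<subseteq> B}. variation ?\<mu> K) + ennreal e" .
    qed
  qed
  show ?thesis using vm outer inner unfolding regular_cm_def regular_nonneg_def by blast
qed

end

end

section \<open>The space of functions integrable with respect to a matrix measure\<close>

lemma borel_measurable_matrix_vector_mult:
  fixes R :: "'a \<Rightarrow> complex^'q^'q"
  assumes "R \<in> borel_measurable N" "g \<in> borel_measurable N"
  shows "(\<lambda>x. R x *v g x) \<in> borel_measurable N"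
proof (rule borel_measurable_continuous_Pair[OF assms])
  show "continuous_on UNIV (\<lambda>x :: (complex^'q^'q) \<times> (complex^'q). fst x *v snd x)"
    unfolding matrix_vector_mult_def by (intro continuous_on_vec_lambda continuous_intros)
qed

context psd_matrix_measure
begin

text \<open>The matrix function \<open>(dM/d\<tau>)\<^bsup>1/\<alpha>\<^esup>\<close>. The density is only almost everywhere positive semidefinite; replacing it
  by \<open>0\<close> elsewhere makes the function measurable and Hermitian everywhere.\<close>

definition W_root :: "real \<Rightarrow> 'a \<Rightarrow> complex^'q^'q" where
  "W_root \<alpha> x = psd_powr (if psd (W x) then W x else 0) (1 / \<alpha>)"

lemma AE_W_root: "AE x in \<tau>. psd (W x) \<and> W_root \<alpha> x = psd_powr (W x) (1 / \<alpha>)"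
  using AE_psd_W by eventually_elim (simp add: W_root_def)

lemma W_root_measurable [measurable]: "0 < \<alpha> \<Longrightarrow> W_root \<alpha> \<in> borel_measurable \<tau>"
proof -
  assume a: "0 < \<alpha>"
  have [measurable]: "W \<in> borel_measurable \<tau>" using W_integrable by auto
  have [measurable]: "{A :: complex^'q^'q. psd A} \<in> sets borel" using closed_psd by (rule borel_closed)
  have "(\<lambda>x. if W x \<in> {A. psd A} then W x else 0) \<in> borel_measurable \<tau>" by measurable
  then show ?thesis unfolding W_root_def
    using a by (intro borel_measurable_psd_powr) (auto simp: psd_zero)
qed

lemma hermitian_W_root: "0 < \<alpha> \<Longrightarrow> hermitian (W_root \<alpha> x)"
  unfolding W_root_def by (intro hermitian_psd_powr) (auto simp: psd_zero)

lemma W_root_adjoint: "0 < \<alpha> \<Longrightarrow> (W_root \<alpha> x *v u) \<bullet> v = u \<bullet> (W_root \<alpha> x *v v)"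
  using hermitian_W_root[of \<alpha> x] inner_conj_transpose[of "W_root \<alpha> x" u v] by (simp add: hermitian_def)

lemma AE_norm_W_root_le:
  assumes "0 < \<alpha>"
  shows "AE x in \<tau>. 0 \<le> re_trace (W x) \<and> (\<forall>v. norm (W_root \<alpha> x *v v) \<le> re_trace (W x) powr (1 / \<alpha>) * norm v)"
  using AE_psd_W
proof eventually_elim
  fix x assume "psd (W x)"
  then show "0 \<le> re_trace (W x) \<and> (\<forall>v. norm (W_root \<alpha> x *v v) \<le> re_trace (W x) powr (1 / \<alpha>) * norm v)"
    using assms norm_psd_powr_le[of "1 / \<alpha>" "W x"] by (simp add: W_root_def re_trace_nonneg)
qed

lemma trace_integrable: "integrable \<tau> (\<lambda>x. re_trace (W x))"
  using integral_linear_W(1)[OF bounded_linear_re_trace, of UNIV] by simp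

lemma L_integral_W_root: "L_integral \<alpha> \<tau> M f = (\<integral>\<^sup>+x. ennreal (norm (W_root \<alpha> x *v f x) powr \<alpha>) \<partial>\<tau>)"
  unfolding L_integral_def
  by (rule nn_integral_cong_AE) (use AE_W_root[of \<alpha>] in eventually_elim, simp)

lemma W_root_Lp:
  assumes \<alpha>: "1 < \<alpha>" and f: "f \<in> borel_measurable borel"
  shows "(\<lambda>x. W_root \<alpha> x *v f x) \<in> borel_measurable \<tau>"
    "(\<lambda>x. W_root \<alpha> x *v f x) \<in> Lp_functions \<alpha> \<tau> \<longleftrightarrow> f \<in> L_functions \<alpha> \<tau> M"
proof -
  have "f \<in> borel_measurable \<tau>" using f by (simp add: measurable_cong_sets[OF sets_eq refl])
  then show m: "(\<lambda>x. W_root \<alpha> x *v f x) \<in> borel_measurable \<tau>"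
    using \<alpha> by (intro borel_measurable_matrix_vector_mult W_root_measurable) auto
  then show "(\<lambda>x. W_root \<alpha> x *v f x) \<in> Lp_functions \<alpha> \<tau> \<longleftrightarrow> f \<in> L_functions \<alpha> \<tau> M"
    using f by (simp add: Lp_functions_iff_nn_integral L_functions_def L_integral_W_root)
qed

lemma L_norm_W_root:
  assumes \<alpha>: "1 < \<alpha>" and f: "f \<in> L_functions \<alpha> \<tau> M"
  shows "L_norm \<alpha> \<tau> M f = Lp_norm \<alpha> \<tau> (\<lambda>x. W_root \<alpha> x *v f x)"
proof -
  have "f \<in> borel_measurable borel" using f by (simp add: L_functions_def)
  then have "(\<lambda>x. W_root \<alpha> x *v f x) \<in> Lp_functions \<alpha> \<tau>" using W_root_Lp(2)[OF \<alpha>] f by simp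
  then show ?thesis
    by (simp add: L_norm_def Lp_norm_def L_integral_W_root nn_integral_norm_powr_Lp)
qed

text \<open>The integrand is at most a constant times the trace of the density, which is integrable.\<close>

lemma bounded_in_L_functions:
  assumes \<alpha>: "1 < \<alpha>" and f: "f \<in> borel_measurable borel" and C: "\<And>x. norm (f x) \<le> C"
  shows "f \<in> L_functions \<alpha> \<tau> M"
proof -
  have pos: "0 < \<alpha>" using \<alpha> by simp
  have "AE x in \<tau>. norm (norm (W_root \<alpha> x *v f x) powr \<alpha>) \<le> norm (C powr \<alpha> * re_trace (W x))"
    using AE_norm_W_root_le[OF pos]
  proof eventually_elim
    fix x assume tr: "0 \<le> re_trace (W x) \<and> (\<forall>v. norm (W_root \<alpha> x *v v) \<le> re_trace (W x) powr (1 / \<alpha>) * norm v)"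
    have "norm (W_root \<alpha> x *v f x) \<le> re_trace (W x) powr (1 / \<alpha>) * norm (f x)" using tr by blast
    also have "\<dots> \<le> re_trace (W x) powr (1 / \<alpha>) * C" by (intro mult_left_mono C) auto
    finally have "norm (W_root \<alpha> x *v f x) powr \<alpha> \<le> (re_trace (W x) powr (1 / \<alpha>) * C) powr \<alpha>"
      using \<alpha> by (intro powr_mono2) auto
    also have "\<dots> = re_trace (W x) * C powr \<alpha>"
      using tr \<alpha> order_trans[OF norm_ge_zero C] by (simp add: powr_mult powr_powr)
    finally show "norm (norm (W_root \<alpha> x *v f x) powr \<alpha>) \<le> norm (C powr \<alpha> * re_trace (W x))"
      using tr by (simp add: mult.commute)
  qed
  note ae = this
  have int: "integrable \<tau> (\<lambda>x. C powr \<alpha> * re_trace (W x))" using trace_integrable by simp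
  have [measurable]: "(\<lambda>x. W_root \<alpha> x *v f x) \<in> borel_measurable \<tau>" by (rule W_root_Lp(1)[OF \<alpha> f])
  have me: "(\<lambda>x. norm (W_root \<alpha> x *v f x) powr \<alpha>) \<in> borel_measurable \<tau>" by measurable
  have "integrable \<tau> (\<lambda>x. norm (W_root \<alpha> x *v f x) powr \<alpha>)"
    by (rule Bochner_Integration.integrable_bound[OF int me ae])
  then show ?thesis using W_root_Lp[OF \<alpha> f] by (auto simp: Lp_functions_def)
qed

lemma M_equiv_iff_W_root:
  assumes \<alpha>: "1 < \<alpha>"
  shows "(f, g) \<in> M_equiv \<tau> M \<longleftrightarrow> f \<in> borel_measurable borel \<and> g \<in> borel_measurable borel \<and>
    (AE x in \<tau>. W_root \<alpha> x *v f x = W_root \<alpha> x *v g x)"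
proof -
  have "(AE x in \<tau>. range_projection (W x) *v f x = range_projection (W x) *v g x) \<longleftrightarrow>
      (AE x in \<tau>. W_root \<alpha> x *v f x = W_root \<alpha> x *v g x)"
  proof (rule eventually_subst)
    show "AE x in \<tau>. (range_projection (W x) *v f x = range_projection (W x) *v g x) \<longleftrightarrow>
      (W_root \<alpha> x *v f x = W_root \<alpha> x *v g x)"
      using AE_W_root[of \<alpha>] by eventually_elim (use \<alpha> in \<open>simp add: range_projection_eq_iff_psd_powr_eq[of "1 / \<alpha>"]\<close>)
  qed
  then show ?thesis by (simp add: M_equiv_def)
qed

lemma equiv_M_equiv:
  fixes \<alpha> :: real
  assumes \<alpha>: "1 < \<alpha>"
  shows "equiv (borel_measurable borel) (M_equiv \<tau> M)"
proof (rule equivI)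
  show "M_equiv \<tau> M \<subseteq> borel_measurable borel \<times> borel_measurable borel" by (auto simp: M_equiv_def)
  show "refl_on (borel_measurable borel) (M_equiv \<tau> M)" by (auto simp: refl_on_def M_equiv_def)
  show "sym (M_equiv \<tau> M)" by (auto simp: sym_def M_equiv_def elim: eventually_mono)
  show "trans (M_equiv \<tau> M)"
  proof (rule transI)
    fix f g h assume "(f, g) \<in> M_equiv \<tau> M" "(g, h) \<in> M_equiv \<tau> M"
    then have fh: "f \<in> borel_measurable borel" "h \<in> borel_measurable borel"
      and ae: "AE x in \<tau>. W_root \<alpha> x *v f x = W_root \<alpha> x *v g x" "AE x in \<tau>. W_root \<alpha> x *v g x = W_root \<alpha> x *v h x"
      by (simp_all add: M_equiv_iff_W_root[OF \<alpha>])
    from ae have "AE x in \<tau>. W_root \<alpha> x *v f x = W_root \<alpha> x *v h x" by eventually_elim simp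
    then show "(f, h) \<in> M_equiv \<tau> M" using fh by (simp add: M_equiv_iff_W_root[OF \<alpha>])
  qed
qed

lemma M_equiv_L_functions:
  assumes \<alpha>: "1 < \<alpha>" and f: "f \<in> L_functions \<alpha> \<tau> M" and fg: "(f, g) \<in> M_equiv \<tau> M"
  shows "g \<in> L_functions \<alpha> \<tau> M"
proof -
  have "g \<in> borel_measurable borel" and ae: "AE x in \<tau>. W_root \<alpha> x *v f x = W_root \<alpha> x *v g x"
    using fg by (simp_all add: M_equiv_iff_W_root[OF \<alpha>])
  moreover have "L_integral \<alpha> \<tau> M g = L_integral \<alpha> \<tau> M f"
    unfolding L_integral_W_root by (rule nn_integral_cong_AE) (use ae in eventually_elim, simp)
  ultimately show ?thesis using f by (simp add: L_functions_def)
qed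

lemma L_functions_diff:
  assumes \<alpha>: "1 < \<alpha>" and f: "f \<in> L_functions \<alpha> \<tau> M" and g: "g \<in> L_functions \<alpha> \<tau> M"
  shows "(\<lambda>x. f x - g x) \<in> L_functions \<alpha> \<tau> M"
proof -
  have m: "f \<in> borel_measurable borel" "g \<in> borel_measurable borel" using f g by (auto simp: L_functions_def)
  then have "(\<lambda>x. W_root \<alpha> x *v f x - W_root \<alpha> x *v g x) \<in> Lp_functions \<alpha> \<tau>"
    using f g W_root_Lp(2)[OF \<alpha>] by (intro Lp_diff \<alpha>) auto
  moreover have "(\<lambda>x. f x - g x) \<in> borel_measurable borel" using m by measurable
  ultimately show ?thesis using W_root_Lp(2)[OF \<alpha>, of "\<lambda>x. f x - g x"] by (simp add: matrix_vector_mult_diff_distrib)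
qed

lemma L_space_representative:
  assumes \<alpha>: "1 < \<alpha>" and X: "X \<in> L_space \<alpha> \<tau> M"
  shows "(SOME f. f \<in> X) \<in> L_functions \<alpha> \<tau> M" "X = M_equiv \<tau> M `` {SOME f. f \<in> X}"
proof -
  obtain f where f: "f \<in> L_functions \<alpha> \<tau> M" "X = M_equiv \<tau> M `` {f}"
    using X by (auto simp: L_space_def elim: quotientE)
  have "f \<in> borel_measurable borel" using f by (simp add: L_functions_def)
  then have "f \<in> X" using equiv_class_self[OF equiv_M_equiv[OF \<alpha>]] f(2) by simp
  then have "(SOME f. f \<in> X) \<in> X" by (rule someI[of "\<lambda>f. f \<in> X"])
  then have e: "(f, SOME f. f \<in> X) \<in> M_equiv \<tau> M" by (subst (asm) (2) f(2)) simp
  show "(SOME f. f \<in> X) \<in> L_functions \<alpha> \<tau> M"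
    by (rule M_equiv_L_functions[OF \<alpha> f(1) e])
  show "X = M_equiv \<tau> M `` {SOME f. f \<in> X}"
    by (rule trans[OF f(2) equiv_class_eq[OF equiv_M_equiv[OF \<alpha>] e]])
qed

lemma L_dist_Lp_norm:
  assumes \<alpha>: "1 < \<alpha>" and X: "X \<in> L_space \<alpha> \<tau> M" and Y: "Y \<in> L_space \<alpha> \<tau> M"
  shows "L_dist \<alpha> \<tau> M X Y = Lp_norm \<alpha> \<tau> (\<lambda>x. W_root \<alpha> x *v (SOME f. f \<in> X) x - W_root \<alpha> x *v (SOME f. f \<in> Y) x)"
  unfolding L_dist_def
  using L_norm_W_root[OF \<alpha> L_functions_diff[OF \<alpha> L_space_representative(1)[OF \<alpha> X] L_space_representative(1)[OF \<alpha> Y]]]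
  by (simp only: matrix_vector_mult_diff_distrib)

text \<open>The distance is defined through arbitrarily chosen representatives. It can be computed from any,
  since equivalent functions have the same image under \<open>W_root\<close> almost everywhere.\<close>

lemma L_dist_class:
  assumes \<alpha>: "1 < \<alpha>" and f: "f \<in> L_functions \<alpha> \<tau> M" and g: "g \<in> L_functions \<alpha> \<tau> M"
  shows "L_dist \<alpha> \<tau> M (M_equiv \<tau> M `` {f}) (M_equiv \<tau> M `` {g}) = Lp_norm \<alpha> \<tau> (\<lambda>x. W_root \<alpha> x *v f x - W_root \<alpha> x *v g x)"
proof -
  let ?r = "\<lambda>X. SOME f. f \<in> X"
  have in_space: "M_equiv \<tau> M `` {f} \<in> L_space \<alpha> \<tau> M" if "f \<in> L_functions \<alpha> \<tau> M" for f
    using that unfolding L_space_def by (rule quotientI)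
  have rep: "AE x in \<tau>. W_root \<alpha> x *v f x = W_root \<alpha> x *v ?r (M_equiv \<tau> M `` {f}) x" if f: "f \<in> L_functions \<alpha> \<tau> M" for f
  proof -
    have "(f, ?r (M_equiv \<tau> M `` {f})) \<in> M_equiv \<tau> M"
      by (rule eq_equiv_class[OF L_space_representative(2)[OF \<alpha> in_space[OF f]] equiv_M_equiv[OF \<alpha>]])
        (use L_space_representative(1)[OF \<alpha> in_space[OF f]] in \<open>simp add: L_functions_def\<close>)
    from iffD1[OF M_equiv_iff_W_root[OF \<alpha>] this] show ?thesis by (elim conjE)
  qed
  have lp: "(\<lambda>x. W_root \<alpha> x *v f x) \<in> Lp_functions \<alpha> \<tau>" if "f \<in> L_functions \<alpha> \<tau> M" for f
    using W_root_Lp(2)[OF \<alpha>, of f] that by (simp add: L_functions_def)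
  note rf = L_space_representative(1)[OF \<alpha> in_space[OF f]] and rg = L_space_representative(1)[OF \<alpha> in_space[OF g]]
  have "(LINT x|\<tau>. norm (W_root \<alpha> x *v ?r (M_equiv \<tau> M `` {f}) x - W_root \<alpha> x *v ?r (M_equiv \<tau> M `` {g}) x) powr \<alpha>)
      = (LINT x|\<tau>. norm (W_root \<alpha> x *v f x - W_root \<alpha> x *v g x) powr \<alpha>)"
  proof (rule integral_cong_AE)
    show "AE x in \<tau>. norm (W_root \<alpha> x *v ?r (M_equiv \<tau> M `` {f}) x - W_root \<alpha> x *v ?r (M_equiv \<tau> M `` {g}) x) powr \<alpha>
        = norm (W_root \<alpha> x *v f x - W_root \<alpha> x *v g x) powr \<alpha>"
      using rep[OF f] rep[OF g] by eventually_elim simp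
  qed (use Lp_functionsD(2)[OF Lp_diff[OF \<alpha> lp[OF rf] lp[OF rg]]] Lp_functionsD(2)[OF Lp_diff[OF \<alpha> lp[OF f] lp[OF g]]]
       in \<open>simp_all add: borel_measurable_integrable\<close>)
  then show ?thesis by (simp add: L_dist_Lp_norm[OF \<alpha> in_space[OF f] in_space[OF g]] Lp_norm_def)
qed

lemma Metric_space_L:
  assumes \<alpha>: "1 < \<alpha>"
  shows "Metric_space (L_space \<alpha> \<tau> M) (L_dist \<alpha> \<tau> M)"
proof
  let ?r = "\<lambda>X. SOME f. f \<in> X"
  have lp: "(\<lambda>x. W_root \<alpha> x *v ?r X x) \<in> Lp_functions \<alpha> \<tau>" if "X \<in> L_space \<alpha> \<tau> M" for X
    using W_root_Lp(2)[OF \<alpha>] L_space_representative(1)[OF \<alpha> that] by (simp add: L_functions_def)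
  fix X Y
  show "0 \<le> L_dist \<alpha> \<tau> M X Y" by (simp add: L_dist_def L_norm_def)
  show "L_dist \<alpha> \<tau> M X Y = L_dist \<alpha> \<tau> M Y X"
    by (simp add: L_dist_def L_norm_def L_integral_def matrix_vector_mult_diff_distrib norm_minus_commute)
  assume X: "X \<in> L_space \<alpha> \<tau> M" and Y: "Y \<in> L_space \<alpha> \<tau> M"
  show "L_dist \<alpha> \<tau> M X Y = 0 \<longleftrightarrow> X = Y"
  proof -
    have "L_dist \<alpha> \<tau> M X Y = 0 \<longleftrightarrow> (LINT x|\<tau>. norm (W_root \<alpha> x *v ?r X x - W_root \<alpha> x *v ?r Y x) powr \<alpha>) = 0"
      by (simp add: L_dist_Lp_norm[OF \<alpha> X Y] Lp_norm_def)
    also have "\<dots> \<longleftrightarrow> (AE x in \<tau>. norm (W_root \<alpha> x *v ?r X x - W_root \<alpha> x *v ?r Y x) powr \<alpha> = 0)"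
      by (rule integral_nonneg_eq_0_iff_AE[OF Lp_functionsD(2)[OF Lp_diff[OF \<alpha> lp[OF X] lp[OF Y]]]]) simp
    also have "\<dots> \<longleftrightarrow> (AE x in \<tau>. W_root \<alpha> x *v ?r X x = W_root \<alpha> x *v ?r Y x)" by simp
    also have "\<dots> \<longleftrightarrow> (?r X, ?r Y) \<in> M_equiv \<tau> M"
      using L_space_representative(1)[OF \<alpha> X] L_space_representative(1)[OF \<alpha> Y]
      by (simp add: M_equiv_iff_W_root[OF \<alpha>] L_functions_def)
    also have "\<dots> \<longleftrightarrow> X = Y"
    proof
      assume "(?r X, ?r Y) \<in> M_equiv \<tau> M"
      then have "M_equiv \<tau> M `` {?r X} = M_equiv \<tau> M `` {?r Y}"
        by (rule equiv_class_eq[OF equiv_M_equiv[OF \<alpha>]])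
      from trans[OF L_space_representative(2)[OF \<alpha> X] trans[OF this L_space_representative(2)[OF \<alpha> Y, symmetric]]]
      show "X = Y" .
    next
      assume "X = Y"
      then show "(?r X, ?r Y) \<in> M_equiv \<tau> M"
        using L_space_representative(1)[OF \<alpha> Y] by (simp add: M_equiv_iff_W_root[OF \<alpha>] L_functions_def)
    qed
    finally show ?thesis .
  qed
  fix Z assume Z: "Z \<in> L_space \<alpha> \<tau> M"
  show "L_dist \<alpha> \<tau> M X Z \<le> L_dist \<alpha> \<tau> M X Y + L_dist \<alpha> \<tau> M Y Z"
    unfolding L_dist_Lp_norm[OF \<alpha> X Y] L_dist_Lp_norm[OF \<alpha> Y Z] L_dist_Lp_norm[OF \<alpha> X Z]
    by (rule Lp_norm_triangle3[OF \<alpha> lp[OF X] lp[OF Y] lp[OF Z]])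
qed

lemma class_in_closure:
  assumes \<alpha>: "1 < \<alpha>" and f: "f \<in> L_functions \<alpha> \<tau> M" and T: "T \<subseteq> L_functions \<alpha> \<tau> M"
    and approx: "\<And>e. 0 < e \<Longrightarrow> \<exists>t\<in>T. Lp_norm \<alpha> \<tau> (\<lambda>x. W_root \<alpha> x *v f x - W_root \<alpha> x *v t x) < e"
  shows "M_equiv \<tau> M `` {f} \<in> L_topology \<alpha> \<tau> M closure_of ((\<lambda>t. M_equiv \<tau> M `` {t}) ` T)"
proof -
  interpret Metric_space "L_space \<alpha> \<tau> M" "L_dist \<alpha> \<tau> M" by (rule Metric_space_L[OF \<alpha>])
  have in_space: "M_equiv \<tau> M `` {f} \<in> L_space \<alpha> \<tau> M" if "f \<in> L_functions \<alpha> \<tau> M" for f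
    using that unfolding L_space_def by (rule quotientI)
  have "\<exists>Y\<in>(\<lambda>t. M_equiv \<tau> M `` {t}) ` T. Y \<in> mball (M_equiv \<tau> M `` {f}) e" if "0 < e" for e
  proof -
    obtain t where t: "t \<in> T" "Lp_norm \<alpha> \<tau> (\<lambda>x. W_root \<alpha> x *v f x - W_root \<alpha> x *v t x) < e"
      using approx \<open>0 < e\<close> by blast
    then have "M_equiv \<tau> M `` {t} \<in> mball (M_equiv \<tau> M `` {f}) e"
      using T f L_dist_class[OF \<alpha> f, of t] by (auto simp: in_mball intro!: in_space)
    then show ?thesis using t(1) by blast
  qed
  then show ?thesis
    unfolding L_topology_def metric_closure_of using in_space[OF f] by (intro CollectI conjI allI impI)
qed

text \<open>With \<open>R = W_root \<alpha>\<close>, integrability is Young's inequality applied to \<open>\<bar>R g\<bar> \<le> (trace W)\<^bsup>1/\<alpha>\<^esup> \<bar>g\<bar>\<close>. By the second fact the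
  measure with this density is absolutely continuous with respect to the trace of \<open>M\<close>.\<close>

lemma dual_density:
  assumes \<alpha>: "1 < \<alpha>" and g: "g \<in> Lp_functions (\<alpha> / (\<alpha> - 1)) \<tau>"
  shows "integrable \<tau> (\<lambda>x. cnj ((W_root \<alpha> x *v g x) $ i))"
    and "AE x in \<tau>. re_trace (W x) = 0 \<longrightarrow> W_root \<alpha> x = 0"
proof -
  have pos: "0 < \<alpha>" using \<alpha> by simp
  define \<beta> where "\<beta> = \<alpha> / (\<alpha> - 1)"
  have \<beta>: "1 < \<beta>" "1 / \<alpha> + 1 / \<beta> = 1" using \<alpha> by (auto simp: \<beta>_def field_simps)
  have m: "(\<lambda>x. W_root \<alpha> x *v g x) \<in> borel_measurable \<tau>"
    by (intro borel_measurable_matrix_vector_mult W_root_measurable pos Lp_functionsD(1)[OF g])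
  have "AE x in \<tau>. norm (cnj ((W_root \<alpha> x *v g x) $ i)) \<le> norm (re_trace (W x) / \<alpha> + norm (g x) powr \<beta> / \<beta>)"
    using AE_norm_W_root_le[OF pos]
  proof eventually_elim
    fix x assume tr: "0 \<le> re_trace (W x) \<and> (\<forall>v. norm (W_root \<alpha> x *v v) \<le> re_trace (W x) powr (1 / \<alpha>) * norm v)"
    have "norm (cnj ((W_root \<alpha> x *v g x) $ i)) \<le> norm (W_root \<alpha> x *v g x)" using Finite_Cartesian_Product.norm_nth_le[of "W_root \<alpha> x *v g x" i] by simp
    also have "\<dots> \<le> re_trace (W x) powr (1 / \<alpha>) * norm (g x)" using tr by blast
    also have "\<dots> \<le> (re_trace (W x) powr (1 / \<alpha>)) powr \<alpha> / \<alpha> + norm (g x) powr \<beta> / \<beta>"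
      by (rule Youngs_inequality[OF \<alpha> \<beta>]) auto
    also have "(re_trace (W x) powr (1 / \<alpha>)) powr \<alpha> = re_trace (W x)" using tr pos by (simp add: powr_powr)
    finally show "norm (cnj ((W_root \<alpha> x *v g x) $ i)) \<le> norm (re_trace (W x) / \<alpha> + norm (g x) powr \<beta> / \<beta>)" by simp
  qed
  note ae = this
  have int: "integrable \<tau> (\<lambda>x. re_trace (W x) / \<alpha> + norm (g x) powr \<beta> / \<beta>)"
    using trace_integrable Lp_functionsD(2)[OF g] by (simp add: \<beta>_def)
  have me: "(\<lambda>x. cnj ((W_root \<alpha> x *v g x) $ i)) \<in> borel_measurable \<tau>"
    using m by (intro borel_measurable_continuous_on[OF _ m, of "\<lambda>v. cnj (v $ i)"] continuous_intros)
  show "integrable \<tau> (\<lambda>x. cnj ((W_root \<alpha> x *v g x) $ i))"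
    by (rule Bochner_Integration.integrable_bound[OF int me ae])
  show "AE x in \<tau>. re_trace (W x) = 0 \<longrightarrow> W_root \<alpha> x = 0"
    using AE_norm_W_root_le[OF pos]
  proof eventually_elim
    fix x assume tr: "0 \<le> re_trace (W x) \<and> (\<forall>v. norm (W_root \<alpha> x *v v) \<le> re_trace (W x) powr (1 / \<alpha>) * norm v)"
    show "re_trace (W x) = 0 \<longrightarrow> W_root \<alpha> x = 0"
    proof
      assume z: "re_trace (W x) = 0"
      have "W_root \<alpha> x *v v = 0 *v v" for v
      proof -
        have "norm (W_root \<alpha> x *v v) \<le> 0 powr (1 / \<alpha>) * norm v" using tr unfolding z by blast
        then have "norm (W_root \<alpha> x *v v) \<le> 0" by (simp only: powr_0 mult_zero_left)
        then show ?thesis by (simp only: norm_le_zero_iff matrix_vector_mult_0)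
      qed
      then show "W_root \<alpha> x = 0" by (intro iffD2[OF matrix_eq] allI)
    qed
  qed
qed

end

section \<open>Trigonometric polynomials\<close>

lemma continuous_on_pairing_left: "continuous_on UNIV (\<lambda>\<gamma>. pairing \<gamma> x)"
proof -
  have "((\<lambda>\<delta>. pairing \<delta> x) \<longlongrightarrow> pairing \<gamma> x) (nhds \<gamma>)" for \<gamma> :: "'a character"
  proof (rule tendstoI)
    fix e :: real assume "0 < e"
    then have "\<forall>\<^sub>F \<delta> in nhds \<gamma>. \<delta> \<in> {\<delta>. \<forall>y\<in>{x}. norm (pairing \<delta> y - pairing \<gamma> y) < e}"
      by (intro eventually_character_nbhd) auto
    then show "\<forall>\<^sub>F \<delta> in nhds \<gamma>. dist (pairing \<delta> x) (pairing \<gamma> x) < e"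
      by eventually_elim (simp add: dist_norm)
  qed
  then show ?thesis
    unfolding continuous_on_def at_within_def by (blast intro: tendsto_mono[OF inf_le1])
qed

lemma trig_polynomial_measurable:
  assumes "t \<in> trig_polynomials E"
  shows "t \<in> borel_measurable borel"
proof -
  obtain n x u where t: "t = (\<lambda>\<gamma>. \<Sum>j<(n::nat). pairing \<gamma> (x j) *s u j)"
    using assms by (auto simp: trig_polynomials_def)
  have "continuous_on UNIV t"
    unfolding t vector_scalar_mult_def
    by (intro continuous_on_sum continuous_on_vec_lambda continuous_on_mult continuous_on_pairing_left continuous_on_const)
  then show ?thesis by (rule borel_measurable_continuous_onI)
qed

lemma norm_vector_scalar_mult: "norm (c *s (v::complex^'q)) = norm c * norm v"
  by (simp add: norm_vec_def norm_mult L2_set_right_distrib)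

lemma trig_polynomial_bounded:
  assumes "t \<in> trig_polynomials E"
  obtains C where "\<And>\<gamma>. norm (t \<gamma>) \<le> C"
proof -
  obtain n x u where t: "t = (\<lambda>\<gamma>. \<Sum>j<(n::nat). pairing \<gamma> (x j) *s u j)"
    using assms by (auto simp: trig_polynomials_def)
  have "norm (t \<gamma>) \<le> (\<Sum>j<n. norm (u j))" for \<gamma>
    unfolding t by (rule order_trans[OF norm_sum]) (simp add: norm_vector_scalar_mult)
  then show thesis by (rule that)
qed

lemma trig_polynomial_zero: "(\<lambda>\<gamma>. 0) \<in> trig_polynomials E"
  unfolding trig_polynomials_def by (rule CollectI, rule exI[of _ 0]) auto

lemma trig_polynomial_monomial: "x \<in> E \<Longrightarrow> (\<lambda>\<gamma>. pairing \<gamma> x *s u) \<in> trig_polynomials E"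
  unfolding trig_polynomials_def
  by (rule CollectI, rule exI[of _ 1], rule exI[of _ "\<lambda>_. x"], rule exI[of _ "\<lambda>_. u"]) auto

lemma sum_lessThan_add: "(\<Sum>j<(n::nat) + m. f j) = (\<Sum>j<n. f j) + (\<Sum>j<m. (f (n + j) :: 'b::comm_monoid_add))"
  by (induction m) (auto simp: add.assoc)

lemma trig_polynomial_add:
  assumes "s \<in> trig_polynomials E" "t \<in> trig_polynomials E"
  shows "(\<lambda>\<gamma>. s \<gamma> + c *\<^sub>R t \<gamma>) \<in> trig_polynomials E"
proof -
  obtain n x u where s: "s = (\<lambda>\<gamma>. \<Sum>j<(n::nat). pairing \<gamma> (x j) *s u j)" "\<And>j. j < n \<Longrightarrow> x j \<in> E"
    using assms by (auto simp: trig_polynomials_def)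
  obtain m y v where t: "t = (\<lambda>\<gamma>. \<Sum>j<(m::nat). pairing \<gamma> (y j) *s v j)" "\<And>j. j < m \<Longrightarrow> y j \<in> E"
    using assms by (auto simp: trig_polynomials_def)
  define z where "z j = (if j < n then x j else y (j - n))" for j
  define w where "w j = (if j < n then u j else c *\<^sub>R v (j - n))" for j
  have "c *\<^sub>R (a *s b) = a *s (c *\<^sub>R b)" for a and b :: "complex^'b"
    by (simp add: vec_eq_iff)
  then have "(\<lambda>\<gamma>. s \<gamma> + c *\<^sub>R t \<gamma>) = (\<lambda>\<gamma>. \<Sum>j<n + m. pairing \<gamma> (z j) *s w j)"
    by (simp add: s t sum_lessThan_add z_def w_def scaleR_sum_right)
  moreover have "\<forall>j<n + m. z j \<in> E" using s(2) t(2) by (auto simp: z_def)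
  ultimately show ?thesis unfolding trig_polynomials_def by blast
qed

section \<open>Annihilators of trigonometric polynomials\<close>

text \<open>A set \<open>A\<close> separating the two parts of \<open>M\<close> may have positive Haar measure, but then it differs from a
  null set only by a set on which \<open>M\<close> vanishes: let \<open>N\<close> be a null set carrying \<open>Ms\<close>; on \<open>A - N\<close> the
  measure \<open>M\<close> agrees with \<open>Ma\<close>, and \<open>Ma\<close> vanishes on \<open>A\<close> and on null sets.\<close>

lemma singular_part_carrier:
  assumes dec: "lebesgue_decomposition \<Lambda> M Ma Ms" and \<Lambda>: "sets \<Lambda> = sets borel"
    and A: "A \<in> sets borel" "Ma A = 0"
  obtains N where "N \<in> sets borel" "emeasure \<Lambda> N = 0" "M (A - N) = 0"
proof -
  have vm: "vector_measure Ma" "vector_measure Ms" and sum: "\<And>B. B \<in> sets borel \<Longrightarrow> M B = Ma B + Ms B"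
    and ac: "abs_cont_mat \<Lambda> Ma" and sing: "singular_mat \<Lambda> Ms"
    using dec by (auto simp: lebesgue_decomposition_def)
  have "\<exists>N\<in>sets borel. emeasure \<Lambda> N = 0 \<and> variation (\<lambda>B. Ms B $ i $ j) (- N) = 0" for i j
    using sing by (simp add: singular_mat_def singular_cm_def)
  then obtain H where H: "\<And>i j. H i j \<in> sets borel" "\<And>i j. emeasure \<Lambda> (H i j) = 0"
    "\<And>i j. variation (\<lambda>B. Ms B $ i $ j) (- H i j) = 0"
    by metis
  define N where "N = (\<Union>i. \<Union>j. H i j)"
  have "H i j \<in> null_sets \<Lambda>" for i j using H(1,2) \<Lambda> by (simp add: null_sets_def)
  then have N_null: "N \<in> null_sets \<Lambda>" unfolding N_def by (intro null_sets_UN)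
  then have N: "N \<in> sets borel" "emeasure \<Lambda> N = 0" using \<Lambda> by (auto simp: null_sets_def)
  have AN: "A - N \<in> sets borel" "A \<inter> N \<in> sets borel" using A N by auto
  have entry: "\<mu> B $ i $ j = 0" if "vector_measure \<mu>" "B \<in> sets borel" "C \<in> sets borel" "B \<subseteq> C"
    "variation (\<lambda>B. \<mu> B $ i $ j) C = 0" for \<mu> :: "'a set \<Rightarrow> complex^'b^'b" and B C i j
  proof -
    have "ennreal (norm (\<mu> B $ i $ j)) \<le> variation (\<lambda>B. \<mu> B $ i $ j) B"
      using that(2) by (intro norm_le_variation) (simp_all add: vector_measure_empty[OF that(1)])
    also have "\<dots> \<le> variation (\<lambda>B. \<mu> B $ i $ j) C" using that by (intro variation_mono)
    finally show ?thesis using that(5) by simp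
  qed
  have "Ms (A - N) $ i $ j = 0" for i j
    by (rule entry[OF vm(2) AN(1) _ _ H(3)]) (use H(1) in \<open>auto simp: N_def\<close>)
  moreover have "Ma (A \<inter> N) $ i $ j = 0" for i j
  proof (rule entry[OF vm(1) AN(2) N(1)])
    show "variation (\<lambda>B. Ma B $ i $ j) N = 0"
      using ac N by (auto simp: abs_cont_mat_def abs_cont_cm_def)
  qed auto
  ultimately have "Ms (A - N) = 0" "Ma (A \<inter> N) = 0" by (simp_all add: vec_eq_iff)
  moreover have "Ma A = Ma (A \<inter> N) + Ma (A - A \<inter> N)"
    by (rule vector_measure_Diff[OF vm(1) AN(2) A(1)]) auto
  moreover have "A - A \<inter> N = A - N" by auto
  ultimately have "M (A - N) = 0" using sum[OF AN(1)] A(2) by simp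
  then show thesis using that N by blast
qed

lemma inverse_fourier_stieltjes_density:
  fixes \<tau> :: "'g::topological_ab_group_add character measure" and w :: "'q::finite \<Rightarrow> 'g character \<Rightarrow> complex"
  assumes \<tau>: "sets \<tau> = sets borel" and w: "\<And>i. integrable \<tau> (w i)"
  shows "inverse_fourier_stieltjes (\<lambda>B. \<chi> i. LINT \<gamma>:B|\<tau>. w i \<gamma>) x = (\<chi> i. LINT \<gamma>|\<tau>. w i \<gamma> * pairing \<gamma> x)"
proof -
  have "(\<lambda>\<gamma>. pairing \<gamma> x) \<in> borel_measurable borel"
    by (rule borel_measurable_continuous_onI[OF continuous_on_pairing_left])
  then have "integral_cm (\<lambda>B. LINT \<gamma>:B|\<tau>. w i \<gamma>) (\<lambda>\<gamma>. pairing \<gamma> x) = (LINT \<gamma>|\<tau>. w i \<gamma> * pairing \<gamma> x)" for i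
    by (rule integral_cm_density[OF w \<tau>, of _ 1]) simp
  then show ?thesis by (simp add: inverse_fourier_stieltjes_def)
qed

locale psd_character_measure = psd_matrix_measure \<tau> M
  for \<tau> :: "'g::topological_ab_group_add character measure" and M :: "'g character set \<Rightarrow> complex^'q^'q"
begin

lemma trig_in_L_functions:
  assumes "1 < \<alpha>" "t \<in> trig_polynomials E"
  shows "t \<in> L_functions \<alpha> \<tau> M"
proof -
  obtain C where "\<And>\<gamma>. norm (t \<gamma>) \<le> C" using trig_polynomial_bounded[OF assms(2)] by blast
  then show ?thesis by (rule bounded_in_L_functions[OF assms(1) trig_polynomial_measurable[OF assms(2)]])
qed

text \<open>Choosing \<open>t = \<chi>\<^sub>x e\<^sub>i\<close> and \<open>t = \<i> \<chi>\<^sub>x e\<^sub>i\<close> gives the real and the imaginary part, although \<open>\<bullet>\<close> is only the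
  real part of the Hermitian inner product.\<close>

lemma fourier_coefficient_zero:
  assumes \<alpha>: "1 < \<alpha>" and g: "g \<in> Lp_functions (\<alpha> / (\<alpha> - 1)) \<tau>"
    and ann: "\<And>t. t \<in> trig_polynomials E \<Longrightarrow> (LINT \<gamma>|\<tau>. g \<gamma> \<bullet> (W_root \<alpha> \<gamma> *v t \<gamma>)) = 0" and x: "x \<in> E"
  shows "(LINT \<gamma>|\<tau>. cnj ((W_root \<alpha> \<gamma> *v g \<gamma>) $ i) * pairing \<gamma> x) = 0"
proof -
  have pos: "0 < \<alpha>" using \<alpha> by simp
  let ?F = "\<lambda>\<gamma>. cnj ((W_root \<alpha> \<gamma> *v g \<gamma>) $ i) * pairing \<gamma> x"
  have "(\<lambda>\<gamma>. pairing \<gamma> x) \<in> borel_measurable borel"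
    by (rule borel_measurable_continuous_onI[OF continuous_on_pairing_left])
  then have "(\<lambda>\<gamma>. pairing \<gamma> x) \<in> borel_measurable \<tau>" by (simp add: measurable_cong_sets[OF sets_eq refl])
  then have int: "integrable \<tau> ?F"
    by (rule integrable_mult_bounded[OF dual_density(1)[OF \<alpha> g], of _ 1]) simp
  have eq: "g \<gamma> \<bullet> (W_root \<alpha> \<gamma> *v (pairing \<gamma> x *s axis i c)) = Re (?F \<gamma> * c)" for \<gamma> c
  proof -
    have "pairing \<gamma> x *s axis i c = axis i (pairing \<gamma> x * c)"
      by (simp add: axis_def vec_eq_iff)
    then have "g \<gamma> \<bullet> (W_root \<alpha> \<gamma> *v (pairing \<gamma> x *s axis i c)) = (W_root \<alpha> \<gamma> *v g \<gamma>) \<bullet> axis i (pairing \<gamma> x * c)"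
      by (simp only: W_root_adjoint[OF pos])
    also have "(W_root \<alpha> \<gamma> *v g \<gamma>) \<bullet> axis i (pairing \<gamma> x * c) = Re (?F \<gamma> * c)"
      by (simp add: inner_axis inner_complex_def algebra_simps)
    finally show ?thesis .
  qed
  have zero: "Re ((LINT \<gamma>|\<tau>. ?F \<gamma>) * c) = 0" for c
  proof -
    have "(LINT \<gamma>|\<tau>. Re (?F \<gamma> * c)) = Re (LINT \<gamma>|\<tau>. ?F \<gamma> * c)"
      by (rule integral_Re) (use int in simp)
    also have "(LINT \<gamma>|\<tau>. ?F \<gamma> * c) = (LINT \<gamma>|\<tau>. ?F \<gamma>) * c"
      by (rule integral_mult_left_zero)
    finally show ?thesis
      using ann[OF trig_polynomial_monomial[OF x], of "axis i c"] by (simp only: eq)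
  qed
  show ?thesis using zero[of 1] zero[of \<i>] by (simp add: complex_eq_iff)
qed

text \<open>The AC property is applied to the vector measure with the densities \<open>cnj ((W_root \<alpha> g)\<^sub>i)\<close>.\<close>

lemma annihilator_vanishes_on_null_set:
  assumes \<alpha>: "1 < \<alpha>" and g: "g \<in> Lp_functions (\<alpha> / (\<alpha> - 1)) \<tau>"
    and ann: "\<And>t. t \<in> trig_polynomials E \<Longrightarrow> (LINT \<gamma>|\<tau>. g \<gamma> \<bullet> (W_root \<alpha> \<gamma> *v t \<gamma>)) = 0"
    and E: "AC_set TYPE('q) \<Lambda> E" and N: "N \<in> sets borel" "emeasure \<Lambda> N = 0"
  shows "AE \<gamma> in \<tau>. \<gamma> \<in> N \<longrightarrow> W_root \<alpha> \<gamma> *v g \<gamma> = 0"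
proof -
  define w where "w i \<gamma> = cnj ((W_root \<alpha> \<gamma> *v g \<gamma>) $ i)" for i \<gamma>
  have w: "integrable \<tau> (w i)" for i unfolding w_def by (rule dual_density(1)[OF \<alpha> g])
  have w0: "AE \<gamma> in \<tau>. re_trace (W \<gamma>) = 0 \<longrightarrow> w i \<gamma> = 0" for i
    using dual_density(2)[OF \<alpha> g] by eventually_elim (auto simp: w_def)
  define \<mu> where "\<mu> B = (\<chi> i. LINT \<gamma>:B|\<tau>. w i \<gamma>)" for B
  have "regular_vec \<mu>"
    unfolding regular_vec_def \<mu>_def using regular_integral[OF w w0] by simp
  moreover have "inverse_fourier_stieltjes \<mu> x = 0" if "x \<in> E" for x
    unfolding \<mu>_def inverse_fourier_stieltjes_density[OF sets_eq w]
    using fourier_coefficient_zero[OF \<alpha> g ann that] by (simp add: w_def vec_eq_iff)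
  ultimately have "abs_cont_vec \<Lambda> \<mu>" using E by (simp add: AC_set_def)
  then have "variation (\<lambda>B. LINT \<gamma>:B|\<tau>. w i \<gamma>) N = 0" for i
    using N by (simp add: abs_cont_vec_def abs_cont_cm_def \<mu>_def)
  then have "AE \<gamma> in \<tau>. \<gamma> \<in> N \<longrightarrow> w i \<gamma> = 0" for i
    by (rule AE_zero_if_variation_zero[OF sigma_finite_measure_axioms sets_eq w N(1)])
  then have "AE \<gamma> in \<tau>. \<forall>i. \<gamma> \<in> N \<longrightarrow> w i \<gamma> = 0" unfolding AE_all_countable by blast
  then show ?thesis by eventually_elim (simp add: w_def vec_eq_iff)
qed

end

theorem lemma4p3:
  fixes \<alpha> :: real
    and \<Lambda> \<tau> :: "'g::{topological_ab_group_add, t2_space} character measure"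
    and S :: "'g set"
    and M Ma Ms :: "'g character set \<Rightarrow> complex^'q^'q"
    and A :: "'g character set"
  assumes "1 < \<alpha>"
    and "locally_compact_space (euclidean :: 'g topology)"
    and "haar_measure \<Lambda>"
    and "S \<noteq> {}"
    and "regular_mat M"
    and "\<And>B. B \<in> sets borel \<Longrightarrow> psd (M B)"
    and "lebesgue_decomposition \<Lambda> M Ma Ms"
    and "A \<in> sets borel" and "Ma A = 0" and "Ms (- A) = 0"
    and "sigma_finite_measure \<tau>" and "sets \<tau> = sets borel" and "abs_cont_mat \<tau> M"
    and "AC_set TYPE('q) \<Lambda> (- S)"
  shows "L_restricted \<alpha> \<tau> M A \<subseteq> L_topology \<alpha> \<tau> M closure_of trig_classes \<tau> M (- S)"
proof
  note \<alpha> = \<open>1 < \<alpha>\<close>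
  interpret psd_character_measure \<tau> M
    using assms by (intro psd_character_measure.intro psd_matrix_measure.intro psd_matrix_measure_axioms.intro)
  have "sets \<Lambda> = sets borel" using \<open>haar_measure \<Lambda>\<close> by (simp add: haar_measure_def)
  then obtain N where N: "N \<in> sets borel" "emeasure \<Lambda> N = 0" "M (A - N) = 0"
    using singular_part_carrier[OF \<open>lebesgue_decomposition \<Lambda> M Ma Ms\<close> _ \<open>A \<in> sets borel\<close> \<open>Ma A = 0\<close>] by metis
  fix X assume "X \<in> L_restricted \<alpha> \<tau> M A"
  then obtain f where f: "f \<in> L_functions \<alpha> \<tau> M" and X: "X = M_equiv \<tau> M `` {\<lambda>\<gamma>. indicator A \<gamma> *s f \<gamma>}"
    by (auto simp: L_restricted_def)
  define h where "h \<gamma> = indicator A \<gamma> *s f \<gamma>" for \<gamma>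
  have h_if: "h \<gamma> = (if \<gamma> \<in> A then f \<gamma> else 0)" for \<gamma> by (simp add: h_def vec_eq_iff)
  have f_borel [measurable]: "f \<in> borel_measurable borel" using f by (simp add: L_functions_def)
  have h: "h \<in> L_functions \<alpha> \<tau> M"
  proof -
    have "h \<in> borel_measurable borel" unfolding h_if[abs_def] using \<open>A \<in> sets borel\<close> by measurable
    moreover have "L_integral \<alpha> \<tau> M h \<le> L_integral \<alpha> \<tau> M f"
      unfolding L_integral_def using \<alpha> by (intro nn_integral_mono) (simp add: h_if)
    ultimately show ?thesis using f by (auto simp: L_functions_def)
  qed
  let ?V = "(\<lambda>t \<gamma>. W_root \<alpha> \<gamma> *v t \<gamma>) ` trig_polynomials (- S)"
  have RLp: "(\<lambda>\<gamma>. W_root \<alpha> \<gamma> *v k \<gamma>) \<in> Lp_functions \<alpha> \<tau>" if "k \<in> L_functions \<alpha> \<tau> M" for k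
    using W_root_Lp(2)[OF \<alpha>, of k] that by (simp add: L_functions_def)
  have trig: "trig_polynomials (- S) \<subseteq> L_functions \<alpha> \<tau> M" using trig_in_L_functions[OF \<alpha>] by blast
  have approx: "\<exists>t\<in>trig_polynomials (- S). Lp_norm \<alpha> \<tau> (\<lambda>\<gamma>. W_root \<alpha> \<gamma> *v h \<gamma> - W_root \<alpha> \<gamma> *v t \<gamma>) < e" if e: "0 < e" for e
  proof -
    have "\<exists>v\<in>?V. Lp_norm \<alpha> \<tau> (\<lambda>\<gamma>. W_root \<alpha> \<gamma> *v h \<gamma> - v \<gamma>) < e"
    proof (rule Lp_approximable_if_annihilators_vanish[OF \<alpha> RLp[OF h] _ _ _ _ e])
      show "?V \<subseteq> Lp_functions \<alpha> \<tau>" using RLp trig by blast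
      show "?V \<noteq> {}" using trig_polynomial_zero by blast
      show "(\<lambda>\<gamma>. v \<gamma> + c *\<^sub>R w \<gamma>) \<in> ?V" if vw: "v \<in> ?V" "w \<in> ?V" for v w c
      proof -
        obtain s t where st: "s \<in> trig_polynomials (- S)" "t \<in> trig_polynomials (- S)"
          "v = (\<lambda>\<gamma>. W_root \<alpha> \<gamma> *v s \<gamma>)" "w = (\<lambda>\<gamma>. W_root \<alpha> \<gamma> *v t \<gamma>)" using vw by blast
        have "(\<lambda>\<gamma>. v \<gamma> + c *\<^sub>R w \<gamma>) = (\<lambda>\<gamma>. W_root \<alpha> \<gamma> *v (s \<gamma> + c *\<^sub>R t \<gamma>))"
          by (simp add: st matrix_vector_right_distrib matrix_vector_mult_scaleR)
        then show ?thesis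
          by (rule image_eqI[of _ _ "\<lambda>\<gamma>. s \<gamma> + c *\<^sub>R t \<gamma>", OF _ trig_polynomial_add[OF st(1,2)]])
      qed
      fix g :: "'g character \<Rightarrow> complex^'q" assume g: "g \<in> Lp_functions (\<alpha> / (\<alpha> - 1)) \<tau>"
        and ann: "\<And>v. v \<in> ?V \<Longrightarrow> (LINT \<gamma>|\<tau>. g \<gamma> \<bullet> v \<gamma>) = 0"
      have "AE \<gamma> in \<tau>. \<gamma> \<in> N \<longrightarrow> W_root \<alpha> \<gamma> *v g \<gamma> = 0"
        by (rule annihilator_vanishes_on_null_set[OF \<alpha> g _ \<open>AC_set TYPE('q) \<Lambda> (- S)\<close> N(1,2)]) (rule ann, rule imageI)
      \<comment> \<open>As \<open>M (A - N) = 0\<close> and the trace of \<open>M\<close> is monotone, the density vanishes on \<open>A - N\<close>.\<close>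
      moreover have "AE \<gamma> in \<tau>. \<gamma> \<in> A - N \<longrightarrow> re_trace (W \<gamma>) = 0"
        using N \<open>A \<in> sets borel\<close> by (intro trace_zero_AE) (auto simp: re_trace_def)
      ultimately have "AE \<gamma> in \<tau>. g \<gamma> \<bullet> (W_root \<alpha> \<gamma> *v h \<gamma>) = 0"
        using dual_density(2)[OF \<alpha> g]
      proof eventually_elim
        fix \<gamma> assume 1: "\<gamma> \<in> N \<longrightarrow> W_root \<alpha> \<gamma> *v g \<gamma> = 0" "\<gamma> \<in> A - N \<longrightarrow> re_trace (W \<gamma>) = 0"
          "re_trace (W \<gamma>) = 0 \<longrightarrow> W_root \<alpha> \<gamma> = 0"
        have adj: "g \<gamma> \<bullet> (W_root \<alpha> \<gamma> *v h \<gamma>) = (W_root \<alpha> \<gamma> *v g \<gamma>) \<bullet> h \<gamma>"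
          using \<alpha> W_root_adjoint[of \<alpha> \<gamma> "g \<gamma>" "h \<gamma>"] by simp
        consider "\<gamma> \<notin> A" | "\<gamma> \<in> N" | "\<gamma> \<in> A - N" by blast
        then show "g \<gamma> \<bullet> (W_root \<alpha> \<gamma> *v h \<gamma>) = 0"
        proof cases
          case 1
          then show ?thesis by (simp add: h_if)
        next
          case 2
          then show ?thesis using 1 by (simp add: adj)
        next
          case 3
          then show ?thesis using 1 by (simp add: adj)
        qed
      qed
      then show "(LINT \<gamma>|\<tau>. g \<gamma> \<bullet> (W_root \<alpha> \<gamma> *v h \<gamma>)) = 0" by (rule integral_eq_zero_AE)
    qed
    then show ?thesis by simp
  qed
  show "X \<in> L_topology \<alpha> \<tau> M closure_of trig_classes \<tau> M (- S)"
    unfolding X trig_classes_def h_def[symmetric]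
    by (rule class_in_closure[OF \<alpha> h trig approx])
qed

end
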